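(* If $\mathfrak{R}$ is a PCC expansion of $(\mathbb{R},<,+)$ generated by topological submanifolds, and $\mathfrak{R}$ is not o-minimal, then no expansion of $\mathfrak{R}$ has a decidable theory.
   Context: All structures are first-order structures with underlying set $\mathbb{R}$. "Definable" means definable with parameters; definable sets are subsets of $\mathbb{R}^n$ for arbitrary $n$. Each $\mathbb{R}^n$ has its usual topology and subsets carry the subspace topology. "Generated by topological submanifolds" means that $\mathfrak{R}$ is the expansion of $(\mathbb{R},<,+)$ by some collection of sets, each of which is a topological submanifold of some $\mathbb{R}^n$, i.e., a subset of $\mathbb{R}^n$ that is a topological manifold in the subspace topology. A structure on $\mathbb{R}$ is PCC (path-component closed) if for every definable set $E$, each path component of $E$ is definable. An expansion of $(\mathbb{R},<)$ is o-minimal if every definable subset of $\mathbb{R}$ is a finite union of points and open intervals. An expansion of $\mathfrak{R}$ is a structure on $\mathbb{R}$ in which every set definable in $\mathfrak{R}$ is definable. *)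

theory Defs
  imports "HOL-Analysis.Analysis" "HOL-Library.Nat_Bijection"
begin

section \<open>First-order structures with underlying set \<open>\<real>\<close>\<close>

datatype 'f tm = Var nat | Fn 'f "'f tm list"

datatype ('f, 'r) fm =
    Eq "'f tm" "'f tm"
  | Rel 'r "'f tm list"
  | Neg "('f, 'r) fm"
  | Conj "('f, 'r) fm" "('f, 'r) fm"
  | Ex nat "('f, 'r) fm"

text \<open>
  A point of \<open>\<real>\<^sup>n\<close> is, as in \<^const>\<open>Euclidean_space\<close>, a function \<open>nat \<Rightarrow> real\<close> that vanishes from
  index \<open>n\<close> on. The interpretations of a symbol of arity \<open>n\<close> only matter on \<open>\<real>\<^sup>n\<close>, so every value
  of the following type is a structure. The symbols of the language are the members of
  \<open>fun_syms\<close> and \<open>rel_syms\<close>; constants are function symbols of arity 0.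
\<close>

record ('f, 'r) real_structure =
  fun_syms :: "'f set"
  fun_arity :: "'f \<Rightarrow> nat"
  fun_interp :: "'f \<Rightarrow> (nat \<Rightarrow> real) \<Rightarrow> real"
  rel_syms :: "'r set"
  rel_arity :: "'r \<Rightarrow> nat"
  rel_interp :: "'r \<Rightarrow> (nat \<Rightarrow> real) set"

definition point_of :: "real list \<Rightarrow> nat \<Rightarrow> real" where
  "point_of xs = (\<lambda>i. if i < length xs then xs ! i else 0)"

fun wf_tm :: "('f, 'r) real_structure \<Rightarrow> 'f tm \<Rightarrow> bool" where
  "wf_tm M (Var v) \<longleftrightarrow> True"
| "wf_tm M (Fn f ts) \<longleftrightarrow>
     f \<in> fun_syms M \<and> length ts = fun_arity M f \<and> (\<forall>t\<in>set ts. wf_tm M t)"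

fun wf_fm :: "('f, 'r) real_structure \<Rightarrow> ('f, 'r) fm \<Rightarrow> bool" where
  "wf_fm M (Eq s t) \<longleftrightarrow> wf_tm M s \<and> wf_tm M t"
| "wf_fm M (Rel r ts) \<longleftrightarrow>
     r \<in> rel_syms M \<and> length ts = rel_arity M r \<and> (\<forall>t\<in>set ts. wf_tm M t)"
| "wf_fm M (Neg \<phi>) \<longleftrightarrow> wf_fm M \<phi>"
| "wf_fm M (Conj \<phi> \<psi>) \<longleftrightarrow> wf_fm M \<phi> \<and> wf_fm M \<psi>"
| "wf_fm M (Ex v \<phi>) \<longleftrightarrow> wf_fm M \<phi>"

fun fv_tm :: "'f tm \<Rightarrow> nat set" where
  "fv_tm (Var v) = {v}"
| "fv_tm (Fn f ts) = (\<Union>t\<in>set ts. fv_tm t)"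

fun fv_fm :: "('f, 'r) fm \<Rightarrow> nat set" where
  "fv_fm (Eq s t) = fv_tm s \<union> fv_tm t"
| "fv_fm (Rel r ts) = (\<Union>t\<in>set ts. fv_tm t)"
| "fv_fm (Neg \<phi>) = fv_fm \<phi>"
| "fv_fm (Conj \<phi> \<psi>) = fv_fm \<phi> \<union> fv_fm \<psi>"
| "fv_fm (Ex v \<phi>) = fv_fm \<phi> - {v}"

fun eval_tm :: "('f, 'r) real_structure \<Rightarrow> (nat \<Rightarrow> real) \<Rightarrow> 'f tm \<Rightarrow> real" where
  "eval_tm M e (Var v) = e v"
| "eval_tm M e (Fn f ts) = fun_interp M f (point_of (map (eval_tm M e) ts))"

fun sat :: "('f, 'r) real_structure \<Rightarrow> (nat \<Rightarrow> real) \<Rightarrow> ('f, 'r) fm \<Rightarrow> bool" where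
  "sat M e (Eq s t) \<longleftrightarrow> eval_tm M e s = eval_tm M e t"
| "sat M e (Rel r ts) \<longleftrightarrow> point_of (map (eval_tm M e) ts) \<in> rel_interp M r"
| "sat M e (Neg \<phi>) \<longleftrightarrow> \<not> sat M e \<phi>"
| "sat M e (Conj \<phi> \<psi>) \<longleftrightarrow> sat M e \<phi> \<and> sat M e \<psi>"
| "sat M e (Ex v \<phi>) \<longleftrightarrow> (\<exists>a. sat M (e(v := a)) \<phi>)"

text \<open>The values of \<open>p\<close> at indices \<open>\<ge> n\<close> are the parameters.\<close>

definition definable :: "('f, 'r) real_structure \<Rightarrow> nat \<Rightarrow> (nat \<Rightarrow> real) set \<Rightarrow> bool" where
  "definable M n E \<longleftrightarrow>
     (\<exists>\<phi> p. wf_fm M \<phi> \<and>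
        E = {x \<in> topspace (Euclidean_space n). sat M (\<lambda>i. if i < n then x i else p i) \<phi>})"

definition expansion_of :: "('g, 's) real_structure \<Rightarrow> ('f, 'r) real_structure \<Rightarrow> bool" where
  "expansion_of N M \<longleftrightarrow> (\<forall>n E. definable M n E \<longrightarrow> definable N n E)"

definition interdefinable :: "('g, 's) real_structure \<Rightarrow> ('f, 'r) real_structure \<Rightarrow> bool" where
  "interdefinable N M \<longleftrightarrow> expansion_of N M \<and> expansion_of M N"


section \<open>Topological submanifolds, and the structures they generate\<close>

definition topological_manifold :: "'a topology \<Rightarrow> bool" where
  "topological_manifold X \<longleftrightarrow>
     Hausdorff_space X \<and> second_countable X \<and>
     (\<exists>d. \<forall>x\<in>topspace X. \<exists>U V.
        openin X U \<and> x \<in> U \<and> openin (Euclidean_space d) V \<and>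
        subtopology X U homeomorphic_space subtopology (Euclidean_space d) V)"

definition topological_submanifold :: "nat \<Rightarrow> (nat \<Rightarrow> real) set \<Rightarrow> bool" where
  "topological_submanifold n S \<longleftrightarrow>
     S \<subseteq> topspace (Euclidean_space n) \<and>
     topological_manifold (subtopology (Euclidean_space n) S)"

datatype plus_sym = Plus

datatype rel_sym = Less | Member nat "(nat \<Rightarrow> real) set"

text \<open>
  The structure \<open>(\<real>, <, +, (S)\<^bsub>(n, S) \<in> \<S>\<^esub>)\<close>, with one \<open>n\<close>-ary relation symbol for each
  \<open>(n, S) \<in> \<S>\<close>.
\<close>

definition real_group_with :: "(nat \<times> (nat \<Rightarrow> real) set) set \<Rightarrow> (plus_sym, rel_sym) real_structure" where
  "real_group_with \<S> =
     \<lparr>fun_syms = {Plus},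
      fun_arity = (\<lambda>_. 2),
      fun_interp = (\<lambda>_ x. x 0 + x 1),
      rel_syms = insert Less {Member n S | n S. (n, S) \<in> \<S>},
      rel_arity = case_rel_sym 2 (\<lambda>n S. n),
      rel_interp = case_rel_sym {x. x 0 < x 1} (\<lambda>n S. S)\<rparr>"

definition real_group :: "(plus_sym, rel_sym) real_structure" where
  "real_group = real_group_with {}"

text \<open>Structures are compared through their definable sets, as in \<^const>\<open>expansion_of\<close>.\<close>

definition generated_by_topological_submanifolds :: "('f, 'r) real_structure \<Rightarrow> bool" where
  "generated_by_topological_submanifolds M \<longleftrightarrow>
     (\<exists>\<S>. (\<forall>(n, S)\<in>\<S>. topological_submanifold n S) \<and> interdefinable M (real_group_with \<S>))"

definition PCC :: "('f, 'r) real_structure \<Rightarrow> bool" where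
  "PCC M \<longleftrightarrow>
     (\<forall>n E. definable M n E \<longrightarrow>
        (\<forall>C\<in>path_components_of (subtopology (Euclidean_space n) E). definable M n C))"

text \<open>
  Defined for expansions of \<open>(\<real>, <)\<close>. Open intervals may be unbounded; \<open>\<real>\<^sup>1\<close> is identified
  with \<open>\<real>\<close> via the coordinate of index 0.
\<close>

definition o_minimal :: "('f, 'r) real_structure \<Rightarrow> bool" where
  "o_minimal M \<longleftrightarrow>
     (\<forall>E. definable M 1 E \<longrightarrow>
        (\<exists>\<I>. finite \<I> \<and>
             (\<forall>I\<in>\<I>. (\<exists>a. I = {a}) \<or> (open I \<and> is_interval I)) \<and>
             (\<lambda>x. x 0) ` E = \<Union>\<I>))"


section \<open>Decidable theories\<close>

text \<open>Partial recursive functions, with their graph as an inductive relation.\<close>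

datatype recfun =
    RZero
  | RSucc
  | RProj nat
  | RComp recfun "recfun list"
  | RPrec recfun recfun
  | RMin recfun

inductive computes :: "recfun \<Rightarrow> nat list \<Rightarrow> nat \<Rightarrow> bool" where
  "computes RZero xs 0"
| "computes RSucc [x] (Suc x)"
| "i < length xs \<Longrightarrow> computes (RProj i) xs (xs ! i)"
| "list_all2 (\<lambda>g y. computes g xs y) gs ys \<Longrightarrow> computes f ys z \<Longrightarrow> computes (RComp f gs) xs z"
| "computes f xs y \<Longrightarrow> computes (RPrec f g) (0 # xs) y"
| "computes (RPrec f g) (n # xs) y \<Longrightarrow> computes g (n # y # xs) z \<Longrightarrow>
     computes (RPrec f g) (Suc n # xs) z"
| "computes f (n # xs) 0 \<Longrightarrow> (\<forall>m<n. \<exists>y. computes f (m # xs) (Suc y)) \<Longrightarrow>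
     computes (RMin f) xs n"

definition recursive_set :: "nat set \<Rightarrow> bool" where
  "recursive_set A \<longleftrightarrow> (\<exists>f. \<forall>n. computes f [n] (if n \<in> A then 1 else 0))"

text \<open>Goedel numbers, relative to numberings \<open>cf\<close> and \<open>cr\<close> of the symbols.\<close>

fun tm_code :: "('f \<Rightarrow> nat) \<Rightarrow> 'f tm \<Rightarrow> nat" where
  "tm_code cf (Var v) = prod_encode (0, v)"
| "tm_code cf (Fn f ts) = prod_encode (1, prod_encode (cf f, list_encode (map (tm_code cf) ts)))"

fun fm_code :: "('f \<Rightarrow> nat) \<Rightarrow> ('r \<Rightarrow> nat) \<Rightarrow> ('f, 'r) fm \<Rightarrow> nat" where
  "fm_code cf cr (Eq s t) = prod_encode (0, prod_encode (tm_code cf s, tm_code cf t))"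
| "fm_code cf cr (Rel r ts) =
     prod_encode (1, prod_encode (cr r, list_encode (map (tm_code cf) ts)))"
| "fm_code cf cr (Neg \<phi>) = prod_encode (2, fm_code cf cr \<phi>)"
| "fm_code cf cr (Conj \<phi> \<psi>) =
     prod_encode (3, prod_encode (fm_code cf cr \<phi>, fm_code cf cr \<psi>))"
| "fm_code cf cr (Ex v \<phi>) = prod_encode (4, prod_encode (v, fm_code cf cr \<phi>))"

definition theory_of :: "('f, 'r) real_structure \<Rightarrow> ('f, 'r) fm set" where
  "theory_of M = {\<phi>. wf_fm M \<phi> \<and> fv_fm \<phi> = {} \<and> (\<forall>e. sat M e \<phi>)}"

text \<open>
  The language must admit a numbering by natural numbers (so it is countable) for which the
  theory is recursive. Arities need not be assumed recursive: \<open>r\<close> has arity \<open>k\<close> exactly if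
  \<open>\<forall>v\<^sub>1 \<dots> v\<^sub>k. r(v\<^sub>1, \<dots>, v\<^sub>k) \<or> \<not> r(v\<^sub>1, \<dots>, v\<^sub>k)\<close> belongs to the theory.
\<close>

definition has_decidable_theory :: "('f, 'r) real_structure \<Rightarrow> bool" where
  "has_decidable_theory M \<longleftrightarrow>
     (\<exists>cf cr. inj_on cf (fun_syms M) \<and> inj_on cr (rel_syms M) \<and>
        recursive_set (fm_code cf cr ` theory_of M))"

end

(*
  If G is a definable relation on a definable set D without nonconstant paths, then the classes of
  the equivalence relation generated by G are, up to coordinates, path components of a definable
  set. So PCC structures define the orbits of injective definable maps on such sets.

  If a definable subset E of the line witnesses the failure of o-minimality, its frontier is
  infinite. Either E is dense and codense in an interval, and then the graph of its characteristic
  function is a copy of the interval without paths, on which halving has an infinite discrete orbit;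
  or the endpoints or the lengths of the gaps of the frontier form an infinite discrete set. In each
  case there is a definable set of order type omega, and since its powers have no paths either,
  the orbits of suitable injective maps on them yield arithmetic, including the coding of finite
  sequences. Every expansion then interprets arithmetic with parameters and is undecidable.
*)
theory Submission
  imports Defs
begin

section \<open>Substitution of variables\<close>

text \<open>First-order formulas cannot iterate a map. PCC supplies the missing transitive closure,
  but only in the symmetric form \<open>(G \<union> G\<inverse>)\<^sup>*\<close>: backward steps are
  always included and could merge unrelated trajectories. Every walk used below is therefore chosen
  so that its invariant survives steps in both directions. A second obstacle is that only
  \<open><\<close> and \<open>+\<close> are given on the reals, and these say little about the
  positions of the elements of a discrete set. Its arithmetic is thus not inherited from the reals:
  the order yields the successor, and pairing and list access are read off from walks that count
  their own steps in successors.\<close>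

lemma eval_tm_cong: "(\<And>v. v \<in> fv_tm t \<Longrightarrow> e v = e' v) \<Longrightarrow> eval_tm M e t = eval_tm M e' t"
proof (induction t)
  case (Fn f ts)
  have "map (eval_tm M e) ts = map (eval_tm M e') ts"
    using Fn by (intro map_cong) auto
  then show ?case by (simp only: eval_tm.simps)
qed simp

lemma sat_cong: "(\<And>v. v \<in> fv_fm \<phi> \<Longrightarrow> e v = e' v) \<Longrightarrow> sat M e \<phi> = sat M e' \<phi>"
proof (induction \<phi> arbitrary: e e')
  case (Eq s t)
  have "eval_tm M e s = eval_tm M e' s" "eval_tm M e t = eval_tm M e' t"
    by (rule eval_tm_cong, simp add: Eq)+
  then show ?case by simp
next
  case (Rel r ts)
  have "map (eval_tm M e) ts = map (eval_tm M e') ts"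
    using Rel by (intro map_cong) (auto intro!: eval_tm_cong)
  then show ?case by (simp only: sat.simps)
next
  case (Neg \<phi>)
  have "sat M e \<phi> = sat M e' \<phi>" by (rule Neg.IH) (simp add: Neg.prems)
  then show ?case by simp
next
  case (Conj \<phi> \<psi>)
  have "sat M e \<phi> = sat M e' \<phi>" by (rule Conj.IH(1)) (simp add: Conj.prems)
  moreover have "sat M e \<psi> = sat M e' \<psi>" by (rule Conj.IH(2)) (simp add: Conj.prems)
  ultimately show ?case by simp
next
  case (Ex v \<phi>)
  have "sat M (e(v := a)) \<phi> = sat M (e'(v := a)) \<phi>" for a
    using Ex.prems by (intro Ex.IH) auto
  then show ?case by simp
qed

lemma finite_fv_tm: "finite (fv_tm t)"
  by (induction t) auto

lemma finite_fv_fm: "finite (fv_fm \<phi>)"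
  by (induction \<phi>) (auto simp: finite_fv_tm)

fun sub_tm :: "(nat \<Rightarrow> nat) \<Rightarrow> 'f tm \<Rightarrow> 'f tm" where
  "sub_tm \<rho> (Var v) = Var (\<rho> v)"
| "sub_tm \<rho> (Fn f ts) = Fn f (map (sub_tm \<rho>) ts)"

text \<open>\<open>\<rho>\<close> need not be injective, so bound variables are renamed to avoid
  capture: the new one exceeds the images of all variables free in the scope. Inserting 0 keeps
  \<open>Max\<close> meaningful when there are none.\<close>

fun sub_fm :: "(nat \<Rightarrow> nat) \<Rightarrow> ('f, 'r) fm \<Rightarrow> ('f, 'r) fm" where
  "sub_fm \<rho> (Eq s t) = Eq (sub_tm \<rho> s) (sub_tm \<rho> t)"
| "sub_fm \<rho> (Rel r ts) = Rel r (map (sub_tm \<rho>) ts)"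
| "sub_fm \<rho> (Neg \<phi>) = Neg (sub_fm \<rho> \<phi>)"
| "sub_fm \<rho> (Conj \<phi> \<psi>) = Conj (sub_fm \<rho> \<phi>) (sub_fm \<rho> \<psi>)"
| "sub_fm \<rho> (Ex v \<phi>) =
     (let w = Suc (Max (insert 0 (\<rho> ` fv_fm \<phi>))) in Ex w (sub_fm (\<rho>(v := w)) \<phi>))"

lemma wf_sub_tm: "wf_tm M (sub_tm \<rho> t) = wf_tm M t"
  by (induction t) auto

lemma wf_sub_fm: "wf_fm M (sub_fm \<rho> \<phi>) = wf_fm M \<phi>"
  by (induction \<phi> arbitrary: \<rho>) (auto simp: wf_sub_tm Let_def)

lemma fv_sub_tm: "fv_tm (sub_tm \<rho> t) = \<rho> ` fv_tm t"
  by (induction t) auto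

lemma fv_sub_fm: "fv_fm (sub_fm \<rho> \<phi>) \<subseteq> \<rho> ` fv_fm \<phi>"
proof (induction \<phi> arbitrary: \<rho>)
  case (Ex v \<phi>)
  define w where "w = Suc (Max (insert 0 (\<rho> ` fv_fm \<phi>)))"
  have "fv_fm (sub_fm (\<rho>(v := w)) \<phi>) \<subseteq> insert w (\<rho> ` (fv_fm \<phi> - {v}))"
    using Ex.IH[of "\<rho>(v := w)"] by (rule order_trans) (auto split: if_splits)
  then show ?case by (auto simp: Let_def w_def[symmetric])
next
  case (Conj \<phi> \<psi>)
  then show ?case by (simp add: image_Un) blast
qed (auto simp: fv_sub_tm)

lemma eval_sub_tm: "eval_tm M e (sub_tm \<rho> t) = eval_tm M (\<lambda>i. e (\<rho> i)) t"
proof (induction t)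
  case (Fn f ts)
  have "map (eval_tm M e \<circ> sub_tm \<rho>) ts = map (eval_tm M (\<lambda>i. e (\<rho> i))) ts"
    using Fn by (intro map_cong) auto
  then show ?case by (simp only: sub_tm.simps eval_tm.simps map_map)
qed simp

lemma sat_sub_fm: "sat M e (sub_fm \<rho> \<phi>) = sat M (\<lambda>i. e (\<rho> i)) \<phi>"
proof (induction \<phi> arbitrary: e \<rho>)
  case (Rel r ts)
  have "map (eval_tm M e \<circ> sub_tm \<rho>) ts = map (eval_tm M (\<lambda>i. e (\<rho> i))) ts"
    by (simp add: eval_sub_tm)
  then show ?case by (simp only: sub_fm.simps sat.simps map_map)
next
  case (Ex v \<phi>)
  define w where "w = Suc (Max (insert 0 (\<rho> ` fv_fm \<phi>)))"
  have fresh: "\<rho> u \<noteq> w" if "u \<in> fv_fm \<phi>" for u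
  proof -
    have "\<rho> u \<le> Max (insert 0 (\<rho> ` fv_fm \<phi>))"
      using that by (intro Max_ge) (auto simp: finite_fv_fm)
    then show ?thesis by (simp add: w_def)
  qed
  have "sat M (e(w := a)) (sub_fm (\<rho>(v := w)) \<phi>) = sat M ((\<lambda>i. e (\<rho> i))(v := a)) \<phi>" for a
    unfolding Ex.IH by (rule sat_cong) (use fresh in auto)
  then show ?case by (simp add: Let_def w_def[symmetric])
qed (auto simp: eval_sub_tm)


section \<open>Definable predicates\<close>

text \<open>
  Variables live at the even indices and parameters at the odd ones, so that there are infinitely
  many of both.
\<close>

definition interleave :: "(nat \<Rightarrow> 'a) \<Rightarrow> (nat \<Rightarrow> 'a) \<Rightarrow> nat \<Rightarrow> 'a" where
  "interleave e p = (\<lambda>i. if even i then e (i div 2) else p (i div 2))"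

lemma interleave_simps [simp]:
  "interleave e p (2 * i) = e i" "interleave e p (Suc (2 * i)) = p i"
  "interleave e p 0 = e 0" "interleave e p (Suc 0) = p 0"
  by (auto simp: interleave_def)

text \<open>The formula is chosen before the parameters \<open>p\<close>. The diagonal argument
  depends on this order, since it quantifies over the parameters inside a sentence.\<close>

definition uniformly_def ::
  "('f, 'r) real_structure \<Rightarrow> ((nat \<Rightarrow> real) \<Rightarrow> (nat \<Rightarrow> real) \<Rightarrow> bool) \<Rightarrow> bool" where
  "uniformly_def M Q \<longleftrightarrow>
     (\<exists>\<phi>. wf_fm M \<phi> \<and> (\<forall>p e. Q p e \<longleftrightarrow> sat M (interleave e p) \<phi>))"

lemma uniformly_defI:
  "wf_fm M \<phi> \<Longrightarrow> (\<And>p e. Q p e \<longleftrightarrow> sat M (interleave e p) \<phi>) \<Longrightarrow> uniformly_def M Q"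
  unfolding uniformly_def_def by blast

lemma uniformly_defE:
  assumes "uniformly_def M Q"
  obtains \<phi> where "wf_fm M \<phi>" "\<And>p e. Q p e \<longleftrightarrow> sat M (interleave e p) \<phi>"
  using assms unfolding uniformly_def_def by blast

lemma uniformly_def_not:
  assumes "uniformly_def M P"
  shows "uniformly_def M (\<lambda>p e. \<not> P p e)"
proof -
  obtain \<phi> where "wf_fm M \<phi>" "\<And>p e. P p e \<longleftrightarrow> sat M (interleave e p) \<phi>"
    using uniformly_defE[OF assms] by blast
  then show ?thesis by (intro uniformly_defI[of M "Neg \<phi>"]) auto
qed

lemma uniformly_def_conj:
  assumes "uniformly_def M P" "uniformly_def M Q"
  shows "uniformly_def M (\<lambda>p e. P p e \<and> Q p e)"
proof -
  obtain \<phi> where "wf_fm M \<phi>" "\<And>p e. P p e \<longleftrightarrow> sat M (interleave e p) \<phi>"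
    using uniformly_defE[OF assms(1)] by blast
  moreover obtain \<psi> where "wf_fm M \<psi>" "\<And>p e. Q p e \<longleftrightarrow> sat M (interleave e p) \<psi>"
    using uniformly_defE[OF assms(2)] by blast
  ultimately show ?thesis by (intro uniformly_defI[of M "Conj \<phi> \<psi>"]) auto
qed

lemma uniformly_def_disj:
  assumes "uniformly_def M P" "uniformly_def M Q"
  shows "uniformly_def M (\<lambda>p e. P p e \<or> Q p e)"
  using uniformly_def_not[OF uniformly_def_conj[OF assms[THEN uniformly_def_not]]] by simp

lemma uniformly_def_imp:
  assumes "uniformly_def M P" "uniformly_def M Q"
  shows "uniformly_def M (\<lambda>p e. P p e \<longrightarrow> Q p e)"
  unfolding imp_conv_disj by (rule uniformly_def_disj[OF uniformly_def_not[OF assms(1)] assms(2)])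

lemma uniformly_def_iff:
  assumes "uniformly_def M P" "uniformly_def M Q"
  shows "uniformly_def M (\<lambda>p e. P p e \<longleftrightarrow> Q p e)"
  unfolding iff_conv_conj_imp
  by (rule uniformly_def_conj[OF uniformly_def_imp[OF assms] uniformly_def_imp[OF assms(2,1)]])

text \<open>Both substitutions read from the joint interleaved environment, so a variable may be
  replaced by a parameter and conversely.\<close>

lemma uniformly_def_subst:
  assumes "uniformly_def M Q"
  shows "uniformly_def M (\<lambda>p e. Q (\<lambda>i. interleave e p (\<rho> i)) (\<lambda>i. interleave e p (\<sigma> i)))"
proof -
  obtain \<phi> where \<phi>: "wf_fm M \<phi>" "\<And>p e. Q p e \<longleftrightarrow> sat M (interleave e p) \<phi>"
    using uniformly_defE[OF assms] by blast
  define \<tau> where "\<tau> = interleave \<sigma> \<rho>"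
  have "(\<lambda>j. interleave e p (\<tau> j)) =
      interleave (\<lambda>i. interleave e p (\<sigma> i)) (\<lambda>i. interleave e p (\<rho> i))" for e p :: "nat \<Rightarrow> real"
    by (auto simp: \<tau>_def interleave_def)
  then show ?thesis
    by (intro uniformly_defI[of M "sub_fm \<tau> \<phi>"]) (simp_all only: \<phi> wf_sub_fm sat_sub_fm)
qed

text \<open>
  Quantifiers are treated in de Bruijn style: passing under one shifts the variables, so that no
  freshness conditions arise.
\<close>

lemma uniformly_def_ex:
  assumes "uniformly_def M (\<lambda>p e. Q p (\<lambda>i. e (Suc i)) (e 0))"
  shows "uniformly_def M (\<lambda>p e. \<exists>a. Q p e a)"
proof -
  obtain \<phi> where \<phi>: "wf_fm M \<phi>"
      "\<And>p e. Q p (\<lambda>i. e (Suc i)) (e 0) \<longleftrightarrow> sat M (interleave e p) \<phi>"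
    using uniformly_defE[OF assms] by blast
  define w where "w = Suc (Max (insert 0 (fv_fm \<phi>)))"
  have w: "v < w" if "v \<in> fv_fm \<phi>" for v
    unfolding w_def less_Suc_eq_le using that by (intro Max_ge) (auto simp: finite_fv_fm)
  \<comment> \<open>This undoes the de Bruijn shift: the quantified variable moves from index 0 to
    the fresh \<open>w\<close>, the other variables move down by one variable, that is by two
    indices, and the parameters at odd indices stay.\<close>
  define \<rho> where "\<rho> j = (if j = 0 then w else if even j then j - 2 else j)" for j :: nat
  have "Q p e a \<longleftrightarrow> sat M ((interleave e p)(w := a)) (sub_fm \<rho> \<phi>)" for p e a
  proof -
    have "Q p e a \<longleftrightarrow> sat M (interleave (case_nat a e) p) \<phi>"
      using \<phi>(2)[of p "case_nat a e"] by simp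
    also have "\<dots> \<longleftrightarrow> sat M (\<lambda>j. ((interleave e p)(w := a)) (\<rho> j)) \<phi>"
    proof (rule sat_cong)
      fix v assume v: "v \<in> fv_fm \<phi>"
      show "interleave (case_nat a e) p v = ((interleave e p)(w := a)) (\<rho> v)"
      proof (cases "v = 0")
        case False
        then have "\<rho> v \<noteq> w" using w[OF v] by (auto simp: \<rho>_def)
        moreover have "interleave (case_nat a e) p v = interleave e p (\<rho> v)"
        proof (cases "even v")
          case True
          then obtain k where "v = 2 * Suc k"
            using False by (metis evenE mult_0_right not0_implies_Suc)
          then show ?thesis by (simp add: \<rho>_def) (simp add: interleave_def)
        next
          case odd: False
          then show ?thesis by (auto simp: \<rho>_def interleave_def)
        qed
        ultimately show ?thesis by simp
      qed (simp add: \<rho>_def)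
    qed
    finally show ?thesis by (simp add: sat_sub_fm)
  qed
  then show ?thesis
    by (intro uniformly_defI[of M "Ex w (sub_fm \<rho> \<phi>)"]) (auto simp: \<phi> wf_sub_fm)
qed

lemma uniformly_def_all:
  assumes "uniformly_def M (\<lambda>p e. Q p (\<lambda>i. e (Suc i)) (e 0))"
  shows "uniformly_def M (\<lambda>p e. \<forall>a. Q p e a)"
  using uniformly_def_not[OF uniformly_def_ex[of M "\<lambda>p e a. \<not> Q p e a",
        OF uniformly_def_not[OF assms]]] by simp

text \<open>Arguments of definable predicates are plain reads of one variable or parameter. Compound
  terms are instead unfolded with quantifiers over graphs.\<close>

definition is_var :: "((nat \<Rightarrow> real) \<Rightarrow> (nat \<Rightarrow> real) \<Rightarrow> real) \<Rightarrow> bool" where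
  "is_var f \<longleftrightarrow> (\<exists>j. \<forall>p e. f p e = interleave e p j)"

lemma is_var_simps: "is_var (\<lambda>p e. e i)" "is_var (\<lambda>p e. p i)"
  unfolding is_var_def by (metis interleave_simps(1), metis interleave_simps(2))

lemma uniformly_def_inst:
  assumes "uniformly_def M P" "\<And>i. is_var (s i)"
  shows "uniformly_def M (\<lambda>p e. P p (\<lambda>i. s i p e))"
proof -
  obtain \<sigma> where \<sigma>: "\<And>i p e. s i p e = interleave e p (\<sigma> i)"
    using assms(2) unfolding is_var_def by metis
  have "uniformly_def M (\<lambda>p e. P (\<lambda>i. interleave e p (Suc (2 * i))) (\<lambda>i. interleave e p (\<sigma> i)))"
    by (rule uniformly_def_subst[OF assms(1)])
  then show ?thesis by (simp add: \<sigma>)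
qed

lemma uniformly_def_inst1:
  assumes "uniformly_def M (\<lambda>p e. P p (e 0))" "is_var f"
  shows "uniformly_def M (\<lambda>p e. P p (f p e))"
  using uniformly_def_inst[OF assms(1), of "\<lambda>_. f"] assms(2) by simp

lemma uniformly_def_inst2:
  assumes "uniformly_def M (\<lambda>p e. P p (e 0) (e 1))" "is_var f" "is_var g"
  shows "uniformly_def M (\<lambda>p e. P p (f p e) (g p e))"
  using uniformly_def_inst[OF assms(1), of "\<lambda>i. if i = 0 then f else g"] assms(2,3) by simp

lemma uniformly_def_inst3:
  assumes "uniformly_def M (\<lambda>p e. P p (e 0) (e 1) (e 2))" "is_var f" "is_var g" "is_var h"
  shows "uniformly_def M (\<lambda>p e. P p (f p e) (g p e) (h p e))"
  using uniformly_def_inst[OF assms(1), of "\<lambda>i. if i = 0 then f else if i = 1 then g else h"]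
    assms(2-4) by simp

lemma uniformly_def_eq:
  assumes "is_var f" "is_var g"
  shows "uniformly_def M (\<lambda>p e. f p e = g p e)"
proof -
  obtain i j where "\<And>p e. f p e = interleave e p i" "\<And>p e. g p e = interleave e p j"
    using assms unfolding is_var_def by metis
  then show ?thesis by (intro uniformly_defI[of M "Eq (Var i) (Var j)"]) auto
qed

lemma uniformly_def_const: "uniformly_def M (\<lambda>p e. b)"
proof (cases b)
  case True
  then show ?thesis by (intro uniformly_defI[of M "Eq (Var 0) (Var 0)"]) auto
next
  case False
  then show ?thesis by (intro uniformly_defI[of M "Neg (Eq (Var 0) (Var 0))"]) auto
qed

section \<open>Predicates definable with fixed parameters\<close>

definition defp :: "('f, 'r) real_structure \<Rightarrow> ((nat \<Rightarrow> real) \<Rightarrow> bool) \<Rightarrow> bool" where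
  "defp M P \<longleftrightarrow> (\<exists>Q p. uniformly_def M Q \<and> P = Q p)"

lemma defpI: "uniformly_def M Q \<Longrightarrow> (\<And>e. P e \<longleftrightarrow> Q p e) \<Longrightarrow> defp M P"
  unfolding defp_def by blast

lemma defpE:
  assumes "defp M P"
  obtains Q p where "uniformly_def M Q" "\<And>e. P e \<longleftrightarrow> Q p e"
  using assms unfolding defp_def by blast

lemma defp_not:
  assumes "defp M P"
  shows "defp M (\<lambda>e. \<not> P e)"
proof -
  obtain Q p where "uniformly_def M Q" "\<And>e. P e \<longleftrightarrow> Q p e"
    using defpE[OF assms] by blast
  then show ?thesis
    by (intro defpI[where Q = "\<lambda>p e. \<not> Q p e" and p = p]) (auto intro: uniformly_def_not)
qed

lemma uniformly_def_reindex_params: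
  assumes "uniformly_def M Q"
  shows "uniformly_def M (\<lambda>p e. Q (\<lambda>i. p (\<rho> i)) e)"
  using uniformly_def_subst[OF assms, of "\<lambda>i. Suc (2 * \<rho> i)" "\<lambda>i. 2 * i"] by simp

lemma defp_conj:
  assumes "defp M P" "defp M P'"
  shows "defp M (\<lambda>e. P e \<and> P' e)"
proof -
  obtain Q p where Q: "uniformly_def M Q" "\<And>e. P e \<longleftrightarrow> Q p e"
    using defpE[OF assms(1)] by blast
  obtain Q' p' where Q': "uniformly_def M Q'" "\<And>e. P' e \<longleftrightarrow> Q' p' e"
    using defpE[OF assms(2)] by blast
  show ?thesis
  proof (rule defpI)
    \<comment> \<open>The two predicates come with their own parameters, which are merged into one
      sequence by interleaving.\<close>
    show "uniformly_def M (\<lambda>p e. Q (\<lambda>i. p (2 * i)) e \<and> Q' (\<lambda>i. p (Suc (2 * i))) e)"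
      by (rule uniformly_def_conj[OF uniformly_def_reindex_params uniformly_def_reindex_params])
        (fact Q(1) Q'(1))+
    show "P e \<and> P' e \<longleftrightarrow> Q (\<lambda>i. interleave p p' (2 * i)) e
        \<and> Q' (\<lambda>i. interleave p p' (Suc (2 * i))) e" for e
      by (simp add: Q(2) Q'(2))
  qed
qed

lemma defp_disj:
  assumes "defp M P" "defp M Q"
  shows "defp M (\<lambda>e. P e \<or> Q e)"
  using defp_not[OF defp_conj[OF assms[THEN defp_not]]] by simp

lemma defp_imp:
  assumes "defp M P" "defp M Q"
  shows "defp M (\<lambda>e. P e \<longrightarrow> Q e)"
  unfolding imp_conv_disj by (rule defp_disj[OF defp_not[OF assms(1)] assms(2)])

lemma defp_ex:
  assumes "defp M (\<lambda>e. P (\<lambda>i. e (Suc i)) (e 0))"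
  shows "defp M (\<lambda>e. \<exists>a. P e a)"
proof -
  obtain Q p where Q: "uniformly_def M Q" "\<And>e. P (\<lambda>i. e (Suc i)) (e 0) \<longleftrightarrow> Q p e"
    using defpE[OF assms] by blast
  have eq: "case_nat (e 0) (\<lambda>i. e (Suc i)) = e" for e :: "nat \<Rightarrow> real"
    by (auto split: nat.split)
  have "uniformly_def M (\<lambda>p e. \<exists>a. Q p (case_nat a e))"
    by (rule uniformly_def_ex) (use Q(1) in \<open>simp add: eq\<close>)
  moreover have "(\<exists>a. P e a) \<longleftrightarrow> (\<exists>a. Q p (case_nat a e))" for e
    by (simp flip: Q(2))
  ultimately show ?thesis by (rule defpI)
qed

lemma defp_all:
  assumes "defp M (\<lambda>e. P (\<lambda>i. e (Suc i)) (e 0))"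
  shows "defp M (\<lambda>e. \<forall>a. P e a)"
  using defp_not[OF defp_ex[of M "\<lambda>e a. \<not> P e a", OF defp_not[OF assms]]] by simp

definition is_atom :: "((nat \<Rightarrow> real) \<Rightarrow> real) \<Rightarrow> bool" where
  "is_atom f \<longleftrightarrow> (\<exists>i. f = (\<lambda>e. e i)) \<or> (\<exists>c. f = (\<lambda>_. c))"

lemma is_atom_simps: "is_atom (\<lambda>e. e i)" "is_atom (\<lambda>e. c)"
  unfolding is_atom_def by blast+

lemma defp_inst:
  assumes "defp M P" "\<And>i. is_atom (s i)"
  shows "defp M (\<lambda>e. P (\<lambda>i. s i e))"
proof -
  obtain Q p where Q: "uniformly_def M Q" "\<And>e. P e \<longleftrightarrow> Q p e"
    using defpE[OF assms(1)] by blast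
  define isv where "isv i \<longleftrightarrow> (\<exists>j. s i = (\<lambda>e. e j))" for i
  define v where "v i = (SOME j. s i = (\<lambda>e. e j))" for i
  define c where "c i = (SOME c. s i = (\<lambda>_. c))" for i
  have v: "s i = (\<lambda>e. e (v i))" if "isv i" for i
    using that unfolding isv_def v_def by (rule someI_ex)
  have c: "s i = (\<lambda>_. c i)" if "\<not> isv i" for i
    unfolding c_def by (rule someI_ex) (use that assms(2)[of i] in \<open>auto simp: isv_def is_atom_def\<close>)
  \<comment> \<open>Constants become additional parameters: old parameters sit at the even places
    and constants at the odd places of the new parameter sequence, which itself occupies the odd
    indices of the environment.\<close>
  have "(\<lambda>i. interleave e (interleave p c)
           (if isv i then 2 * v i else Suc (2 * Suc (2 * i)))) = (\<lambda>i. s i e)" for e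
    by (rule ext) (simp only: interleave_simps v c split: if_splits, metis interleave_simps(1,2) v c)
  moreover have "(\<lambda>i. interleave e (interleave p c) (Suc (2 * (2 * i)))) = p" for e
    by (simp only: interleave_simps)
  ultimately have "P (\<lambda>i. s i e) \<longleftrightarrow> Q (\<lambda>i. interleave e (interleave p c) (Suc (2 * (2 * i))))
      (\<lambda>i. interleave e (interleave p c) (if isv i then 2 * v i else Suc (2 * Suc (2 * i))))" for e
    by (simp only: Q(2))
  with uniformly_def_subst[OF Q(1), of "\<lambda>i. Suc (2 * (2 * i))"
      "\<lambda>i. if isv i then 2 * v i else Suc (2 * Suc (2 * i))"]
  show ?thesis by (rule defpI)
qed

lemma defp_inst1:
  assumes "defp M (\<lambda>e. P (e 0))" "is_atom f"
  shows "defp M (\<lambda>e. P (f e))"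
  using defp_inst[OF assms(1), of "\<lambda>_. f"] assms(2) by simp

lemma defp_inst2:
  assumes "defp M (\<lambda>e. P (e 0) (e 1))" "is_atom f" "is_atom g"
  shows "defp M (\<lambda>e. P (f e) (g e))"
  using defp_inst[OF assms(1), of "\<lambda>i. if i = 0 then f else g"] assms(2,3) by simp

lemma defp_inst3:
  assumes "defp M (\<lambda>e. P (e 0) (e 1) (e 2))" "is_atom f" "is_atom g" "is_atom h"
  shows "defp M (\<lambda>e. P (f e) (g e) (h e))"
  using defp_inst[OF assms(1), of "\<lambda>i. if i = 0 then f else if i = 1 then g else h"]
    assms(2-4) by simp

lemma defp_const: "defp M (\<lambda>e. b)"
  by (rule defpI[OF uniformly_def_const[of M b]]) auto

lemma defp_eq:
  assumes "is_atom f" "is_atom g"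
  shows "defp M (\<lambda>e. f e = g e)"
proof -
  have "defp M (\<lambda>e. e 0 = e 1)"
    by (rule defpI[OF uniformly_def_eq[OF is_var_simps(1) is_var_simps(1)]]) auto
  from defp_inst2[OF this assms] show ?thesis .
qed

section \<open>Definable sets and definable predicates\<close>

definition trunc :: "nat \<Rightarrow> (nat \<Rightarrow> real) \<Rightarrow> nat \<Rightarrow> real" where
  "trunc n e = (\<lambda>i. if i < n then e i else 0)"

lemma in_Euclidean_space_iff: "x \<in> topspace (Euclidean_space n) \<longleftrightarrow> (\<forall>i\<ge>n. x i = 0)"
  by (simp add: topspace_Euclidean_space)

lemma trunc_in_Euclidean_space: "trunc n e \<in> topspace (Euclidean_space n)"
  by (simp add: in_Euclidean_space_iff trunc_def)

lemma defp_imp_definable: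
  assumes "defp M P"
  shows "definable M n {x \<in> topspace (Euclidean_space n). P x}"
proof -
  obtain Q p where Q: "uniformly_def M Q" "\<And>e. P e \<longleftrightarrow> Q p e"
    using defpE[OF assms] by blast
  obtain \<phi> where \<phi>: "wf_fm M \<phi>" "\<And>p e. Q p e \<longleftrightarrow> sat M (interleave e p) \<phi>"
    using uniformly_defE[OF Q(1)] by blast
  \<comment> \<open>Coordinates from \<open>n\<close> on vanish on the space, so all variables
    beyond the dimension share the single slot \<open>n\<close>, which holds 0. The parameters
    follow from slot \<open>Suc n\<close> on.\<close>
  define \<rho> where "\<rho> = interleave (\<lambda>i. if i < n then i else n) (\<lambda>i. Suc n + i)"
  define q where "q i = (if i = n then 0 else p (i - Suc n))" for i
  have "(\<lambda>i. if \<rho> i < n then x (\<rho> i) else q (\<rho> i)) = interleave x p"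
    if "x \<in> topspace (Euclidean_space n)" for x
  proof
    fix i
    show "(if \<rho> i < n then x (\<rho> i) else q (\<rho> i)) = interleave x p i"
      using that by (auto simp: in_Euclidean_space_iff \<rho>_def q_def interleave_def)
  qed
  then have "{x \<in> topspace (Euclidean_space n). P x} = {x \<in> topspace (Euclidean_space n).
      sat M (\<lambda>i. if i < n then x i else q i) (sub_fm \<rho> \<phi>)}"
    by (auto simp: sat_sub_fm Q \<phi>)
  then show ?thesis
    unfolding definable_def by (intro exI[of _ "sub_fm \<rho> \<phi>"] exI[of _ q]) (auto simp: wf_sub_fm \<phi>)
qed

lemma definable_imp_defp:
  assumes "definable M n E"
  shows "defp M (\<lambda>e. trunc n e \<in> E)"
proof -
  obtain \<phi> p where \<phi>: "wf_fm M \<phi>"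
    "E = {x \<in> topspace (Euclidean_space n). sat M (\<lambda>i. if i < n then x i else p i) \<phi>}"
    using assms unfolding definable_def by blast
  define \<rho> where "\<rho> i = (if i < n then 2 * i else Suc (2 * i))" for i
  have "(\<lambda>i. interleave e p (\<rho> i)) = (\<lambda>i. if i < n then trunc n e i else p i)" for e
    by (auto simp: \<rho>_def trunc_def)
  then have "trunc n e \<in> E \<longleftrightarrow> sat M (interleave e p) (sub_fm \<rho> \<phi>)" for e
    by (simp add: \<phi>(2) trunc_in_Euclidean_space sat_sub_fm)
  moreover have "uniformly_def M (\<lambda>p e. sat M (interleave e p) (sub_fm \<rho> \<phi>))"
    by (rule uniformly_defI[of M "sub_fm \<rho> \<phi>"]) (auto simp: wf_sub_fm \<phi>(1))
  ultimately show ?thesis by (intro defpI)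
qed

text \<open>\<open>expansion_of\<close> compares sets of a given finite dimension, so a predicate is
  transferred only if it depends on finitely many variables.\<close>

lemma defp_expansion:
  assumes "expansion_of N M" "defp M P" "\<And>e. P (trunc n e) = P e"
  shows "defp N P"
proof -
  have "definable N n {x \<in> topspace (Euclidean_space n). P x}"
    using assms(1) defp_imp_definable[OF assms(2)] unfolding expansion_of_def by blast
  from definable_imp_defp[OF this] show ?thesis
    by (simp add: trunc_in_Euclidean_space assms(3))
qed

lemma defp_real_group:
  assumes "expansion_of M real_group"
  shows "defp M (\<lambda>e. e 0 < e 1)" "defp M (\<lambda>e. e 0 + e 1 = e 2)"
proof -
  have "definable real_group 2 {x \<in> topspace (Euclidean_space 2). x 0 < x 1}"
    unfolding definable_def
    by (rule exI[of _ "Rel Less [Var 0, Var 1]"])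
      (auto simp: real_group_def real_group_with_def point_of_def)
  then have "definable M 2 {x \<in> topspace (Euclidean_space 2). x 0 < x 1}"
    using assms unfolding expansion_of_def by blast
  from definable_imp_defp[OF this] show "defp M (\<lambda>e. e 0 < e 1)"
    by (simp add: trunc_in_Euclidean_space) (simp add: trunc_def)
  have "definable real_group 3 {x \<in> topspace (Euclidean_space 3). x 0 + x 1 = x 2}"
    unfolding definable_def
    by (rule exI[of _ "Eq (Fn Plus [Var 0, Var 1]) (Var 2)"])
      (auto simp: real_group_def real_group_with_def point_of_def)
  then have "definable M 3 {x \<in> topspace (Euclidean_space 3). x 0 + x 1 = x 2}"
    using assms unfolding expansion_of_def by blast
  from definable_imp_defp[OF this] show "defp M (\<lambda>e. e 0 + e 1 = e 2)"
    by (simp add: trunc_in_Euclidean_space) (simp add: trunc_def)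
qed

lemmas uniformly_def_intros = uniformly_def_not uniformly_def_conj uniformly_def_disj
  uniformly_def_imp uniformly_def_iff uniformly_def_ex uniformly_def_all uniformly_def_eq
  is_var_simps

lemmas defp_intros = defp_not defp_conj defp_disj defp_imp defp_ex defp_all defp_eq is_atom_simps

section \<open>Orbits as path components\<close>

text \<open>\<open>Euclidean_space n\<close> carries the subspace topology of a product, so
  continuity can be tested coordinatewise.\<close>

lemma pathin_Euclidean_space_iff:
  "pathin (subtopology (Euclidean_space n) E) g \<longleftrightarrow>
     (\<forall>i. continuous_on {0..1} (\<lambda>t. g t i)) \<and> (\<forall>t\<in>{0..1}. g t \<in> E \<and> g t \<in> topspace (Euclidean_space n))"
  unfolding pathin_def Euclidean_space_def subtopology_subtopology continuous_map_in_subtopology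
    continuous_map_componentwise_UNIV topspace_subtopology
  by (auto simp: image_subset_iff Pi_iff)

text \<open>Arbitrary parameter intervals are allowed so that the property applies directly to a
  restriction of a path.\<close>

definition no_paths :: "(nat \<Rightarrow> real) set \<Rightarrow> bool" where
  "no_paths D \<longleftrightarrow> (\<forall>g a b. a \<le> b \<longrightarrow> (\<forall>i. continuous_on {a..b::real} (\<lambda>t. g t i)) \<longrightarrow>
     (\<forall>t\<in>{a..b}. g t \<in> D) \<longrightarrow> g a = g b)"

definition snd_block :: "nat \<Rightarrow> (nat \<Rightarrow> real) \<Rightarrow> nat \<Rightarrow> real" where
  "snd_block m w = (\<lambda>i. if i < m then w (m + i) else 0)"

definition blocks :: "nat \<Rightarrow> (nat \<Rightarrow> real) \<Rightarrow> (nat \<Rightarrow> real) \<Rightarrow> real \<Rightarrow> nat \<Rightarrow> real" where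
  "blocks m x y t = (\<lambda>i. if i < m then x i else if i < 2 * m then y (i - m)
     else if i = 2 * m then t else 0)"

lemma blocks_simps:
  "x \<in> topspace (Euclidean_space m) \<Longrightarrow> trunc m (blocks m x y t) = x"
  "y \<in> topspace (Euclidean_space m) \<Longrightarrow> snd_block m (blocks m x y t) = y"
  "blocks m x y t (2 * m) = t"
  "blocks m x y t \<in> topspace (Euclidean_space (Suc (2 * m)))"
  by (auto simp: blocks_def trunc_def snd_block_def in_Euclidean_space_iff)

lemma blocks_convex:
  "(1 - s) * blocks m x y t i + s * blocks m x' y' t' i =
   blocks m (\<lambda>i. (1 - s) * x i + s * x' i) (\<lambda>i. (1 - s) * y i + s * y' i) ((1 - s) * t + s * t') i"
  by (simp add: blocks_def)

lemma segment_path_component_of: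
  assumes "\<And>t. t \<in> {0..1} \<Longrightarrow> (\<lambda>i. (1 - t) * a i + t * b i) \<in> W \<inter> topspace (Euclidean_space n)"
  shows "path_component_of (subtopology (Euclidean_space n) W) a b"
  unfolding path_component_of_def
  by (rule exI[of _ "\<lambda>t i. (1 - t) * a i + t * b i"])
    (use assms in \<open>auto simp: pathin_Euclidean_space_iff intro!: continuous_intros\<close>)

lemma defp_all_less:
  assumes "\<And>i. defp M (P i)"
  shows "defp M (\<lambda>e. \<forall>i<m::nat. P i e)"
proof (induction m)
  case 0
  then show ?case using defp_const[of M True] by simp
next
  case (Suc m)
  have "(\<lambda>e. \<forall>i<Suc m. P i e) = (\<lambda>e. P m e \<and> (\<forall>i<m. P i e))"
    by (auto simp: less_Suc_eq)
  then show ?case using defp_conj[OF assms Suc.IH] by simp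
qed

text \<open>
  Over \<open>t < 1\<close> the first block runs through \<open>D\<close> and hence is locally constant along a path, over
  \<open>t > 0\<close> the second block is, and in between they are related by \<open>G\<close>. So the path components are
  the equivalence classes generated by \<open>G\<close>.
\<close>

definition orbit_space ::
  "nat \<Rightarrow> (nat \<Rightarrow> real) set \<Rightarrow> ((nat \<Rightarrow> real) \<times> (nat \<Rightarrow> real)) set \<Rightarrow> (nat \<Rightarrow> real) set" where
  "orbit_space m D G = {w \<in> topspace (Euclidean_space (Suc (2 * m))).
     0 \<le> w (2 * m) \<and> w (2 * m) \<le> 1 \<and>
     (w (2 * m) < 1 \<longrightarrow> trunc m w \<in> D) \<and>
     (0 < w (2 * m) \<longrightarrow> snd_block m w \<in> D) \<and>
     (0 < w (2 * m) \<and> w (2 * m) < 1 \<longrightarrow>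
        (trunc m w, snd_block m w) \<in> G \<or> trunc m w = snd_block m w)}"

context
  fixes m D G
  assumes D: "D \<subseteq> topspace (Euclidean_space m)" and G: "G \<subseteq> D \<times> D"
begin

abbreviation "orbit_top \<equiv> subtopology (Euclidean_space (Suc (2 * m))) (orbit_space m D G)"

lemma blocks_in_orbit_space:
  assumes "x \<in> topspace (Euclidean_space m)" "y \<in> topspace (Euclidean_space m)"
  shows "blocks m x y t \<in> orbit_space m D G \<longleftrightarrow>
    0 \<le> t \<and> t \<le> 1 \<and> (t < 1 \<longrightarrow> x \<in> D) \<and> (0 < t \<longrightarrow> y \<in> D) \<and>
    (0 < t \<and> t < 1 \<longrightarrow> (x, y) \<in> G \<or> x = y)"
  using assms by (simp add: orbit_space_def blocks_simps)

text \<open>Write a point as (first block, second block, height). Four segments lead through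
  (x,x,0), (x,y,0), (x,y,1), (y,y,1), (y,y,0): at height 0 the second block moves freely, the pair
  in \<open>G\<close> permits the ascent, at height 1 the first block moves freely, and the diagonal
  permits the descent.\<close>

lemma path_component_orbit_space_step:
  assumes "(x, y) \<in> G"
  shows "path_component_of orbit_top (blocks m x x 0) (blocks m y y 0)"
proof -
  have x: "x \<in> D" "x \<in> topspace (Euclidean_space m)" and y: "y \<in> D" "y \<in> topspace (Euclidean_space m)"
    using assms G D by auto
  have convex: "(\<lambda>i. (1 - s) * x i + s * y i) \<in> topspace (Euclidean_space m)" for s
    using x y by (simp add: in_Euclidean_space_iff)
  have const: "(\<lambda>i. (1 - s) * u i + s * u i) = u" for u :: "nat \<Rightarrow> real" and s
    by (simp add: fun_eq_iff algebra_simps)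
  have const': "(1 - s) * u + s * u = u" for u s :: real
    by (simp add: algebra_simps)
  have "path_component_of orbit_top (blocks m x x 0) (blocks m x y 0)"
    by (rule segment_path_component_of, unfold blocks_convex)
      (use x y convex in \<open>simp add: const const' blocks_in_orbit_space blocks_simps(4)\<close>)
  moreover have "path_component_of orbit_top (blocks m x y 0) (blocks m x y 1)"
    by (rule segment_path_component_of, unfold blocks_convex)
      (use x y assms in \<open>simp add: const const' blocks_in_orbit_space blocks_simps(4)\<close>)
  moreover have "path_component_of orbit_top (blocks m x y 1) (blocks m y y 1)"
    by (rule segment_path_component_of, unfold blocks_convex)
      (use x y convex in \<open>simp add: const const' blocks_in_orbit_space blocks_simps(4)\<close>)
  moreover have "path_component_of orbit_top (blocks m y y 1) (blocks m y y 0)"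
    by (rule segment_path_component_of, unfold blocks_convex)
      (use x y in \<open>simp add: const const' blocks_in_orbit_space blocks_simps(4)\<close>)
  ultimately show ?thesis by (meson path_component_of_trans)
qed

lemma continuous_near:
  assumes "continuous_on {0..1::real} h" "a \<in> {0..1}" "open U" "h a \<in> (U :: real set)"
  obtains \<epsilon> where "\<epsilon> > 0" "\<And>s. s \<in> {0..1} \<Longrightarrow> \<bar>s - a\<bar> < \<epsilon> \<Longrightarrow> h s \<in> U"
proof -
  obtain \<delta> where \<delta>: "\<delta> > 0" "\<And>y. dist y (h a) < \<delta> \<Longrightarrow> y \<in> U"
    using assms(3,4) unfolding open_dist by blast
  obtain \<epsilon> where "\<epsilon> > 0" "\<And>s. s \<in> {0..1} \<Longrightarrow> dist s a < \<epsilon> \<Longrightarrow> dist (h s) (h a) < \<delta>"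
    using assms(1,2) \<delta>(1) unfolding continuous_on_iff by blast
  with \<delta>(2) show thesis by (intro that) (auto simp: dist_real_def)
qed

lemma no_paths_near:
  assumes "no_paths D" "a \<in> {0..1::real}" "s \<in> {0..1}" "\<bar>s - a\<bar> < \<epsilon>"
    and "\<And>i. continuous_on {0..1} (\<lambda>t. g t i)"
    and "\<And>t. t \<in> {0..1} \<Longrightarrow> \<bar>t - a\<bar> < \<epsilon> \<Longrightarrow> g t \<in> D"
  shows "g s = g a"
proof -
  have sub: "{min a s..max a s} \<subseteq> {0..1}"
    using assms(2,3) by auto
  have "g (min a s) = g (max a s)"
  proof (rule assms(1)[unfolded no_paths_def, rule_format])
    show "continuous_on {min a s..max a s} (\<lambda>t. g t i)" for i
      by (rule continuous_on_subset[OF assms(5) sub])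
    show "g t \<in> D" if "t \<in> {min a s..max a s}" for t
      by (rule assms(6)) (use sub that assms(4) in auto)
  qed simp
  then show ?thesis by (auto simp: min_def max_def split: if_splits)
qed

lemma path_component_orbit_space_imp:
  assumes no_paths: "no_paths D" and "d \<in> D" "x \<in> topspace (Euclidean_space m)"
    and "path_component_of orbit_top (blocks m d d 0) (blocks m x x 0)"
  shows "(d, x) \<in> (G \<union> G\<inverse>)\<^sup>*"
proof -
  define R where "R = (G \<union> G\<inverse>)\<^sup>*"
  have sym: "sym R" unfolding R_def by (intro sym_rtrancl) (auto simp: sym_def)
  have trans: "trans R" unfolding R_def by (rule trans_rtrancl)
  have class_eq: "{z. (u, z) \<in> R} = {z. (v, z) \<in> R}" if "(u, v) \<in> R" for u v
    using that sym trans by (auto dest: symD transD)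
  obtain g where g: "pathin orbit_top g" "g 0 = blocks m d d 0" "g 1 = blocks m x x 0"
    using assms(4) unfolding path_component_of_def by blast
  have cont: "continuous_on {0..1} (\<lambda>t. g t i)" for i
    using g(1) by (simp add: pathin_Euclidean_space_iff)
  have W: "g t \<in> orbit_space m D G" if "t \<in> {0..1}" for t
    using g(1) that by (simp add: pathin_Euclidean_space_iff)
  have cont': "continuous_on {0..1} (\<lambda>t. trunc m (g t) i)"
      "continuous_on {0..1} (\<lambda>t. snd_block m (g t) i)" for i
    using cont by (cases "i < m"; simp add: trunc_def snd_block_def)+
  \<comment> \<open>This selects a block that is sure to lie in \<open>D\<close>, as the first block
    is unconstrained only at height 1. Taking its \<open>R\<close>-class below turns a possible
    switch of blocks into a locally constant function.\<close>
  define cls where "cls t = (if g t (2 * m) < 1 then trunc m (g t) else snd_block m (g t))" for t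
  have "(\<lambda>t. {z. (cls t, z) \<in> R}) constant_on {0..1}"
  proof (rule locally_constant_imp_constant)
    fix a :: real assume a: "a \<in> {0..1}"
    have "\<exists>\<epsilon>>0. \<forall>s\<in>{0..1}. \<bar>s - a\<bar> < \<epsilon> \<longrightarrow> (cls s, cls a) \<in> R"
    proof (cases "g a (2 * m) < 1")
      case True
      obtain \<epsilon> where \<epsilon>: "\<epsilon> > 0" "\<And>s. s \<in> {0..1} \<Longrightarrow> \<bar>s - a\<bar> < \<epsilon> \<Longrightarrow> g s (2 * m) \<in> {..<1}"
        using continuous_near[OF cont a, of "{..<1}" "2 * m"] True by auto
      have "trunc m (g s) = trunc m (g a)" if "s \<in> {0..1}" "\<bar>s - a\<bar> < \<epsilon>" for s
        by (rule no_paths_near[OF no_paths a that cont'(1)])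
          (use \<epsilon>(2) W in \<open>auto simp: orbit_space_def\<close>)
      then have "cls s = cls a" if "s \<in> {0..1}" "\<bar>s - a\<bar> < \<epsilon>" for s
        using \<epsilon>(2)[OF that] True that by (simp add: cls_def)
      with \<epsilon>(1) show ?thesis by (auto simp: R_def)
    next
      case False
      obtain \<epsilon> where \<epsilon>: "\<epsilon> > 0" "\<And>s. s \<in> {0..1} \<Longrightarrow> \<bar>s - a\<bar> < \<epsilon> \<Longrightarrow> g s (2 * m) \<in> {0<..}"
        using continuous_near[OF cont a, of "{0<..}" "2 * m"] False by auto
      have eq: "snd_block m (g s) = cls a" if "s \<in> {0..1}" "\<bar>s - a\<bar> < \<epsilon>" for s
      proof -
        have "snd_block m (g s) = snd_block m (g a)"
          by (rule no_paths_near[OF no_paths a that cont'(2)])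
            (use \<epsilon>(2) W in \<open>auto simp: orbit_space_def\<close>)
        then show ?thesis using False by (simp add: cls_def)
      qed
      \<comment> \<open>Close to height 1 the second block is constant. At a nearby lower height
        \<open>cls\<close> reads the first block, which is equal or \<open>G\<close>-related to the
        second.\<close>
      have "(cls s, cls a) \<in> R" if s: "s \<in> {0..1}" "\<bar>s - a\<bar> < \<epsilon>" for s
      proof (cases "g s (2 * m) < 1")
        case True
        then have "(trunc m (g s), snd_block m (g s)) \<in> G \<or> trunc m (g s) = snd_block m (g s)"
          using W[OF s(1)] \<epsilon>(2)[OF s] by (simp add: orbit_space_def)
        then show ?thesis using True eq[OF s] by (auto simp: cls_def R_def)
      next
        case False
        then show ?thesis using eq[OF s] by (simp add: cls_def R_def)
      qed
      with \<epsilon>(1) show ?thesis by auto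
    qed
    then obtain \<epsilon> where "\<epsilon> > 0" "\<forall>s\<in>{0..1}. \<bar>s - a\<bar> < \<epsilon> \<longrightarrow> (cls s, cls a) \<in> R"
      by blast
    then show "\<exists>T. openin (top_of_set {0..1}) T \<and> a \<in> T \<and>
        (\<forall>s\<in>T. {z. (cls s, z) \<in> R} = {z. (cls a, z) \<in> R})"
      using a by (intro exI[of _ "{0..1} \<inter> ball a \<epsilon>"] conjI openin_open_Int ballI class_eq)
        (auto simp: dist_real_def abs_minus_commute)
  qed simp
  then have "{z. (cls 0, z) \<in> R} = {z. (cls 1, z) \<in> R}"
    unfolding constant_on_def by (metis atLeastAtMost_iff order_refl zero_le_one)
  moreover have "cls 0 = d" "cls 1 = x"
    using g(2,3) assms(2,3) D by (auto simp: cls_def blocks_simps)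
  ultimately have "(d, x) \<in> R" by (metis R_def mem_Collect_eq rtrancl.rtrancl_refl)
  then show ?thesis by (simp add: R_def)
qed

lemma path_component_orbit_space_iff:
  assumes "no_paths D" "d \<in> D" "x \<in> topspace (Euclidean_space m)"
  shows "path_component_of orbit_top (blocks m d d 0) (blocks m x x 0) \<longleftrightarrow> (d, x) \<in> (G \<union> G\<inverse>)\<^sup>*"
proof
  assume "(d, x) \<in> (G \<union> G\<inverse>)\<^sup>*"
  then show "path_component_of orbit_top (blocks m d d 0) (blocks m x x 0)"
  proof (induction rule: rtrancl_induct)
    case base
    have "d \<in> topspace (Euclidean_space m)" using assms(2) D by blast
    then show ?case
      using assms(2) by (simp add: path_component_of_refl orbit_space_def blocks_simps)
  next
    case (step y z)
    have "path_component_of orbit_top (blocks m y y 0) (blocks m z z 0)"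
      using step.hyps(2) path_component_orbit_space_step[of y z]
        path_component_of_sym[OF path_component_orbit_space_step[of z y]] by auto
    with step.IH show ?case by (rule path_component_of_trans)
  qed
qed (rule path_component_orbit_space_imp[OF assms])

text \<open>PCC makes the path component of (d,d,0) definable. Pulling it back along the map from x
  to (x,x,0), which is the substitution \<open>s\<close>, leaves exactly the class of
  \<open>d\<close>.\<close>

lemma defp_orbit:
  assumes "PCC M" and lt: "defp M (\<lambda>e. e 0 < e 1)"
    and DD: "defp M (\<lambda>e. trunc m e \<in> D)" and GG: "defp M (\<lambda>e. (trunc m e, snd_block m e) \<in> G)"
    and "no_paths D" "d \<in> D"
  shows "defp M (\<lambda>e. (d, trunc m e) \<in> (G \<union> G\<inverse>)\<^sup>*)"
proof -
  have d: "d \<in> topspace (Euclidean_space m)" using \<open>d \<in> D\<close> D by blast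
  have DD': "defp M (\<lambda>e. snd_block m e \<in> D)"
  proof -
    have "defp M (\<lambda>e. trunc m (\<lambda>i. (\<lambda>i e. e (m + i)) i e) \<in> D)"
      by (rule defp_inst[OF DD]) (rule is_atom_simps)
    then show ?thesis by (simp add: trunc_def snd_block_def cong: if_cong)
  qed
  have eq: "defp M (\<lambda>e. trunc m e = snd_block m e)"
  proof -
    have "(\<lambda>e. trunc m e = snd_block m e) = (\<lambda>e. \<forall>i<m. e i = e (m + i))"
      by (auto simp: trunc_def snd_block_def fun_eq_iff)
    moreover have "defp M (\<lambda>e. \<forall>i<m. e i = e (m + i))"
      by (intro defp_all_less defp_intros)
    ultimately show ?thesis by simp
  qed
  have W: "orbit_space m D G = {w \<in> topspace (Euclidean_space (Suc (2 * m))).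
     \<not> w (2 * m) < 0 \<and> \<not> 1 < w (2 * m) \<and>
     (w (2 * m) < 1 \<longrightarrow> trunc m w \<in> D) \<and>
     (0 < w (2 * m) \<longrightarrow> snd_block m w \<in> D) \<and>
     (0 < w (2 * m) \<and> w (2 * m) < 1 \<longrightarrow>
        (trunc m w, snd_block m w) \<in> G \<or> trunc m w = snd_block m w)}"
    by (simp add: orbit_space_def not_less)
  have "definable M (Suc (2 * m)) (orbit_space m D G)"
    unfolding W
    by (intro defp_imp_definable) (intro defp_intros DD DD' GG eq defp_inst2[OF lt])
  moreover have "Collect (path_component_of orbit_top (blocks m d d 0)) \<in> path_components_of orbit_top"
    using \<open>d \<in> D\<close> d
    by (auto simp: path_components_of_def orbit_space_def blocks_simps intro!: imageI)
  ultimately have "definable M (Suc (2 * m)) (Collect (path_component_of orbit_top (blocks m d d 0)))"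
    using \<open>PCC M\<close> unfolding PCC_def by blast
  from definable_imp_defp[OF this]
  have C: "defp M (\<lambda>e. path_component_of orbit_top (blocks m d d 0) (trunc (Suc (2 * m)) e))"
    by simp
  define s :: "nat \<Rightarrow> (nat \<Rightarrow> real) \<Rightarrow> real" where
    "s i = (if i < m then (\<lambda>e. e i) else if i < 2 * m then (\<lambda>e. e (i - m)) else (\<lambda>_. 0))" for i
  have "defp M (\<lambda>e. path_component_of orbit_top (blocks m d d 0) (trunc (Suc (2 * m)) (\<lambda>i. s i e)))"
    by (rule defp_inst[OF C]) (auto simp: s_def is_atom_simps)
  moreover have "trunc (Suc (2 * m)) (\<lambda>i. s i e) = blocks m (trunc m e) (trunc m e) 0" for e
    by (rule ext) (auto simp: s_def trunc_def blocks_def)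
  ultimately show ?thesis
    by (simp add: path_component_orbit_space_iff[OF \<open>no_paths D\<close> \<open>d \<in> D\<close> trunc_in_Euclidean_space])
qed

end

section \<open>Discrete definable sets\<close>

text \<open>These are the sets of order type \<open>\<omega>\<close>.\<close>

definition omega_like :: "real set \<Rightarrow> bool" where
  "omega_like L \<longleftrightarrow> infinite L \<and> (\<forall>x\<in>L. finite {y \<in> L. y \<le> x})"

text \<open>Gap lengths and orbits under halving run downwards, so they acquire order type \<omega>
  after negation.\<close>

lemma omega_like_uminus:
  assumes "infinite L" "\<And>x. x \<in> L \<Longrightarrow> finite {y \<in> L. x \<le> y}"
  shows "omega_like (uminus ` L)"
proof -
  have "{y \<in> uminus ` L. y \<le> - x} = uminus ` {y \<in> L. x \<le> y}" for x
    by auto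
  then show ?thesis
    using assms by (auto simp: omega_like_def finite_image_iff)
qed

section \<open>Gaps of closed sets of reals\<close>

lemma finite_if_separated:
  fixes A :: "real set"
  assumes "0 < \<epsilon>" "\<And>x. x \<in> A \<Longrightarrow> \<bar>x\<bar> \<le> N" "\<And>x y. x \<in> A \<Longrightarrow> y \<in> A \<Longrightarrow> x < y \<Longrightarrow> \<epsilon> \<le> y - x"
  shows "finite A"
proof (rule inj_on_finite)
  \<comment> \<open>Points at least \<epsilon> apart lie in different cells of width \<epsilon>, and
    a bounded set meets only finitely many cells.\<close>
  show "inj_on (\<lambda>x. \<lfloor>x / \<epsilon>\<rfloor>) A"
  proof (rule linorder_inj_onI')
    fix x y assume "x \<in> A" "y \<in> A" "x < y"
    then have "1 \<le> (y - x) / \<epsilon>"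
      using assms(1,3) by simp
    then have "x / \<epsilon> + 1 \<le> y / \<epsilon>"
      by (simp add: diff_divide_distrib)
    then show "\<lfloor>x / \<epsilon>\<rfloor> \<noteq> \<lfloor>y / \<epsilon>\<rfloor>" by linarith
  qed
  have "- N / \<epsilon> \<le> x / \<epsilon>" "x / \<epsilon> \<le> N / \<epsilon>" if "x \<in> A" for x
    by (rule divide_right_mono; use assms(1) assms(2)[OF that] in simp)+
  then show "(\<lambda>x. \<lfloor>x / \<epsilon>\<rfloor>) ` A \<subseteq> {\<lfloor>- N / \<epsilon>\<rfloor>..\<lfloor>N / \<epsilon>\<rfloor>}"
    by (auto simp del: minus_divide_left[symmetric] intro!: floor_mono)
qed simp

text \<open>The length appears as \<open>x + l = y\<close> so that the description uses only the
  graph of addition and the order.\<close>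

definition gaps :: "real set \<Rightarrow> real set" where
  "gaps F = {l. \<exists>x y. x \<in> F \<and> y \<in> F \<and> x < y \<and> (\<forall>z. x < z \<and> z < y \<longrightarrow> z \<notin> F) \<and> x + l = y}"

text \<open>Left ends of gaps of length at least \<epsilon> are \<epsilon>-separated, because the
  next one cannot precede the right end of the previous gap. Each left end determines its gap, hence
  the length.\<close>

lemma finite_gaps_ge:
  assumes "0 < \<epsilon>" "\<And>x. x \<in> F \<Longrightarrow> \<bar>x\<bar> \<le> N"
  shows "finite {l \<in> gaps F. \<epsilon> \<le> l}"
proof -
  define P where "P x y \<longleftrightarrow> x \<in> F \<and> y \<in> F \<and> x < y \<and> (\<forall>z. x < z \<and> z < y \<longrightarrow> z \<notin> F) \<and> \<epsilon> \<le> y - x" for x y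
  have unique: "y = y'" if "P x y" "P x y'" for x y y'
    using that unfolding P_def by (meson linorder_neqE)
  have "finite {x. \<exists>y. P x y}"
  proof (rule finite_if_separated[OF assms(1)])
    fix x x' assume "x \<in> {x. \<exists>y. P x y}" "x' \<in> {x. \<exists>y. P x y}" "x < x'"
    then obtain y where "P x y" "x' \<in> F" by (auto simp: P_def)
    then have "y \<le> x'" using \<open>x < x'\<close> unfolding P_def by (meson not_le)
    then show "\<epsilon> \<le> x' - x" using \<open>P x y\<close> by (simp add: P_def)
  qed (use assms(2) in \<open>auto simp: P_def\<close>)
  moreover have "{l \<in> gaps F. \<epsilon> \<le> l} \<subseteq> (\<lambda>x. (THE y. P x y) - x) ` {x. \<exists>y. P x y}"
  proof
    fix l assume "l \<in> {l \<in> gaps F. \<epsilon> \<le> l}"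
    then obtain x y where xy: "P x y" "l = y - x" by (auto simp: gaps_def P_def)
    then have "(THE y. P x y) = y" using unique by blast
    then show "l \<in> (\<lambda>x. (THE y. P x y) - x) ` {x. \<exists>y. P x y}" using xy by force
  qed
  ultimately show ?thesis by (meson finite_imageI finite_subset)
qed

text \<open>By compactness there are nearest points of \<open>F\<close> on both sides of
  \<open>z\<close>, and these bound a gap inside the interval from \<open>x\<close> to
  \<open>y\<close>.\<close>

lemma gap_around:
  fixes F :: "real set"
  assumes "closed F" "x \<in> F" "y \<in> F" "x < z" "z < y" "z \<notin> F"
  shows "\<exists>l\<in>gaps F. l \<le> y - x"
proof -
  have ne: "F \<inter> {x..z} \<noteq> {}" "F \<inter> {z..y} \<noteq> {}" using assms by auto
  have "compact (F \<inter> {x..z})" "compact (F \<inter> {z..y})"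
    using assms(1) by (auto intro: closed_Int_compact)
  then obtain a b where a: "a \<in> F" "x \<le> a" "a \<le> z" "\<And>w. w \<in> F \<Longrightarrow> x \<le> w \<Longrightarrow> w \<le> z \<Longrightarrow> w \<le> a"
    and b: "b \<in> F" "z \<le> b" "b \<le> y" "\<And>w. w \<in> F \<Longrightarrow> z \<le> w \<Longrightarrow> w \<le> y \<Longrightarrow> b \<le> w"
    using compact_attains_sup[OF _ ne(1)] compact_attains_inf[OF _ ne(2)] by force
  have "a < z" "z < b" using a b assms(6) by (auto simp: order.strict_iff_order)
  moreover have "w \<notin> F" if "a < w" "w < b" for w
    using that a(2) a(4)[of w] b(3) b(4)[of w] by (cases "w \<le> z") force+
  ultimately have "b - a \<in> gaps F"
    unfolding gaps_def mem_Collect_eq using a(1) b(1) \<open>a < z\<close> \<open>z < b\<close>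
    by (intro exI[of _ a] exI[of _ b]) auto
  then show ?thesis using a(2) b(3) by (intro bexI[of _ "b - a"]) auto
qed

text \<open>Between any two points of \<open>F\<close> there is a gap. If only finitely many lengths
  occurred, the least of them would separate the points of the bounded set \<open>F\<close>.\<close>

lemma infinite_gaps:
  assumes "closed F" "\<And>x. x \<in> F \<Longrightarrow> \<bar>x\<bar> \<le> N" "infinite F"
    and hollow: "\<And>x y. x < y \<Longrightarrow> \<exists>z. x < z \<and> z < y \<and> z \<notin> F"
  shows "infinite (gaps F)"
proof
  assume fin: "finite (gaps F)"
  have pos: "0 < l" if "l \<in> gaps F" for l using that by (auto simp: gaps_def)
  have *: "\<exists>l\<in>gaps F. l \<le> y - x" if "x \<in> F" "y \<in> F" "x < y" for x y
    using gap_around[OF assms(1) that(1,2)] hollow[OF that(3)] by blast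
  have "finite F"
  proof (cases "gaps F = {}")
    case True
    \<comment> \<open>Without gaps there are no two distinct points in \<open>F\<close>, so any
      separation constant serves.\<close>
    show ?thesis
      by (rule finite_if_separated[of 1, OF _ assms(2)]) (use * True in auto)
  next
    case False
    show ?thesis
    proof (rule finite_if_separated[of "Min (gaps F)", OF _ assms(2)])
      show "0 < Min (gaps F)" using fin False pos by simp
      show "Min (gaps F) \<le> y - x" if "x \<in> F" "y \<in> F" "x < y" for x y
        using *[OF that] fin by (meson Min_le order_trans)
    qed
  qed
  then show False using assms(3) by blast
qed

lemma omega_like_gaps:
  assumes "closed F" "\<And>x. x \<in> F \<Longrightarrow> \<bar>x\<bar> \<le> N" "infinite F"
    and hollow: "\<And>x y. x < y \<Longrightarrow> \<exists>z. x < z \<and> z < y \<and> z \<notin> F"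
  shows "omega_like (uminus ` gaps F)"
proof (rule omega_like_uminus[OF infinite_gaps[OF assms]])
  fix x assume "x \<in> gaps F"
  then have "0 < x" by (auto simp: gaps_def)
  then show "finite {y \<in> gaps F. x \<le> y}"
    by (rule finite_gaps_ge[OF _ assms(2)])
qed

lemma omega_like_locally_finite:
  fixes F :: "real set"
  assumes "infinite F" "\<And>N. finite (F \<inter> {-N..N})"
  shows "omega_like (F \<inter> {0..}) \<or> omega_like (uminus ` (F \<inter> {..0}))"
proof -
  have F: "F = F \<inter> {0..} \<union> F \<inter> {..0}" by auto
  have "infinite (F \<inter> {0..}) \<or> infinite (F \<inter> {..0})"
    using assms(1) by (subst (asm) F) simp
  then show ?thesis
  proof
    assume "infinite (F \<inter> {0..})"
    moreover have "finite {y \<in> F \<inter> {0..}. y \<le> x}" for x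
      by (rule finite_subset[OF _ assms(2)[of x]]) auto
    ultimately show ?thesis by (simp add: omega_like_def)
  next
    assume inf: "infinite (F \<inter> {..0})"
    have "finite {y \<in> F \<inter> {..0}. x \<le> y}" for x
      by (rule finite_subset[OF _ assms(2)[of "-x"]]) auto
    with inf show ?thesis by (intro disjI2 omega_like_uminus)
  qed
qed

text \<open>The number of smaller elements is an order isomorphism onto the naturals, and
  \<open>enc\<close> is its inverse. Surjectivity rests on counting: the ranks of the elements up to
  \<open>x\<close> fill the whole segment up to \<open>rank x\<close>.\<close>

lemma omega_like_enum:
  assumes "omega_like L"
  obtains enc :: "nat \<Rightarrow> real" where "strict_mono enc" "range enc = L"
proof -
  define rank where "rank x = card {y \<in> L. y < x}" for x
  have inf: "infinite L" and fin: "x \<in> L \<Longrightarrow> finite {y \<in> L. y \<le> x}" for x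
    using assms by (auto simp: omega_like_def)
  have mono: "rank x < rank y" if "x \<in> L" "y \<in> L" "x < y" for x y
    unfolding rank_def
    by (rule psubset_card_mono[OF finite_subset[OF _ fin[OF \<open>y \<in> L\<close>]]]) (use that in auto)
  then have inj: "inj_on rank L" by (metis inj_onI less_irrefl linorder_neqE)
  have init: "rank ` {y \<in> L. y \<le> x} = {..rank x}" if "x \<in> L" for x
  proof (rule card_subset_eq)
    show "rank ` {y \<in> L. y \<le> x} \<subseteq> {..rank x}"
      using mono that by (force simp: le_less)
    have "{y \<in> L. y \<le> x} = insert x {y \<in> L. y < x}" using that by auto
    moreover have "finite {y \<in> L. y < x}" by (rule finite_subset[OF _ fin[OF that]]) auto
    ultimately have "card {y \<in> L. y \<le> x} = card {..rank x}"
      by (simp add: rank_def)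
    moreover have "card (rank ` {y \<in> L. y \<le> x}) = card {y \<in> L. y \<le> x}"
      by (rule card_image) (rule inj_on_subset[OF inj], auto)
    ultimately show "card (rank ` {y \<in> L. y \<le> x}) = card {..rank x}" by simp
  qed simp
  have surj: "rank ` L = UNIV"
  proof -
    have "infinite (rank ` L)" using inf inj by (simp add: finite_image_iff)
    then have "\<exists>x\<in>L. n \<le> rank x" for n
      by (metis (mono_tags, lifting) finite_nat_set_iff_bounded_le image_iff nle_le)
    then have "\<exists>x\<in>L. n \<in> rank ` {y \<in> L. y \<le> x}" for n
      using init by simp
    then show ?thesis by blast
  qed
  define enc where "enc = inv_into L rank"
  have enc: "enc n \<in> L" "rank (enc n) = n" for n
    using surj by (auto simp: enc_def inv_into_into f_inv_into_f)
  have "strict_mono enc"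
  proof (rule strict_monoI)
    fix i j :: nat assume "i < j"
    then show "enc i < enc j"
      using mono[OF enc(1) enc(1), of j i] enc(2) by (metis less_asym linorder_neqE)
  qed
  moreover have "range enc = L"
  proof
    show "L \<subseteq> range enc"
      using inv_into_f_f[OF inj] by (metis enc_def rangeI subsetI)
  qed (use enc(1) in auto)
  ultimately show thesis by (rule that)
qed

section \<open>Frontiers and the failure of o-minimality\<close>

lemma frontier_real_iff:
  fixes E :: "real set"
  shows "x \<in> frontier E \<longleftrightarrow>
    (\<forall>a b. a < x \<and> x < b \<longrightarrow> (\<exists>y. y \<in> E \<and> a < y \<and> y < b) \<and> (\<exists>y. y \<notin> E \<and> a < y \<and> y < b))"
proof -
  have closure: "x \<in> closure S \<longleftrightarrow> (\<forall>a b. a < x \<and> x < b \<longrightarrow> (\<exists>y. y \<in> S \<and> a < y \<and> y < b))" for S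
  proof
    assume *: "x \<in> closure S"
    show "\<forall>a b. a < x \<and> x < b \<longrightarrow> (\<exists>y. y \<in> S \<and> a < y \<and> y < b)"
    proof (intro allI impI)
      fix a b assume "a < x \<and> x < b"
      then obtain y where "y \<in> S" "dist y x < min (x - a) (b - x)"
        using * unfolding closure_approachable by (metis diff_gt_0_iff_gt min_less_iff_conj)
      then show "\<exists>y. y \<in> S \<and> a < y \<and> y < b"
        by (intro exI[of _ y]) (auto simp: dist_real_def)
    qed
  next
    assume *: "\<forall>a b. a < x \<and> x < b \<longrightarrow> (\<exists>y. y \<in> S \<and> a < y \<and> y < b)"
    show "x \<in> closure S"
      unfolding closure_approachable
    proof (intro allI impI)
      fix \<epsilon> :: real assume "0 < \<epsilon>"
      then obtain y where "y \<in> S" "x - \<epsilon> < y" "y < x + \<epsilon>" using *[rule_format, of "x - \<epsilon>" "x + \<epsilon>"] by auto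
      then show "\<exists>y\<in>S. dist y x < \<epsilon>" by (intro bexI[of _ y]) (auto simp: dist_real_def)
    qed
  qed
  show ?thesis
    unfolding frontier_closures Int_iff closure by auto
qed

text \<open>A connected set that misses the frontier and meets \<open>E\<close> lies in
  \<open>E\<close>. Off the frontier, the piece around \<open>x\<close> extends to the nearest
  frontier point on each side, or to infinity, which leaves only finitely many candidates.\<close>

lemma finite_frontier_imp_finite_union:
  fixes E :: "real set"
  assumes "finite (frontier E)"
  shows "\<exists>\<I>. finite \<I> \<and> (\<forall>I\<in>\<I>. (\<exists>a. I = {a}) \<or> (open I \<and> is_interval I)) \<and> E = \<Union>\<I>"
proof -
  define F where "F = frontier E"
  define \<J> where "\<J> = (\<lambda>a. {a}) ` F \<union> (\<lambda>(u, v). {u<..<v}) ` (F \<times> F) \<union> lessThan ` F \<union>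
    greaterThan ` F \<union> {UNIV}"
  have fin: "finite F" using assms by (simp add: F_def)
  then have "finite \<J>" by (simp add: \<J>_def)
  have "\<exists>I\<in>\<J>. x \<in> I \<and> I \<subseteq> E" if "x \<in> E" for x
  proof (cases "x \<in> F")
    case True
    then show ?thesis using that by (auto simp: \<J>_def)
  next
    case False
    have conn: "\<exists>I\<in>\<J>. x \<in> I \<and> I \<subseteq> E" if "I \<in> \<J>" "x \<in> I" "connected I" "I \<inter> F = {}" for I
      using connected_Int_frontier[of I E] that \<open>x \<in> E\<close> by (auto simp: F_def)
    define A where "A = F \<inter> {..<x}"
    define B where "B = F \<inter> {x<..}"
    have "finite A" "finite B" using fin by (auto simp: A_def B_def)
    have gapl: "y \<le> Max A" if "y \<in> F" "y < x" for y
      using that \<open>finite A\<close> by (simp add: A_def)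
    have gapr: "Min B \<le> y" if "y \<in> F" "x < y" for y
      using that \<open>finite B\<close> by (simp add: B_def)
    have A: "Max A \<in> F" "Max A < x" if "A \<noteq> {}"
      using Max_in[OF \<open>finite A\<close> that] by (auto simp: A_def)
    have B: "Min B \<in> F" "x < Min B" if "B \<noteq> {}"
      using Min_in[OF \<open>finite B\<close> that] by (auto simp: B_def)
    have side: "y < x \<or> x < y" if "y \<in> F" for y
      using that False by (metis linorder_neqE)
    show ?thesis
    proof (cases "A = {}"; cases "B = {}")
      assume "A = {}" "B = {}"
      then have "F = {}" using side by (auto simp: A_def B_def)
      then show ?thesis by (intro conn[of UNIV]) (auto simp: \<J>_def)
    next
      assume ne: "A = {}" "B \<noteq> {}"
      have "{..<Min B} \<inter> F = {}"
        using gapr side ne(1) by (force simp: A_def)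
      then show ?thesis using B[OF ne(2)] by (intro conn[of "{..<Min B}"]) (auto simp: \<J>_def)
    next
      assume ne: "A \<noteq> {}" "B = {}"
      have "{Max A<..} \<inter> F = {}"
        using gapl side ne(2) by (force simp: B_def)
      then show ?thesis using A[OF ne(1)] by (intro conn[of "{Max A<..}"]) (auto simp: \<J>_def)
    next
      assume ne: "A \<noteq> {}" "B \<noteq> {}"
      have "{Max A<..<Min B} \<inter> F = {}"
        using gapl gapr side by force
      then show ?thesis
        using A[OF ne(1)] B[OF ne(2)]
        by (intro conn[of "{Max A<..<Min B}"]) (auto simp: \<J>_def intro: rev_image_eqI)
    qed
  qed
  then have "E = \<Union>{I \<in> \<J>. I \<subseteq> E}" by blast
  moreover have "\<forall>I\<in>\<J>. (\<exists>a. I = {a}) \<or> (open I \<and> is_interval I)"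
    by (auto simp: \<J>_def is_interval_connected_1)
  ultimately show ?thesis
    using \<open>finite \<J>\<close> by (intro exI[of _ "{I \<in> \<J>. I \<subseteq> E}"]) auto
qed

lemma not_o_minimal_imp_infinite_frontier:
  assumes "\<not> o_minimal M"
  obtains E where "defp M (\<lambda>e. e 0 \<in> E)" "infinite (frontier E)"
proof -
  obtain E where E: "definable M 1 E"
    "\<not> (\<exists>\<I>. finite \<I> \<and> (\<forall>I\<in>\<I>. (\<exists>a. I = {a}) \<or> (open I \<and> is_interval I)) \<and> (\<lambda>x. x 0) ` E = \<Union>\<I>)"
    using assms unfolding o_minimal_def by blast
  have sub: "E \<subseteq> topspace (Euclidean_space 1)"
    using E(1) unfolding definable_def by auto
  have "trunc 1 e \<in> E \<longleftrightarrow> e 0 \<in> (\<lambda>x. x 0) ` E" for e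
  proof
    assume "e 0 \<in> (\<lambda>x. x 0) ` E"
    then obtain x where x: "x \<in> E" "e 0 = x 0" by blast
    then have "trunc 1 e = x"
      using sub by (auto simp: trunc_def in_Euclidean_space_iff fun_eq_iff)
    then show "trunc 1 e \<in> E" using x by simp
  qed (auto simp: trunc_def intro!: image_eqI[of _ _ "trunc 1 e"])
  then have "defp M (\<lambda>e. e 0 \<in> (\<lambda>x. x 0) ` E)"
    using definable_imp_defp[OF E(1)] by simp
  then show thesis
    using that finite_frontier_imp_finite_union E(2) by meson
qed

section \<open>Sets without nonconstant paths\<close>

lemma between_path_endpoints:
  fixes h :: "real \<Rightarrow> real"
  assumes "a \<le> b" "continuous_on {a..b} h" "\<And>t. t \<in> {a..b} \<Longrightarrow> h t \<in> A"
  shows "{h a..h b} \<subseteq> A" "{h b..h a} \<subseteq> A"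
proof -
  have "connected (h ` {a..b})"
    using assms(2) by (intro connected_continuous_image) auto
  moreover have "h a \<in> h ` {a..b}" "h b \<in> h ` {a..b}" using assms(1) by auto
  ultimately have "{h a..h b} \<subseteq> h ` {a..b}" "{h b..h a} \<subseteq> h ` {a..b}"
    by (simp_all add: connected_contains_Icc)
  with assms(3) show "{h a..h b} \<subseteq> A" "{h b..h a} \<subseteq> A" by blast+
qed

text \<open>A coordinate that changes along a path runs through a nondegenerate interval, which is
  uncountable.\<close>

lemma no_paths_countable:
  assumes "\<And>i. countable ((\<lambda>x. x i) ` D)"
  shows "no_paths D"
  unfolding no_paths_def
proof (intro allI impI ext)
  fix g :: "real \<Rightarrow> nat \<Rightarrow> real" and a b i
  assume ab: "a \<le> b" "\<forall>i. continuous_on {a..b} (\<lambda>t. g t i)" "\<forall>t\<in>{a..b}. g t \<in> D"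
  have "{g a i..g b i} \<subseteq> (\<lambda>x. x i) ` D" "{g b i..g a i} \<subseteq> (\<lambda>x. x i) ` D"
    using between_path_endpoints[of a b "\<lambda>t. g t i" "(\<lambda>x. x i) ` D"] ab by auto
  then have "countable {g a i..g b i}" "countable {g b i..g a i}"
    using assms countable_subset by blast+
  then show "g a i = g b i"
    by (meson linorder_neqE uncountable_closed_interval)
qed

text \<open>
  A set that is dense and codense in \<open>[u, v]\<close> makes its characteristic function a copy of \<open>[u, v]\<close>
  without paths, on which the orbit of \<open>v\<close> under halving the distance to \<open>u\<close> is discrete.
\<close>

definition chi_graph :: "real \<Rightarrow> real \<Rightarrow> real set \<Rightarrow> (nat \<Rightarrow> real) set" where
  "chi_graph u v E = {x \<in> topspace (Euclidean_space 2). u < x 0 \<and> x 0 \<le> v \<and>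
     (x 0 \<in> E \<and> x 1 = 1 \<or> x 0 \<notin> E \<and> x 1 = 0)}"

text \<open>Along a path the second coordinate takes values in {0, 1} and hence is constant. So the
  first coordinate stays in \<open>E\<close> or stays outside, and neither side contains an interval
  below \<open>v\<close> and above \<open>u\<close>.\<close>

lemma no_paths_chi_graph:
  assumes dense: "{u..v} \<subseteq> frontier E"
  shows "no_paths (chi_graph u v E)"
  unfolding no_paths_def
proof (intro allI impI)
  fix g :: "real \<Rightarrow> nat \<Rightarrow> real" and a b
  assume ab: "a \<le> b" and cont: "\<forall>i. continuous_on {a..b} (\<lambda>t. g t i)"
    and g: "\<forall>t\<in>{a..b}. g t \<in> chi_graph u v E"
  have const1: "g t 1 = g a 1" if "t \<in> {a..b}" for t
  proof -
    have *: "g s 1 \<in> {0, 1}" if "s \<in> {a..t}" for s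
      using g \<open>t \<in> {a..b}\<close> that by (auto simp: chi_graph_def)
    have cont': "continuous_on {a..t} (\<lambda>t. g t 1)"
      using cont that by (auto intro: continuous_on_subset)
    have "a \<le> t" using that by simp
    from between_path_endpoints[OF this cont' *]
    have "countable {g a 1..g t 1}" "countable {g t 1..g a 1}"
      by (meson countable_subset countable_insert countable_empty)+
    then show ?thesis
      by (meson linorder_neqE uncountable_closed_interval)
  qed
  define A where "A = {x. u < x \<and> x \<le> v \<and> (x \<in> E \<longleftrightarrow> g a 1 = 1)}"
  have gA: "g t 0 \<in> A" if "t \<in> {a..b}" for t
    using bspec[OF g that] const1[OF that] by (auto simp: A_def chi_graph_def)
  have sub: "{g a 0..g b 0} \<subseteq> A" "{g b 0..g a 0} \<subseteq> A"
    using between_path_endpoints[OF ab, of "\<lambda>t. g t 0" A] cont gA by auto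
  have hollow: False if "x < y" "{x..y} \<subseteq> A" for x y
  proof -
    have "x \<in> A" "y \<in> A" using that by auto
    then have "(x + y) / 2 \<in> frontier E" using dense that(1) by (auto simp: A_def)
    moreover have "x < (x + y) / 2 \<and> (x + y) / 2 < y" using that(1) by simp
    ultimately obtain p q where "p \<in> E" "x < p" "p < y" "q \<notin> E" "x < q" "q < y"
      unfolding frontier_real_iff by blast
    then have "p \<in> A" "q \<in> A" using that(2) by auto
    then show False using \<open>p \<in> E\<close> \<open>q \<notin> E\<close> by (auto simp: A_def)
  qed
  have "g a 0 = g b 0"
    using hollow[OF _ sub(1)] hollow[OF _ sub(2)] by (cases "g a 0" "g b 0" rule: linorder_cases) auto
  moreover have "g a 1 = g b 1" using const1[of b] ab by simp
  moreover have "g a i = g b i" if "i \<ge> 2" for i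
    using g ab that by (auto simp: chi_graph_def in_Euclidean_space_iff)
  moreover have "i = 0 \<or> i = 1 \<or> i \<ge> 2" for i :: nat by linarith
  ultimately show "g a = g b" by (metis ext)
qed

lemma defp_chi_graph:
  assumes "defp M (\<lambda>e. e 0 < e 1)" "defp M (\<lambda>e. e 0 \<in> E)"
  shows "defp M (\<lambda>e. trunc 2 e \<in> chi_graph u v E)"
proof -
  have "trunc 2 e \<in> chi_graph u v E \<longleftrightarrow>
      u < e 0 \<and> \<not> v < e 0 \<and> (e 0 \<in> E \<and> e 1 = 1 \<or> e 0 \<notin> E \<and> e 1 = 0)" for e
    by (auto simp: chi_graph_def trunc_in_Euclidean_space) (auto simp: trunc_def)
  then show ?thesis
    by (simp only:) (intro defp_intros defp_inst2[OF assms(1)] defp_inst1[OF assms(2)])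
qed

lemma omega_like_halving:
  assumes "u < (v :: real)"
  shows "omega_like (uminus ` range (\<lambda>n. u + (v - u) / 2 ^ n))" (is "omega_like (uminus ` range ?c)")
proof (rule omega_like_uminus)
  have inj: "inj ?c"
    using assms by (auto intro!: injI)
  then show "infinite (range ?c)" by (simp add: range_inj_infinite)
  fix x assume "x \<in> range ?c"
  then obtain n where n: "x = ?c n" by blast
  have "{y \<in> range ?c. x \<le> y} \<subseteq> ?c ` {..n}"
  proof
    fix y assume "y \<in> {y \<in> range ?c. x \<le> y}"
    then obtain k where k: "y = ?c k" "?c n \<le> ?c k" using n by auto
    have "k \<le> n"
    proof (rule ccontr)
      assume "\<not> k \<le> n"
      then have "(v - u) / 2 ^ k < (v - u) / 2 ^ n"
        using assms by (intro divide_strict_left_mono) auto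
      then show False using k(2) by simp
    qed
    then show "y \<in> ?c ` {..n}" using k by blast
  qed
  then show "finite {y \<in> range ?c. x \<le> y}" by (rule finite_subset) simp
qed

text \<open>\<open>G\<close> sends a point of the graph to the point over the midpoint between it
  and \<open>u\<close>, expressed by addition alone. The starting point has no
  \<open>G\<close>-predecessor in the graph, so its two-sided orbit is just the forward one.\<close>

lemma defp_halving:
  assumes "PCC M" and lt: "defp M (\<lambda>e. e 0 < e 1)" and add: "defp M (\<lambda>e. e 0 + e 1 = e 2)"
    and E: "defp M (\<lambda>e. e 0 \<in> E)" and uv: "u < v" and dense: "{u..v} \<subseteq> frontier E"
  shows "defp M (\<lambda>e. e 0 \<in> range (\<lambda>n. u + (v - u) / 2 ^ n))"
proof -
  define c where "c n = u + (v - u) / 2 ^ n" for n :: nat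
  define D where "D = chi_graph u v E"
  \<comment> \<open>The lift of \<open>y\<close> to the graph of the characteristic
    function.\<close>
  define pt where "pt y = (\<lambda>i::nat. if i = 0 then y else if i = 1 \<and> y \<in> E then 1 else (0::real))" for y :: real
  define G where "G = {(x, y). x \<in> D \<and> y \<in> D \<and> y 0 + y 0 = x 0 + u}"
  have ptD: "pt y \<in> D \<longleftrightarrow> u < y \<and> y \<le> v" for y
    by (auto simp: D_def chi_graph_def pt_def in_Euclidean_space_iff)
  have D_pt: "x = pt (x 0)" if "x \<in> D" for x
  proof
    fix i show "x i = pt (x 0) i"
      using that by (cases "i < 2") (auto simp: D_def chi_graph_def pt_def in_Euclidean_space_iff less_2_cases_iff)
  qed
  have c: "u < c n" "c n \<le> v" "c (Suc n) + c (Suc n) = c n + u" "c 0 = v" for n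
  proof -
    show "u < c n" using uv by (simp add: c_def)
    have "v - u \<le> (v - u) * 2 ^ n" using uv by simp
    then have "(v - u) / 2 ^ n \<le> v - u" by (simp add: field_simps)
    then show "c n \<le> v" by (simp add: c_def)
  qed (auto simp: c_def field_simps)
  have reach: "(pt v, pt (c n)) \<in> (G \<union> G\<inverse>)\<^sup>*" for n
  proof (induction n)
    case (Suc n)
    have "(pt (c n), pt (c (Suc n))) \<in> G"
      using c by (auto simp: G_def ptD) (simp add: pt_def)
    with Suc.IH show ?case by (meson UnI1 rtrancl.rtrancl_into_rtrancl)
  qed (simp add: c)
  have only: "x \<in> D \<and> (\<exists>n. x 0 = c n)" if "(pt v, x) \<in> (G \<union> G\<inverse>)\<^sup>*" for x
    using that
  proof (induction rule: rtrancl_induct)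
    case base
    then show ?case using ptD uv c(4) by (metis order_refl pt_def)
  next
    case (step x y)
    then obtain n where n: "x 0 = c n" by blast
    consider "(x, y) \<in> G" | "(y, x) \<in> G" using step.hyps(2) by blast
    then show ?case
    proof cases
      case 1
      then have "y \<in> D" "y 0 = c (Suc n)" using n c(3)[of n] by (auto simp: G_def)
      then show ?thesis by blast
    next
      case 2
      then have y: "y \<in> D" "c n + c n = y 0 + u" using n by (auto simp: G_def)
      show ?thesis
      proof (cases n)
        case 0
        \<comment> \<open>A backward step from \<open>v\<close> doubles the distance to
          \<open>u\<close> and so leaves the graph, which ends at \<open>v\<close>.\<close>
        then have "v < y 0" using y(2) c(4) uv by simp
        then show ?thesis using y(1) by (auto simp: D_def chi_graph_def)
      next
        case (Suc k)
        then have "y 0 = c k" using y(2) c(3)[of k] by simp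
          then show ?thesis using y(1) by blast
      qed
    qed
  qed
  have "defp M (\<lambda>e. (pt v, trunc 2 e) \<in> (G \<union> G\<inverse>)\<^sup>*)"
  proof (rule defp_orbit[OF _ _ \<open>PCC M\<close> lt])
    show "D \<subseteq> topspace (Euclidean_space 2)" by (auto simp: D_def chi_graph_def)
    show "G \<subseteq> D \<times> D" by (auto simp: G_def)
    show D: "defp M (\<lambda>e. trunc 2 e \<in> D)" unfolding D_def by (rule defp_chi_graph[OF lt E])
    have "defp M (\<lambda>e. trunc 2 (\<lambda>i. (\<lambda>i e. e (2 + i)) i e) \<in> D)"
      by (rule defp_inst[OF D]) (rule is_atom_simps)
    moreover have "trunc 2 (\<lambda>i. e (2 + i)) = snd_block 2 e" for e
      by (auto simp: trunc_def snd_block_def)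
    ultimately have D': "defp M (\<lambda>e. snd_block 2 e \<in> D)" by simp
    have "(trunc 2 e, snd_block 2 e) \<in> G \<longleftrightarrow> trunc 2 e \<in> D \<and> snd_block 2 e \<in> D \<and>
        (\<exists>s. e 2 + e 2 = s \<and> e 0 + u = s)" for e
      by (auto simp: G_def trunc_def snd_block_def)
    then show "defp M (\<lambda>e. (trunc 2 e, snd_block 2 e) \<in> G)"
      by (simp only:) (intro defp_intros D D' defp_inst3[OF add])
    show "no_paths D" unfolding D_def by (rule no_paths_chi_graph[OF dense])
    show "pt v \<in> D" using uv by (simp add: ptD)
  qed
  from defp_inst[OF this, of "\<lambda>i e. e i"]
  have orbit: "defp M (\<lambda>e. (pt v, trunc 2 e) \<in> (G \<union> G\<inverse>)\<^sup>*)" by (simp add: is_atom_simps)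
  \<comment> \<open>Projection to the first coordinate forgets the value of the characteristic
    function and returns to the line.\<close>
  have "e 0 \<in> range c \<longleftrightarrow> (\<exists>y. (pt v, trunc 2 (\<lambda>i. if i = 0 then e 0 else y)) \<in> (G \<union> G\<inverse>)\<^sup>*)" for e :: "nat \<Rightarrow> real"
  proof
    assume "e 0 \<in> range c"
    then obtain n where n: "e 0 = c n" by blast
    have "trunc 2 (\<lambda>i. if i = 0 then e 0 else pt (c n) 1) = pt (c n)"
      using n by (auto simp: trunc_def pt_def)
    then show "\<exists>y. (pt v, trunc 2 (\<lambda>i. if i = 0 then e 0 else y)) \<in> (G \<union> G\<inverse>)\<^sup>*"
      using reach by metis
  next
    assume "\<exists>y. (pt v, trunc 2 (\<lambda>i. if i = 0 then e 0 else y)) \<in> (G \<union> G\<inverse>)\<^sup>*"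
    then show "e 0 \<in> range c" using only by (fastforce simp: trunc_def)
  qed
  moreover have "defp M (\<lambda>e. (pt v, trunc 2 (\<lambda>i. (if i = 0 then (\<lambda>e. e (Suc 0)) else (\<lambda>e. e 0)) e)) \<in> (G \<union> G\<inverse>)\<^sup>*)"
    by (rule defp_inst[OF orbit]) (auto simp: is_atom_simps)
  then have "defp M (\<lambda>e. \<exists>y. (pt v, trunc 2 (\<lambda>i. if i = 0 then e 0 else y)) \<in> (G \<union> G\<inverse>)\<^sup>*)"
    by (intro defp_ex) (simp add: if_distribR cong: if_cong)
  ultimately show ?thesis by (simp add: c_def)
qed

lemma defp_uminus_image:
  assumes "defp M (\<lambda>e. e 0 + e 1 = e 2)" "defp M (\<lambda>e. e 0 \<in> L)"
  shows "defp M (\<lambda>e. e 0 \<in> uminus ` L)"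
proof -
  have "x \<in> uminus ` L \<longleftrightarrow> (\<exists>y. y \<in> L \<and> x + y = 0)" for x
    by (auto simp: eq_neg_iff_add_eq_0 image_iff)
  then show ?thesis
    by (simp only:) (intro defp_intros defp_inst3[OF assms(1)] defp_inst1[OF assms(2)])
qed

lemma ex_omega_like:
  assumes "PCC M" and lt: "defp M (\<lambda>e. e 0 < e 1)" and add: "defp M (\<lambda>e. e 0 + e 1 = e 2)"
    and "\<not> o_minimal M"
  obtains L where "omega_like L" "defp M (\<lambda>e. e 0 \<in> L)"
proof -
  obtain E where E: "defp M (\<lambda>e. e 0 \<in> E)" and inf: "infinite (frontier E)"
    using not_o_minimal_imp_infinite_frontier[OF assms(4)] by blast
  define F where "F = frontier E"
  \<comment> \<open>The frontier has been described by the order and \<open>E\<close> alone, which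
    is what makes it definable.\<close>
  have F: "defp M (\<lambda>e. e 0 \<in> F)"
    unfolding F_def frontier_real_iff
    by (intro defp_intros defp_inst2[OF lt] defp_inst1[OF E])
  have "closed F" "infinite F" using inf by (auto simp: F_def)
  have cut: "defp M (\<lambda>e. e 0 \<in> F \<inter> {a..b})" "defp M (\<lambda>e. e 0 \<in> F \<inter> {a..})" "defp M (\<lambda>e. e 0 \<in> F \<inter> {..b})" for a b
    unfolding Int_iff atLeastAtMost_iff atLeast_iff atMost_iff not_less[symmetric]
    by (intro defp_intros defp_inst2[OF lt] defp_inst1[OF F])+
  \<comment> \<open>An interval inside the frontier makes \<open>E\<close> dense and codense there.
    Otherwise the frontier contains no interval, as the gap argument requires, and the last
    distinction is whether it accumulates in a bounded region.\<close>
  consider (dense) u v where "u < v" "{u..v} \<subseteq> F"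
    | (bounded) N where "infinite (F \<inter> {-N..N})" "\<And>x y. x < y \<Longrightarrow> \<exists>z. x < z \<and> z < y \<and> z \<notin> F"
    | (locally_finite) "\<And>N. finite (F \<inter> {-N..N})"
  proof (cases "\<exists>x y. x < y \<and> (\<forall>z. x < z \<and> z < y \<longrightarrow> z \<in> F)")
    case True
    then obtain x y where xy: "x < y" "\<forall>z. x < z \<and> z < y \<longrightarrow> z \<in> F" by blast
    obtain u where u: "x < u" "u < y" using dense_order_class.dense[OF xy(1)] by blast
    obtain v where "u < v" "v < y" using dense_order_class.dense[OF u(2)] by blast
    with u xy(2) show thesis by (intro that(1)[of u v]) auto
  qed (metis that(2,3))
  then show thesis
  proof cases
    case dense
    have "defp M (\<lambda>e. e 0 \<in> range (\<lambda>n. u + (v - u) / 2 ^ n))"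
      using defp_halving[OF assms(1) lt add E dense(1)] dense(2) by (simp add: F_def)
    then show thesis
      by (intro that[OF omega_like_halving[OF dense(1)]] defp_uminus_image[OF add])
  next
    case bounded
    have "omega_like (uminus ` gaps (F \<inter> {-N..N}))"
      by (rule omega_like_gaps[of _ N]) (use bounded \<open>closed F\<close> in \<open>auto intro: closed_Int\<close>)
    moreover have "defp M (\<lambda>e. e 0 \<in> gaps (F \<inter> {-N..N}))"
      unfolding gaps_def mem_Collect_eq
      by (intro defp_intros defp_inst2[OF lt] defp_inst3[OF add] defp_inst1[OF cut(1)])
    ultimately show thesis by (rule that[OF _ defp_uminus_image[OF add]])
  next
    case locally_finite
    then consider "omega_like (F \<inter> {0..})" | "omega_like (uminus ` (F \<inter> {..0}))"
      using omega_like_locally_finite[OF \<open>infinite F\<close>] by blast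
    then show thesis
      by cases (use that cut(2) defp_uminus_image[OF add cut(3)] in blast)+
  qed
qed

section \<open>Arithmetic on discrete definable sets\<close>

definition suc_rel :: "(nat \<Rightarrow> real) \<Rightarrow> real \<Rightarrow> real \<Rightarrow> bool" where
  "suc_rel enc x y \<longleftrightarrow> (\<exists>i. x = enc i \<and> y = enc (Suc i))"

definition less_rel :: "(nat \<Rightarrow> real) \<Rightarrow> real \<Rightarrow> real \<Rightarrow> bool" where
  "less_rel enc x y \<longleftrightarrow> (\<exists>i j. x = enc i \<and> y = enc j \<and> i < j)"

definition pair_rel :: "(nat \<Rightarrow> real) \<Rightarrow> real \<Rightarrow> real \<Rightarrow> real \<Rightarrow> bool" where
  "pair_rel enc x y z \<longleftrightarrow> (\<exists>i j. x = enc i \<and> y = enc j \<and> z = enc (prod_encode (i, j)))"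

definition nth_rel :: "(nat \<Rightarrow> real) \<Rightarrow> real \<Rightarrow> real \<Rightarrow> real \<Rightarrow> bool" where
  "nth_rel enc x y z \<longleftrightarrow> (\<exists>c i. x = enc c \<and> y = enc i \<and> i < length (list_decode c) \<and>
     z = enc (list_decode c ! i))"

text \<open>Cantor's pairing numbers the antidiagonals one after another: the code grows by one
  along an antidiagonal, and again in passing from its end to the start of the next.\<close>

lemma prod_encode_walk:
  "prod_encode (Suc m, n) = Suc (prod_encode (m, Suc n))"
  "prod_encode (0, Suc n) = Suc (prod_encode (n, 0))"
  "prod_encode (0, 0) = 0"
  by (simp_all add: prod_encode_def)

type_synonym nat4 = "nat \<times> nat \<times> nat \<times> nat"

context
  fixes enc :: "nat \<Rightarrow> real" and M :: "('f, 'r) real_structure"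
  assumes mono: "strict_mono enc" and PCC: "PCC M"
    and lt: "defp M (\<lambda>e. e 0 < e 1)" and range: "defp M (\<lambda>e. e 0 \<in> range enc)"
begin

lemma enc_eq: "enc i = enc j \<longleftrightarrow> i = j" and enc_less: "enc i < enc j \<longleftrightarrow> i < j"
  using mono by (simp_all add: strict_mono_eq strict_mono_less)

lemma suc_rel_enc: "suc_rel enc (enc i) (enc j) \<longleftrightarrow> j = Suc i"
  by (auto simp: suc_rel_def enc_eq)

lemma defp_suc_rel: "defp M (\<lambda>e. suc_rel enc (e 0) (e 1))"
proof -
  have "suc_rel enc x y \<longleftrightarrow> x \<in> range enc \<and> y \<in> range enc \<and> x < y \<and>
      \<not> (\<exists>z. z \<in> range enc \<and> x < z \<and> z < y)" for x y
    by (fastforce simp: suc_rel_def enc_less enc_eq less_Suc_eq intro: Suc_lessI)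
  then show ?thesis
    by (simp only:) (intro defp_intros defp_inst2[OF lt] defp_inst1[OF range])
qed

lemma defp_less_rel: "defp M (\<lambda>e. less_rel enc (e 0) (e 1))"
proof -
  have "less_rel enc x y \<longleftrightarrow> x \<in> range enc \<and> y \<in> range enc \<and> x < y" for x y
    by (auto simp: less_rel_def enc_less enc_eq)
  then show ?thesis
    by (simp only:) (intro defp_intros defp_inst2[OF lt] defp_inst1[OF range])
qed

text \<open>One state format serves both walks below. The pairing walk pads it with a fourth
  component 0.\<close>

definition point4 :: "nat4 \<Rightarrow> nat \<Rightarrow> real" where
  "point4 = (\<lambda>(a, b, c, d). point_of [enc a, enc b, enc c, enc d])"

lemma trunc_eq_point4:
  "trunc 4 e = point4 (a, b, c, d) \<longleftrightarrow> e 0 = enc a \<and> e 1 = enc b \<and> e 2 = enc c \<and> e 3 = enc d"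
proof
  assume "trunc 4 e = point4 (a, b, c, d)"
  then have "trunc 4 e i = point4 (a, b, c, d) i" for i by simp
  from this[of 0] this[of 1] this[of 2] this[of 3]
  show "e 0 = enc a \<and> e 1 = enc b \<and> e 2 = enc c \<and> e 3 = enc d"
    by (simp add: trunc_def point4_def point_of_def)
next
  assume *: "e 0 = enc a \<and> e 1 = enc b \<and> e 2 = enc c \<and> e 3 = enc d"
  show "trunc 4 e = point4 (a, b, c, d)"
  proof
    fix i :: nat
    consider "i = 0" | "i = 1" | "i = 2" | "i = 3" | "i \<ge> 4" by linarith
    then show "trunc 4 e i = point4 (a, b, c, d) i"
      using * by cases (auto simp: trunc_def point4_def point_of_def)
  qed
qed

lemma inj_point4: "inj point4"
proof (rule injI)
  fix x y :: nat4 assume "point4 x = point4 y"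
  then have "point4 x i = point4 y i" for i by simp
  from this[of 0] this[of 1] this[of 2] this[of 3] show "x = y"
    by (cases x; cases y) (auto simp: point4_def point_of_def enc_eq)
qed

text \<open>Tuples over the countable set \<open>range enc\<close> admit no nonconstant paths, so
  orbits on them are definable. Membership in \<open>range enc\<close> is added to
  \<open>\<Gamma>\<close>, hence \<open>\<Gamma>\<close> has to match \<open>H\<close> on encoded
  tuples only.\<close>

lemma defp_nat_orbit:
  assumes \<Gamma>: "defp M \<Gamma>"
    and H: "\<And>e a b c d a' b' c' d'. e 0 = enc a \<Longrightarrow> e 1 = enc b \<Longrightarrow> e 2 = enc c \<Longrightarrow> e 3 = enc d \<Longrightarrow>
      e 4 = enc a' \<Longrightarrow> e 5 = enc b' \<Longrightarrow> e 6 = enc c' \<Longrightarrow> e 7 = enc d' \<Longrightarrow>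
      \<Gamma> e \<longleftrightarrow> ((a, b, c, d), (a', b', c', d')) \<in> H"
  shows "defp M (\<lambda>e. \<exists>a b c d. e 0 = enc a \<and> e 1 = enc b \<and> e 2 = enc c \<and> e 3 = enc d \<and>
    (s, (a, b, c, d)) \<in> (H \<union> H\<inverse>)\<^sup>*)"
proof -
  define G where "G = map_prod point4 point4 ` H"
  have "defp M (\<lambda>e. (point4 s, trunc 4 e) \<in> (G \<union> G\<inverse>)\<^sup>*)"
  proof (rule defp_orbit[OF _ _ PCC lt])
    show "range point4 \<subseteq> topspace (Euclidean_space 4)"
      by (auto simp: in_Euclidean_space_iff point4_def point_of_def)
    show "G \<subseteq> range point4 \<times> range point4" by (auto simp: G_def)
    have D: "trunc 4 e \<in> range point4 \<longleftrightarrow> e 0 \<in> range enc \<and> e 1 \<in> range enc \<and> e 2 \<in> range enc \<and>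
        e 3 \<in> range enc" for e
      by (auto simp: image_iff trunc_eq_point4)
    show "defp M (\<lambda>e. trunc 4 e \<in> range point4)"
      unfolding D by (intro defp_intros defp_inst1[OF range])
    have snd: "snd_block 4 e = trunc 4 (\<lambda>i. e (4 + i))" for e
      by (auto simp: snd_block_def trunc_def)
    have "(trunc 4 e, snd_block 4 e) \<in> G \<longleftrightarrow> e 0 \<in> range enc \<and> e 1 \<in> range enc \<and> e 2 \<in> range enc \<and>
        e 3 \<in> range enc \<and> e 4 \<in> range enc \<and> e 5 \<in> range enc \<and> e 6 \<in> range enc \<and> e 7 \<in> range enc \<and> \<Gamma> e" for e
    proof
      assume "(trunc 4 e, snd_block 4 e) \<in> G"
      then obtain a b c d a' b' c' d' where "((a, b, c, d), (a', b', c', d')) \<in> H"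
        "trunc 4 e = point4 (a, b, c, d)" "trunc 4 (\<lambda>i. e (4 + i)) = point4 (a', b', c', d')"
        by (auto simp: G_def snd)
      then show "e 0 \<in> range enc \<and> e 1 \<in> range enc \<and> e 2 \<in> range enc \<and>
        e 3 \<in> range enc \<and> e 4 \<in> range enc \<and> e 5 \<in> range enc \<and> e 6 \<in> range enc \<and> e 7 \<in> range enc \<and> \<Gamma> e"
        using H[of e a b c d a' b' c' d'] by (simp add: trunc_eq_point4)
    next
      assume "e 0 \<in> range enc \<and> e 1 \<in> range enc \<and> e 2 \<in> range enc \<and>
        e 3 \<in> range enc \<and> e 4 \<in> range enc \<and> e 5 \<in> range enc \<and> e 6 \<in> range enc \<and> e 7 \<in> range enc \<and> \<Gamma> e"
      moreover from this obtain a b c d a' b' c' d' where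
        "e 0 = enc a" "e 1 = enc b" "e 2 = enc c" "e 3 = enc d"
        "e 4 = enc a'" "e 5 = enc b'" "e 6 = enc c'" "e 7 = enc d'"
        by blast
      moreover from this have "trunc 4 e = point4 (a, b, c, d)"
        "snd_block 4 e = point4 (a', b', c', d')"
        by (simp_all add: snd trunc_eq_point4)
      ultimately show "(trunc 4 e, snd_block 4 e) \<in> G"
        using H[of e a b c d a' b' c' d'] by (force simp: G_def)
    qed
    then show "defp M (\<lambda>e. (trunc 4 e, snd_block 4 e) \<in> G)"
      by (simp only:) (intro defp_intros defp_inst1[OF range] \<Gamma>)
    show "no_paths (range point4)"
    proof (rule no_paths_countable)
      show "countable ((\<lambda>x. x i) ` range point4)" for i by simp
    qed
  qed simp
  \<comment> \<open>Since \<open>point4\<close> is injective, every step of \<open>G\<close> is the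
    image of a step of \<open>H\<close> from the same state, and chains of steps can be
    lifted.\<close>
  moreover have "(point4 s, z) \<in> (G \<union> G\<inverse>)\<^sup>* \<longleftrightarrow> (\<exists>x. z = point4 x \<and> (s, x) \<in> (H \<union> H\<inverse>)\<^sup>*)" for z
  proof
    show "\<exists>x. z = point4 x \<and> (s, x) \<in> (H \<union> H\<inverse>)\<^sup>*" if "(point4 s, z) \<in> (G \<union> G\<inverse>)\<^sup>*"
      using that
    proof (induction rule: rtrancl_induct)
      case (step y z)
      then obtain x where x: "y = point4 x" "(s, x) \<in> (H \<union> H\<inverse>)\<^sup>*" by blast
      with step.hyps(2) have "\<exists>x'. (x, x') \<in> H \<union> H\<inverse> \<and> z = point4 x'"
        by (fastforce simp: G_def dest: injD[OF inj_point4])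
      then obtain x' where "(x, x') \<in> H \<union> H\<inverse>" "z = point4 x'" by blast
      then show ?case using rtrancl_into_rtrancl[OF x(2)] by blast
    qed blast
    have "(point4 s, point4 x) \<in> (G \<union> G\<inverse>)\<^sup>*" if "(s, x) \<in> (H \<union> H\<inverse>)\<^sup>*" for x
      using that
    proof (induction rule: rtrancl_induct)
      case (step x y)
      then have "(point4 x, point4 y) \<in> G \<union> G\<inverse>" by (force simp: G_def)
      with step.IH show ?case by (rule rtrancl.rtrancl_into_rtrancl)
    qed simp
    then show "(point4 s, z) \<in> (G \<union> G\<inverse>)\<^sup>*" if "\<exists>x. z = point4 x \<and> (s, x) \<in> (H \<union> H\<inverse>)\<^sup>*"
      using that by blast
  qed
  moreover have "(\<exists>x. trunc 4 e = point4 x \<and> (s, x) \<in> (H \<union> H\<inverse>)\<^sup>*) \<longleftrightarrow>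
    (\<exists>a b c d. e 0 = enc a \<and> e 1 = enc b \<and> e 2 = enc c \<and> e 3 = enc d \<and>
    (s, (a, b, c, d)) \<in> (H \<union> H\<inverse>)\<^sup>*)" for e
    by (auto simp: trunc_eq_point4)
  ultimately show ?thesis by simp
qed

text \<open>The walk visits all pairs in Cantor's order and counts its steps in the third component,
  so its orbit is the graph of the pairing. The invariant holds after backward steps too, because
  both components and counter are restored.\<close>

lemma defp_pair_rel: "defp M (\<lambda>e. pair_rel enc (e 0) (e 1) (e 2))"
proof -
  define H where "H = {((m, Suc n, c, 0 :: nat), (Suc m, n, Suc c, 0 :: nat)) | m n c. True} \<union>
    {((m, 0, c, 0 :: nat), (0, Suc m, Suc c, 0 :: nat)) | m c. True}"
  define \<Gamma> where "\<Gamma> e \<longleftrightarrow> (suc_rel enc (e 5) (e 1) \<and> suc_rel enc (e 0) (e 4) \<and>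
      suc_rel enc (e 2) (e 6) \<and> e 3 = enc 0 \<and> e 7 = enc 0) \<or>
    (e 1 = enc 0 \<and> e 4 = enc 0 \<and> suc_rel enc (e 0) (e 5) \<and> suc_rel enc (e 2) (e 6) \<and>
      e 3 = enc 0 \<and> e 7 = enc 0)" for e :: "nat \<Rightarrow> real"
  have "defp M (\<lambda>e. \<exists>a b c d. e 0 = enc a \<and> e 1 = enc b \<and> e 2 = enc c \<and> e 3 = enc d \<and>
    ((0, 0, 0, 0), (a, b, c, d)) \<in> (H \<union> H\<inverse>)\<^sup>*)"
  proof (rule defp_nat_orbit)
    show "defp M \<Gamma>"
      unfolding \<Gamma>_def by (intro defp_intros defp_inst2[OF defp_suc_rel])
  qed (auto simp: \<Gamma>_def H_def suc_rel_enc enc_eq)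
  moreover have "((0, 0, 0, 0), x) \<in> (H \<union> H\<inverse>)\<^sup>* \<longleftrightarrow> (\<exists>m n. x = (m, n, prod_encode (m, n), 0))" for x
  proof
    show "\<exists>m n. x = (m, n, prod_encode (m, n), 0)" if "((0, 0, 0, 0), x) \<in> (H \<union> H\<inverse>)\<^sup>*"
      using that
    proof (induction rule: rtrancl_induct)
      case (step x y)
      then show ?case by (auto simp: H_def prod_encode_walk)
    qed (simp add: prod_encode_walk)
    have "((0, 0, 0, 0), (m, n, k, 0)) \<in> (H \<union> H\<inverse>)\<^sup>*" if "k = prod_encode (m, n)" for m n k
      using that
    proof (induction k arbitrary: m n)
      case 0
      then have "m = 0" "n = 0"
        using le_prod_encode_1[of m n] le_prod_encode_2[of n m] by auto
      then show ?case by simp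
    next
      case (Suc k)
      show ?case
      proof (cases m)
        case 0
        then obtain n' where n': "n = Suc n'" using Suc.prems by (cases n) (auto simp: prod_encode_walk)
        then have "((0, 0, 0, 0), (n', 0, k, 0)) \<in> (H \<union> H\<inverse>)\<^sup>*"
          using Suc 0 by (simp add: prod_encode_walk)
        moreover have "((n', 0, k, 0), (m, n, Suc k, 0)) \<in> H" using 0 n' by (simp add: H_def)
        ultimately show ?thesis by (meson UnI1 rtrancl.rtrancl_into_rtrancl)
      next
        case m: (Suc m')
        then have "((0, 0, 0, 0), (m', Suc n, k, 0)) \<in> (H \<union> H\<inverse>)\<^sup>*"
          using Suc by (simp add: prod_encode_walk)
        moreover have "((m', Suc n, k, 0), (m, n, Suc k, 0)) \<in> H" using m by (simp add: H_def)
        ultimately show ?thesis by (meson UnI1 rtrancl.rtrancl_into_rtrancl)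
      qed
    qed
    then show "((0, 0, 0, 0), x) \<in> (H \<union> H\<inverse>)\<^sup>*" if "\<exists>m n. x = (m, n, prod_encode (m, n), 0)"
      using that by blast
  qed
  ultimately have *: "defp M (\<lambda>e. \<exists>a b. e 0 = enc a \<and> e 1 = enc b \<and>
      e 2 = enc (prod_encode (a, b)) \<and> e 3 = enc 0)"
    by (simp add: conj_assoc)
  \<comment> \<open>The padding component is removed by fixing it at \<open>enc 0\<close>.\<close>
  define s :: "nat \<Rightarrow> (nat \<Rightarrow> real) \<Rightarrow> real" where "s i = (if i = 3 then (\<lambda>_. enc 0) else (\<lambda>e. e i))" for i
  have "defp M (\<lambda>e. \<exists>a b. s 0 e = enc a \<and> s 1 e = enc b \<and>
      s 2 e = enc (prod_encode (a, b)) \<and> s 3 e = enc 0)"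
    using defp_inst[OF *, of s] by (simp add: s_def is_atom_simps)
  then show ?thesis by (simp add: s_def pair_rel_def)
qed

text \<open>
  The lists \<open>ys\<close> and \<open>xs\<close> are the two halves of a zipper in the list coded by the first
  component. Moving the zipper is reversible, so that no two lists are ever identified.
\<close>

lemma defp_zipper:
  "defp M (\<lambda>e. \<exists>xs ys. e 0 = enc (list_encode (rev ys @ xs)) \<and> e 1 = enc (length ys) \<and>
     e 2 = enc (list_encode xs) \<and> e 3 = enc (list_encode ys))"
proof -
  \<comment> \<open>The first kind of step moves one entry across the zipper. The second joins the
    initial states of all lists, so that a single orbit starting at 0 reaches every list.\<close>
  define H where "H = {((c, i, list_encode (h # xs), list_encode ys),
      (c, Suc i, list_encode xs, list_encode (h # ys))) | c i h xs ys. True} \<union>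
    {((c, 0, c, 0), (Suc c, 0, Suc c, 0)) | c. True}"
  have H_iff: "((c, i, d, r), (c', i', d', r')) \<in> H \<longleftrightarrow>
      (c = c' \<and> i' = Suc i \<and> (\<exists>h. d = Suc (prod_encode (h, d')) \<and> r' = Suc (prod_encode (h, r)))) \<or>
      (i = 0 \<and> d = c \<and> r = 0 \<and> c' = Suc c \<and> i' = 0 \<and> d' = c' \<and> r' = 0)" for c i d r c' i' d' r'
  proof -
    have "(\<exists>h. d = Suc (prod_encode (h, d')) \<and> r' = Suc (prod_encode (h, r))) \<longleftrightarrow>
        (\<exists>h xs ys. d = list_encode (h # xs) \<and> r = list_encode ys \<and>
          d' = list_encode xs \<and> r' = list_encode (h # ys))"
      by (metis list_decode_inverse list_encode.simps(2))
    then show ?thesis by (simp add: H_def del: list_encode.simps) metis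
  qed
  \<comment> \<open>A nonempty list has code \<open>Suc (prod_encode (h, t))\<close> with
    \<open>t\<close> the code of its tail, so \<open>u\<close> and \<open>w\<close> stand for the
    pairs before the successor is taken. The empty list has code 0.\<close>
  define \<Gamma> where "\<Gamma> e \<longleftrightarrow> (e 0 = e 4 \<and> suc_rel enc (e 1) (e 5) \<and>
      (\<exists>h u w. pair_rel enc h (e 6) u \<and> suc_rel enc u (e 2) \<and> pair_rel enc h (e 3) w \<and> suc_rel enc w (e 7))) \<or>
    (e 1 = enc 0 \<and> e 2 = e 0 \<and> e 3 = enc 0 \<and> suc_rel enc (e 0) (e 4) \<and> e 5 = enc 0 \<and> e 6 = e 4 \<and>
      e 7 = enc 0)" for e :: "nat \<Rightarrow> real"
  have "defp M (\<lambda>e. \<exists>a b c d. e 0 = enc a \<and> e 1 = enc b \<and> e 2 = enc c \<and> e 3 = enc d \<and>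
    ((0, 0, 0, 0), (a, b, c, d)) \<in> (H \<union> H\<inverse>)\<^sup>*)"
  proof (rule defp_nat_orbit)
    show "defp M \<Gamma>"
      unfolding \<Gamma>_def by (intro defp_intros defp_inst2[OF defp_suc_rel] defp_inst3[OF defp_pair_rel])
    fix e :: "nat \<Rightarrow> real" and a b c d a' b' c' d'
    assume e: "e 0 = enc a" "e 1 = enc b" "e 2 = enc c" "e 3 = enc d"
      "e 4 = enc a'" "e 5 = enc b'" "e 6 = enc c'" "e 7 = enc d'"
    have zip: "(\<exists>h u w. pair_rel enc h (e 6) u \<and> suc_rel enc u (e 2) \<and> pair_rel enc h (e 3) w \<and> suc_rel enc w (e 7))
      \<longleftrightarrow> (\<exists>h. c = Suc (prod_encode (h, c')) \<and> d' = Suc (prod_encode (h, d)))"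
      unfolding e by (force simp: pair_rel_def suc_rel_def enc_eq)
    show "\<Gamma> e \<longleftrightarrow> ((a, b, c, d), (a', b', c', d')) \<in> H"
      unfolding \<Gamma>_def H_iff zip unfolding e suc_rel_enc enc_eq by auto
  qed
  moreover have "((0, 0, 0, 0), x) \<in> (H \<union> H\<inverse>)\<^sup>* \<longleftrightarrow>
    (\<exists>xs ys. x = (list_encode (rev ys @ xs), length ys, list_encode xs, list_encode ys))" (is "_ \<longleftrightarrow> ?K x") for x
  proof
    \<comment> \<open>The equivalence covers both directions of a step. Moving an entry leaves
      \<open>rev ys @ xs\<close> unchanged, and initial states satisfy the invariant
      unconditionally.\<close>
    have H_K: "?K u \<longleftrightarrow> ?K v" if uv: "(u, v) \<in> H" for u v
    proof -
      from uv consider c i h xs ys where "u = (c, i, list_encode (h # xs), list_encode ys)"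
          "v = (c, Suc i, list_encode xs, list_encode (h # ys))"
        | c where "u = (c, 0, c, 0)" "v = (Suc c, 0, Suc c, 0)"
        by (auto simp: H_def)
      then show ?thesis
      proof cases
        case 1
        then show ?thesis
          by (auto simp: list_encode_eq simp del: list_encode.simps)
      next
        case 2
        have "?K (c, 0, c, 0)" for c
          by (rule exI[of _ "list_decode c"], rule exI[of _ "[]"]) simp
        then show ?thesis using 2 by blast
      qed
    qed
    show "?K x" if "((0, 0, 0, 0), x) \<in> (H \<union> H\<inverse>)\<^sup>*"
      using that
    proof (induction rule: rtrancl_induct)
      case base
      show ?case by (rule exI[of _ "[]"], rule exI[of _ "[]"]) simp
    next
      case (step y z)
      then show ?case using H_K[of y z] H_K[of z y] by blast
    qed
    have start: "((0, 0, 0, 0), (c, 0, c, 0)) \<in> (H \<union> H\<inverse>)\<^sup>*" for c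
    proof (induction c)
      case (Suc c)
      have "((c, 0, c, 0), (Suc c, 0, Suc c, 0)) \<in> H" by (simp add: H_def)
      with Suc.IH show ?case by (meson UnI1 rtrancl.rtrancl_into_rtrancl)
    qed simp
    have "((0, 0, 0, 0), (list_encode (rev ys @ xs), length ys, list_encode xs, list_encode ys))
      \<in> (H \<union> H\<inverse>)\<^sup>*" for xs ys
    proof (induction ys arbitrary: xs)
      case (Cons h ys)
      have "((list_encode (rev (h # ys) @ xs), length ys, list_encode (h # xs), list_encode ys),
          (list_encode (rev (h # ys) @ xs), length (h # ys), list_encode xs, list_encode (h # ys))) \<in> H"
        unfolding H_def by auto
      with Cons.IH[of "h # xs"] show ?case
        by (simp del: list_encode.simps) (meson UnI1 rtrancl.rtrancl_into_rtrancl)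
    qed (simp add: start)
    then show "((0, 0, 0, 0), x) \<in> (H \<union> H\<inverse>)\<^sup>*" if "?K x" using that by blast
  qed
  ultimately show ?thesis by (simp only: prod.inject) (erule back_subst[of "defp M"], blast)
qed

text \<open>After as many zipper moves as the index says, the wanted entry is the head of the
  remaining list. The existence of that head also enforces that the index is within bounds.\<close>

lemma defp_nth_rel: "defp M (\<lambda>e. nth_rel enc (e 0) (e 1) (e 2))"
proof -
  define Z where "Z x y z w \<longleftrightarrow> (\<exists>xs ys. x = enc (list_encode (rev ys @ xs)) \<and> y = enc (length ys) \<and>
     z = enc (list_encode xs) \<and> w = enc (list_encode ys))" for x y z w
  have Z: "defp M (\<lambda>e. Z (e 0) (e 1) (e 2) (e 3))"
    using defp_zipper by (simp add: Z_def)
  have Z': "defp M (\<lambda>e. Z (f e) (g e) (h e) (k e))" if "is_atom f" "is_atom g" "is_atom h" "is_atom k" for f g h k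
    using defp_inst[OF Z, of "\<lambda>i. if i = 0 then f else if i = 1 then g else if i = 2 then h else k"] that
    by simp
  have "nth_rel enc x y z \<longleftrightarrow> (\<exists>w u d r. Z x y d w \<and> pair_rel enc z r u \<and> suc_rel enc u d)" for x y z
  proof
    assume "nth_rel enc x y z"
    then obtain c i where ci: "x = enc c" "y = enc i" "i < length (list_decode c)"
      "z = enc (list_decode c ! i)" unfolding nth_rel_def by blast
    let ?l = "list_decode c"
    have "Z x y (enc (list_encode (drop i ?l))) (enc (list_encode (rev (take i ?l))))"
      unfolding Z_def using ci by (intro exI[of _ "drop i ?l"] exI[of _ "rev (take i ?l)"]) simp
    moreover have "drop i ?l = ?l ! i # drop (Suc i) ?l" using ci(3) by (simp add: Cons_nth_drop_Suc)
    ultimately have "Z x y (enc (Suc (prod_encode (?l ! i, list_encode (drop (Suc i) ?l)))))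
        (enc (list_encode (rev (take i ?l))))" by simp
    then show "\<exists>w u d r. Z x y d w \<and> pair_rel enc z r u \<and> suc_rel enc u d"
      unfolding ci(4) pair_rel_def suc_rel_def by blast
  next
    assume "\<exists>w u d r. Z x y d w \<and> pair_rel enc z r u \<and> suc_rel enc u d"
    then obtain xs ys h j where *: "x = enc (list_encode (rev ys @ xs))" "y = enc (length ys)"
      "z = enc h" "list_encode xs = Suc (prod_encode (h, j))"
      unfolding Z_def pair_rel_def suc_rel_def enc_eq by (metis enc_eq)
    have "xs = h # list_decode j" using arg_cong[OF *(4), of list_decode] by simp
    then show "nth_rel enc x y z" unfolding nth_rel_def using *
      by (intro exI[of _ "list_encode (rev ys @ xs)"] exI[of _ "length ys"]) (simp add: nth_append)
  qed
  then show ?thesis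
    by (simp only:) (intro defp_intros Z' defp_inst2[OF defp_suc_rel] defp_inst3[OF defp_pair_rel])
qed

end

lemma ex_definable_arithmetic:
  assumes "PCC M" and lt: "defp M (\<lambda>e. e 0 < e 1)" and add: "defp M (\<lambda>e. e 0 + e 1 = e 2)"
    and "\<not> o_minimal M"
  obtains enc where "inj enc" "defp M (\<lambda>e. e 0 \<in> range enc)"
    "defp M (\<lambda>e. suc_rel enc (e 0) (e 1))" "defp M (\<lambda>e. less_rel enc (e 0) (e 1))"
    "defp M (\<lambda>e. pair_rel enc (e 0) (e 1) (e 2))" "defp M (\<lambda>e. nth_rel enc (e 0) (e 1) (e 2))"
proof -
  obtain L where L: "omega_like L" "defp M (\<lambda>e. e 0 \<in> L)"
    using ex_omega_like[OF assms] by blast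
  obtain enc :: "nat \<Rightarrow> real" where enc: "strict_mono enc" "range enc = L"
    using omega_like_enum[OF L(1)] by blast
  have rng: "defp M (\<lambda>e. e 0 \<in> range enc)" using L(2) enc(2) by simp
  note * = enc(1) \<open>PCC M\<close> lt rng
  show thesis
    by (rule that[OF strict_mono_imp_inj_on[OF enc(1)] rng defp_suc_rel[OF *] defp_less_rel[OF *]
          defp_pair_rel[OF *] defp_nth_rel[OF *]])
qed

section \<open>Undecidability\<close>

lemma map_eq_map_conv_pointwise:
  assumes "\<And>x y. x \<in> set xs \<Longrightarrow> y \<in> set ys \<Longrightarrow> f x = f y \<Longrightarrow> x = y" "map f xs = map f ys"
  shows "xs = ys"
  using assms
proof (induction xs arbitrary: ys)
  case (Cons x xs)
  then obtain y ys' where ys: "ys = y # ys'" "f x = f y" "map f xs = map f ys'" by auto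
  have "xs = ys'" by (rule Cons.IH) (use Cons.prems(1) ys in auto)
  moreover have "x = y" using Cons.prems(1) ys by simp
  ultimately show ?case using ys by simp
qed simp

lemma tm_code_inj:
  assumes "inj_on cf (fun_syms M)" "wf_tm M s" "wf_tm M t" "tm_code cf s = tm_code cf t"
  shows "s = t"
  using assms(2-4)
proof (induction s arbitrary: t)
  case (Var v)
  then show ?case by (cases t) auto
next
  case (Fn f ts)
  then obtain g us where t: "t = Fn g us" by (cases t) auto
  have eq: "cf f = cf g" "map (tm_code cf) ts = map (tm_code cf) us"
    using Fn.prems(3) by (auto simp: t list_encode_eq)
  have "ts = us"
    by (rule map_eq_map_conv_pointwise[OF _ eq(2)]) (use Fn t in auto)
  moreover have "f = g" using assms(1) eq(1) Fn.prems t by (auto dest: inj_onD)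
  ultimately show ?case by (simp add: t)
qed

text \<open>The numberings are injective on the symbols of the language, hence the restriction to
  well-formed formulas. This lets membership of a code in the coded theory be read as membership of
  the sentence itself.\<close>

lemma fm_code_inj:
  assumes "inj_on cf (fun_syms M)" "inj_on cr (rel_syms M)"
    and "wf_fm M \<phi>" "wf_fm M \<psi>" "fm_code cf cr \<phi> = fm_code cf cr \<psi>"
  shows "\<phi> = \<psi>"
  using assms(3-5)
proof (induction \<phi> arbitrary: \<psi>)
  case (Eq s t)
  then show ?case by (cases \<psi>) (auto dest: tm_code_inj[OF assms(1)])
next
  case (Rel r ts)
  then obtain q us where \<psi>: "\<psi> = Rel q us" by (cases \<psi>) auto
  have eq: "cr r = cr q" "map (tm_code cf) ts = map (tm_code cf) us"
    using Rel.prems(3) by (auto simp: \<psi> list_encode_eq)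
  have "ts = us"
    by (rule map_eq_map_conv_pointwise[OF _ eq(2)])
      (use Rel.prems \<psi> in \<open>auto dest: tm_code_inj[OF assms(1)]\<close>)
  moreover have "r = q" using assms(2) eq(1) Rel.prems \<psi> by (auto dest: inj_onD)
  ultimately show ?case by (simp add: \<psi>)
next
  case (Neg \<phi>)
  from Neg.prems show ?case by (cases \<psi>) (auto dest: Neg.IH)
next
  case (Conj \<phi>1 \<phi>2)
  from Conj.prems show ?case by (cases \<psi>) (auto dest: Conj.IH)
next
  case (Ex v \<phi>)
  from Ex.prems show ?case by (cases \<psi>) (auto dest: Ex.IH)
qed

text \<open>
  Parameters cannot be fixed in a sentence, so that a sentence can only speak about all parameters
  for which the interpreted structure satisfies the following finitely many axioms. For some
  parameters it need not be the standard model, hence recursive functions must be represented, as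
  in Robinson arithmetic, and not merely be defined. Here \<open>Pr\<close> is meant as the graph of
  \<^const>\<open>prod_encode\<close>, and \<open>Nt c i v\<close> says that \<open>v\<close> is entry \<open>i\<close> of the sequence coded by \<open>c\<close>.
\<close>

locale arith_model =
  fixes N :: "real \<Rightarrow> bool" and Sc Lt :: "real \<Rightarrow> real \<Rightarrow> bool"
    and Pr Nt :: "real \<Rightarrow> real \<Rightarrow> real \<Rightarrow> bool" and z :: real
  assumes zero_N: "N z"
    and Sc_N: "Sc x y \<Longrightarrow> N x \<and> N y"
    and Sc_ex: "N x \<Longrightarrow> \<exists>y. Sc x y"
    and Sc_fun: "Sc x y \<Longrightarrow> Sc x y' \<Longrightarrow> y = y'"
    and Sc_inj: "Sc x y \<Longrightarrow> Sc x' y \<Longrightarrow> x = x'"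
    and Sc_zero: "\<not> Sc x z"
    and Lt_zero: "\<not> Lt x z"
    and Lt_Sc: "Sc y y' \<Longrightarrow> Lt x y' \<longleftrightarrow> Lt x y \<or> x = y"
    and Lt_linear: "N x \<Longrightarrow> N y \<Longrightarrow> Lt x y \<or> x = y \<or> Lt y x"
    and Pr_N: "Pr x y w \<Longrightarrow> N x"
    and Pr_fun: "Pr x y w \<Longrightarrow> Pr x y w' \<Longrightarrow> w = w'"
    and Pr_zero: "Pr x y z \<longleftrightarrow> x = z \<and> y = z"
    and Pr_Sc: "Sc w w' \<Longrightarrow> Pr x y w' \<longleftrightarrow>
        (\<exists>x' y'. Sc x' x \<and> Sc y y' \<and> Pr x' y' w) \<or> x = z \<and> (\<exists>y'. Sc y' y \<and> Pr y' z w)"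
    and Nt_fun: "Nt c i v \<Longrightarrow> Nt c i v' \<Longrightarrow> v = v'"
    and Nt_N: "Nt c i v \<Longrightarrow> N c"
    and Nt_start: "N v \<Longrightarrow> \<exists>c. Nt c z v"
    and Nt_extend: "N c \<Longrightarrow> Sc n n' \<Longrightarrow> N v \<Longrightarrow>
        \<exists>c'. (\<forall>i w. (Lt i n \<or> i = n) \<and> Nt c i w \<longrightarrow> Nt c' i w) \<and> Nt c' n' v"

section \<open>Interpreted arithmetic and its standard part\<close>

locale arith_interpretation =
  fixes M :: "('f, 'r) real_structure"
    and N :: "(nat \<Rightarrow> real) \<Rightarrow> real \<Rightarrow> bool"
    and Sc Lt :: "(nat \<Rightarrow> real) \<Rightarrow> real \<Rightarrow> real \<Rightarrow> bool"
    and Pr Nt :: "(nat \<Rightarrow> real) \<Rightarrow> real \<Rightarrow> real \<Rightarrow> real \<Rightarrow> bool"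
  assumes N: "uniformly_def M (\<lambda>p e. N p (e 0))"
    and Sc: "uniformly_def M (\<lambda>p e. Sc p (e 0) (e 1))"
    and Lt: "uniformly_def M (\<lambda>p e. Lt p (e 0) (e 1))"
    and Pr: "uniformly_def M (\<lambda>p e. Pr p (e 0) (e 1) (e 2))"
    and Nt: "uniformly_def M (\<lambda>p e. Nt p (e 0) (e 1) (e 2))"
begin

text \<open>The first parameter doubles as the zero of the interpreted model, so that every sentence
  about the model can mention zero directly.\<close>

definition arith :: "(nat \<Rightarrow> real) \<Rightarrow> bool" where
  "arith p \<longleftrightarrow> arith_model (N p) (Sc p) (Lt p) (Pr p) (Nt p) (p 0)"

lemmas arith_intros = uniformly_def_intros uniformly_def_inst1[OF N] uniformly_def_inst2[OF Sc]
  uniformly_def_inst2[OF Lt] uniformly_def_inst3[OF Pr] uniformly_def_inst3[OF Nt]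

lemma uniformly_def_arith: "uniformly_def M (\<lambda>p e. arith p)"
  unfolding arith_def arith_model_def by (intro arith_intros)

primrec num :: "(nat \<Rightarrow> real) \<Rightarrow> nat \<Rightarrow> real" where
  "num p 0 = p 0"
| "num p (Suc n) = (THE y. Sc p (num p n) y)"

context
  fixes p assumes p: "arith p"
begin

lemma arith_model: "arith_model (N p) (Sc p) (Lt p) (Pr p) (Nt p) (p 0)"
  using p by (simp add: arith_def)

lemmas zero_N = arith_model.zero_N[OF arith_model]
lemmas Sc_N = arith_model.Sc_N[OF arith_model]
lemmas Sc_ex = arith_model.Sc_ex[OF arith_model]
lemmas Sc_fun = arith_model.Sc_fun[OF arith_model]
lemmas Sc_inj = arith_model.Sc_inj[OF arith_model]
lemmas Sc_zero = arith_model.Sc_zero[OF arith_model]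
lemmas Lt_zero = arith_model.Lt_zero[OF arith_model]
lemmas Lt_Sc = arith_model.Lt_Sc[OF arith_model]
lemmas Lt_linear = arith_model.Lt_linear[OF arith_model]
lemmas Pr_N = arith_model.Pr_N[OF arith_model]
lemmas Pr_fun = arith_model.Pr_fun[OF arith_model]
lemmas Pr_zero = arith_model.Pr_zero[OF arith_model]
lemmas Pr_Sc = arith_model.Pr_Sc[OF arith_model]
lemmas Nt_fun = arith_model.Nt_fun[OF arith_model]
lemmas Nt_N = arith_model.Nt_N[OF arith_model]
lemmas Nt_start = arith_model.Nt_start[OF arith_model]
lemmas Nt_extend = arith_model.Nt_extend[OF arith_model]

lemma N_num: "N p (num p n)" and Sc_num: "Sc p (num p n) (num p (Suc n))"
proof -
  have Sc: "Sc p x (THE y. Sc p x y)" if "N p x" for x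
    using Sc_ex[OF that] Sc_fun by (metis theI)
  show N: "N p (num p n)" for n
  proof (induction n)
    case 0
    show ?case using zero_N by simp
  next
    case (Suc n)
    show ?case using Sc_N[OF Sc[OF Suc]] by simp
  qed
  show "Sc p (num p n) (num p (Suc n))" using Sc[OF N] by simp
qed

lemma Sc_num_iff: "Sc p (num p n) y \<longleftrightarrow> y = num p (Suc n)" "Sc p x (num p (Suc n)) \<longleftrightarrow> x = num p n"
  using Sc_num Sc_fun Sc_inj by blast+

lemma num_Suc_neq_zero: "num p (Suc n) \<noteq> p 0" "p 0 \<noteq> num p (Suc n)"
  using Sc_num[of n] Sc_zero by metis+

lemma num_eq_iff: "num p i = num p j \<longleftrightarrow> i = j"
proof (induction i arbitrary: j)
  case 0
  show ?case by (cases j) (auto simp: num_Suc_neq_zero simp del: num.simps(2))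
next
  case (Suc i)
  show ?case
  proof (cases j)
    case (Suc k)
    have "num p (Suc i) = num p (Suc k) \<longleftrightarrow> num p i = num p k"
      using Sc_num_iff(1)[of i] Sc_num_iff(2)[of _ k] by metis
    then show ?thesis using Suc.IH Suc by simp
  qed (simp add: num_Suc_neq_zero del: num.simps(2))
qed

text \<open>By the recursion axiom for \<open>Lt\<close>, nothing nonstandard lies below a standard
  numeral.\<close>

lemma Lt_num: "Lt p x (num p n) \<longleftrightarrow> (\<exists>k<n. x = num p k)"
proof (induction n)
  case 0
  show ?case by (simp add: Lt_zero)
next
  case (Suc n)
  show ?case using Lt_Sc[OF Sc_num[of n], of x] Suc.IH by (auto simp: less_Suc_eq simp del: num.simps)
qed

text \<open>Induction on the code with the two recursion axioms, which are Cantor's walk read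
  backwards. The arguments are arbitrary: a standard code forces both components to be
  standard.\<close>

lemma Pr_num: "Pr p x y (num p k) \<longleftrightarrow> (\<exists>i j. x = num p i \<and> y = num p j \<and> k = prod_encode (i, j))"
proof (induction k arbitrary: x y)
  case 0
  have "0 = prod_encode (i, j) \<longleftrightarrow> i = 0 \<and> j = 0" for i j
    using le_prod_encode_1[of i j] le_prod_encode_2[of j i] by (auto simp: prod_encode_def)
  then show ?case by (auto simp: Pr_zero)
next
  case (Suc k)
  have zero: "p 0 = num p i \<longleftrightarrow> i = 0" for i
    using num_eq_iff[of 0 i] by auto
  have "Pr p x y (num p (Suc k)) \<longleftrightarrow>
      (\<exists>x' y' i j. Sc p x' x \<and> Sc p y y' \<and> x' = num p i \<and> y' = num p j \<and> k = prod_encode (i, j)) \<or>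
        x = p 0 \<and> (\<exists>y' i j. Sc p y' y \<and> y' = num p i \<and> p 0 = num p j \<and> k = prod_encode (i, j))"
    unfolding Pr_Sc[OF Sc_num] Suc.IH by blast
  also have "\<dots> \<longleftrightarrow> (\<exists>i j. x = num p (Suc i) \<and> Sc p y (num p j) \<and> k = prod_encode (i, j)) \<or>
        x = p 0 \<and> (\<exists>i. y = num p (Suc i) \<and> k = prod_encode (i, 0))"
    unfolding zero using Sc_num_iff by (auto simp del: num.simps)
  also have "(\<exists>i j. x = num p (Suc i) \<and> Sc p y (num p j) \<and> k = prod_encode (i, j)) \<longleftrightarrow>
      (\<exists>i j. x = num p (Suc i) \<and> y = num p j \<and> k = prod_encode (i, Suc j))"
  proof -
    have "Sc p y (num p j) \<longleftrightarrow> (\<exists>j'. j = Suc j' \<and> y = num p j')" for j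
      by (cases j) (auto simp: Sc_zero Sc_num_iff simp del: num.simps(2))
    then show ?thesis by auto
  qed
  also have "\<dots> \<or> x = p 0 \<and> (\<exists>i. y = num p (Suc i) \<and> k = prod_encode (i, 0)) \<longleftrightarrow>
      (\<exists>i j. x = num p i \<and> y = num p j \<and> Suc k = prod_encode (i, j))"
  proof -
    have "Suc k = prod_encode (i, j) \<longleftrightarrow> (\<exists>i'. i = Suc i' \<and> k = prod_encode (i', Suc j)) \<or>
        i = 0 \<and> (\<exists>j'. j = Suc j' \<and> k = prod_encode (j', 0))" for i j
      by (cases i; cases j) (simp_all add: prod_encode_walk)
    then show ?thesis by (auto simp del: num.simps(2))
  qed
  finally show ?case .
qed

lemma Pr_num_iff: "Pr p (num p i) (num p j) z \<longleftrightarrow> z = num p (prod_encode (i, j))"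
  using Pr_num Pr_fun by blast

end

section \<open>Representability\<close>

definition rep :: "(nat \<Rightarrow> nat \<Rightarrow> bool) \<Rightarrow> bool" where
  "rep F \<longleftrightarrow> (\<exists>Q. uniformly_def M (\<lambda>p e. Q p (e 0) (e 1)) \<and>
     (\<forall>p. arith p \<longrightarrow> (\<forall>x y z. F x y \<longrightarrow> (Q p (num p x) z \<longleftrightarrow> z = num p y))))"

lemma repI:
  assumes "uniformly_def M (\<lambda>p e. Q p (e 0) (e 1))"
    and "\<And>p x y z. arith p \<Longrightarrow> F x y \<Longrightarrow> Q p (num p x) z \<longleftrightarrow> z = num p y"
  shows "rep F"
  using assms unfolding rep_def by blast

lemma repE:
  assumes "rep F"
  obtains Q where "uniformly_def M (\<lambda>p e. Q p (e 0) (e 1))"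
    "\<And>p x y z. arith p \<Longrightarrow> F x y \<Longrightarrow> Q p (num p x) z \<longleftrightarrow> z = num p y"
  using assms unfolding rep_def by blast

text \<open>\<open>rep\<close> makes demands only at inputs where the relation has a value, but
  there it excludes every other real, nonstandard elements included. A smaller relation therefore
  poses fewer demands on the same formula.\<close>

lemma rep_mono:
  assumes "rep F" and F': "\<And>x y. F' x y \<Longrightarrow> F x y"
  shows "rep F'"
proof -
  obtain Q where Q: "uniformly_def M (\<lambda>p e. Q p (e 0) (e 1))"
      "\<And>p x y z. arith p \<Longrightarrow> F x y \<Longrightarrow> Q p (num p x) z \<longleftrightarrow> z = num p y"
    using repE[OF assms(1)] by blast
  show ?thesis by (rule repI[OF Q(1)]) (rule Q(2), assumption, erule F')
qed

lemma rep_id: "rep (\<lambda>x y. y = x)"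
proof (rule repI)
  show "uniformly_def M (\<lambda>p e. e 1 = e 0)" by (intro arith_intros)
qed simp

lemma rep_zero: "rep (\<lambda>x y. y = 0)"
proof (rule repI)
  show "uniformly_def M (\<lambda>p e. e 1 = p 0)" by (intro arith_intros)
qed simp

lemma rep_Suc: "rep (\<lambda>x y. y = Suc x)"
proof (rule repI)
  show "uniformly_def M (\<lambda>p e. Sc p (e 0) (e 1))" by (intro arith_intros)
qed (simp add: Sc_num_iff del: num.simps)

lemma rep_pred: "rep (\<lambda>x y. x = Suc y)"
proof (rule repI)
  show "uniformly_def M (\<lambda>p e. Sc p (e 1) (e 0))" by (intro arith_intros)
qed (simp add: Sc_num_iff del: num.simps)

lemma rep_fst: "rep (\<lambda>x y. \<exists>b. x = prod_encode (y, b))"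
proof (rule repI)
  show "uniformly_def M (\<lambda>p e. \<exists>w. Pr p (e 1) w (e 0))" by (intro arith_intros)
qed (auto simp: Pr_num num_eq_iff simp del: num.simps)

lemma rep_snd: "rep (\<lambda>x y. \<exists>a. x = prod_encode (a, y))"
proof (rule repI)
  show "uniformly_def M (\<lambda>p e. \<exists>w. Pr p w (e 1) (e 0))" by (intro arith_intros)
qed (auto simp: Pr_num num_eq_iff simp del: num.simps)

lemma rep_comp:
  assumes "rep F" "rep G"
  shows "rep (\<lambda>x z. \<exists>y. G x y \<and> F y z)"
proof -
  obtain QF where F: "uniformly_def M (\<lambda>p e. QF p (e 0) (e 1))"
      "\<And>p x y z. arith p \<Longrightarrow> F x y \<Longrightarrow> QF p (num p x) z \<longleftrightarrow> z = num p y"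
    using repE[OF assms(1)] by blast
  obtain QG where G: "uniformly_def M (\<lambda>p e. QG p (e 0) (e 1))"
      "\<And>p x y z. arith p \<Longrightarrow> G x y \<Longrightarrow> QG p (num p x) z \<longleftrightarrow> z = num p y"
    using repE[OF assms(2)] by blast
  show ?thesis
  proof (rule repI)
    show "uniformly_def M (\<lambda>p e. \<exists>w. QG p (e 0) w \<and> QF p w (e 1))"
      by (intro arith_intros uniformly_def_inst2[OF F(1)] uniformly_def_inst2[OF G(1)])
  qed (auto simp: F(2) G(2))
qed

lemma rep_pair:
  assumes "rep F" "rep G"
  shows "rep (\<lambda>x z. \<exists>a b. F x a \<and> G x b \<and> z = prod_encode (a, b))"
proof -
  obtain QF where F: "uniformly_def M (\<lambda>p e. QF p (e 0) (e 1))"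
      "\<And>p x y z. arith p \<Longrightarrow> F x y \<Longrightarrow> QF p (num p x) z \<longleftrightarrow> z = num p y"
    using repE[OF assms(1)] by blast
  obtain QG where G: "uniformly_def M (\<lambda>p e. QG p (e 0) (e 1))"
      "\<And>p x y z. arith p \<Longrightarrow> G x y \<Longrightarrow> QG p (num p x) z \<longleftrightarrow> z = num p y"
    using repE[OF assms(2)] by blast
  show ?thesis
  proof (rule repI)
    show "uniformly_def M (\<lambda>p e. \<exists>u w. QF p (e 0) u \<and> QG p (e 0) w \<and> Pr p u w (e 1))"
      by (intro arith_intros uniformly_def_inst2[OF F(1)] uniformly_def_inst2[OF G(1)])
  qed (auto simp: F(2) G(2) Pr_num_iff simp del: num.simps)
qed

text \<open>Primitive recursion with arguments packed into pairs, as a relation because the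
  functions involved may be partial.\<close>

inductive prec :: "(nat \<Rightarrow> nat \<Rightarrow> bool) \<Rightarrow> (nat \<Rightarrow> nat \<Rightarrow> bool) \<Rightarrow> nat \<Rightarrow> nat \<Rightarrow> nat \<Rightarrow> bool" for F G where
  "F x y \<Longrightarrow> prec F G 0 x y"
| "prec F G n x y \<Longrightarrow> G (prod_encode (n, prod_encode (y, x))) z \<Longrightarrow> prec F G (Suc n) x z"

text \<open>A number \<open>s\<close> codes the sequence of intermediate values. In a nonstandard
  model such a code may be strange further out, but its entries at standard positions are forced one
  after another, since all relations involved are functional. Existence comes from
  \<open>Nt_extend\<close>.\<close>

lemma rep_prec:
  assumes "rep F" "rep G"
  shows "rep (\<lambda>c z. \<exists>n x. c = prod_encode (n, x) \<and> prec F G n x z)"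
proof -
  obtain QF where F: "uniformly_def M (\<lambda>p e. QF p (e 0) (e 1))"
      "\<And>p x y z. arith p \<Longrightarrow> F x y \<Longrightarrow> QF p (num p x) z \<longleftrightarrow> z = num p y"
    using repE[OF assms(1)] by blast
  obtain QG where G: "uniformly_def M (\<lambda>p e. QG p (e 0) (e 1))"
      "\<And>p x y z. arith p \<Longrightarrow> G x y \<Longrightarrow> QG p (num p x) z \<longleftrightarrow> z = num p y"
    using repE[OF assms(2)] by blast
  define step where "step p x s i \<longleftrightarrow> (\<exists>y i' y' u v. Nt p s i y \<and> Sc p i i' \<and> Nt p s i' y' \<and>
      Pr p y x u \<and> Pr p i u v \<and> QG p v y')" for p x s i
  define run where "run p n x s \<longleftrightarrow> (\<exists>y. QF p x y \<and> Nt p s (p 0) y) \<and>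
      (\<forall>i. Lt p i n \<longrightarrow> step p x s i)" for p n x s
  have main: "(\<exists>s. run p (num p n) (num p x) s \<and> Nt p s (num p n) z) \<longleftrightarrow> z = num p y"
    if p: "arith p" and "prec F G n x y" for p n x y z
    using that(2)
  proof (induction arbitrary: z rule: prec.induct)
    case (1 x y)
    have "run p (num p 0) (num p x) s \<longleftrightarrow> Nt p s (p 0) (num p y)" for s
      using p 1 by (simp add: run_def F(2) Lt_zero)
    then show ?case
      using Nt_fun[OF p] Nt_start[OF p N_num[OF p]] by auto
  next
    case (2 n x y w)
    have step_n: "step p (num p x) s (num p n) \<longleftrightarrow> Nt p s (num p (Suc n)) (num p w)"
      if "Nt p s (num p n) (num p y)" for s
    proof
      assume "step p (num p x) s (num p n)"
      then obtain y0 i' y' u v where *: "Nt p s (num p n) y0" "Sc p (num p n) i'" "Nt p s i' y'"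
        "Pr p y0 (num p x) u" "Pr p (num p n) u v" "QG p v y'" unfolding step_def by blast
      have "y0 = num p y" using Nt_fun[OF p *(1) that] .
      then have "u = num p (prod_encode (y, x))" using *(4) by (simp add: Pr_num_iff[OF p])
      then have "v = num p (prod_encode (n, prod_encode (y, x)))" using *(5) by (simp add: Pr_num_iff[OF p])
      then have "y' = num p w" using *(6) G(2)[OF p 2(2)] by simp
      then show "Nt p s (num p (Suc n)) (num p w)" using *(2,3) by (simp add: Sc_num_iff[OF p] del: num.simps)
    next
      assume "Nt p s (num p (Suc n)) (num p w)"
      then show "step p (num p x) s (num p n)"
        unfolding step_def using that Sc_num[OF p, of n] Pr_num_iff[OF p] G(2)[OF p 2(2)] by blast
    qed
    have run_Suc: "run p (num p (Suc n)) (num p x) s \<longleftrightarrow>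
        run p (num p n) (num p x) s \<and> step p (num p x) s (num p n)" for s
      unfolding run_def Lt_num[OF p] by (auto simp: less_Suc_eq simp del: num.simps)
    show ?case
    proof
      assume "\<exists>s. run p (num p (Suc n)) (num p x) s \<and> Nt p s (num p (Suc n)) z"
      then obtain s where s: "run p (num p n) (num p x) s" "step p (num p x) s (num p n)"
        "Nt p s (num p (Suc n)) z" unfolding run_Suc by blast
      obtain y0 where "Nt p s (num p n) y0" using s(2) unfolding step_def by blast
      then have "Nt p s (num p n) (num p y)" using 2(3)[of y0] s(1) by blast
      then have "Nt p s (num p (Suc n)) (num p w)" using s(2) step_n by blast
      then show "z = num p w" using Nt_fun[OF p s(3)] by blast
    next
      assume z: "z = num p w"
      obtain s where s: "run p (num p n) (num p x) s" "Nt p s (num p n) (num p y)"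
        using 2(3)[of "num p y"] by blast
      \<comment> \<open>The new code keeps all entries up to position \<open>n\<close> and holds the
        next value behind them, so the old steps remain valid.\<close>
      obtain s' where s': "\<And>i w. Lt p i (num p n) \<or> i = num p n \<Longrightarrow> Nt p s i w \<Longrightarrow> Nt p s' i w"
          "Nt p s' (num p (Suc n)) (num p w)"
        using Nt_extend[OF p Nt_N[OF p s(2)] Sc_num[OF p, of n] N_num[OF p, of w]] by blast
      have keep: "Nt p s' (num p k) u" if "Nt p s (num p k) u" "k \<le> n" for k u
        using s'(1)[of "num p k" u] that by (auto simp: Lt_num[OF p] le_less)
      have "step p (num p x) s' (num p k)" if k: "k < n" for k
      proof -
        have "step p (num p x) s (num p k)" using s(1) k by (auto simp: run_def Lt_num[OF p])
        then obtain y i' y' u v where *: "Nt p s (num p k) y" "Sc p (num p k) i'" "Nt p s i' y'"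
          "Pr p y (num p x) u" "Pr p (num p k) u v" "QG p v y'" unfolding step_def by blast
        moreover have "i' = num p (Suc k)" using *(2) by (simp only: Sc_num_iff[OF p])
        ultimately have "Nt p s' (num p k) y" "Nt p s' i' y'"
          using keep[of k y] keep[of "Suc k" y'] k by (auto simp del: num.simps)
        with * show ?thesis unfolding step_def by blast
      qed
      moreover have "\<exists>y. QF p (num p x) y \<and> Nt p s' (p 0) y"
        using s(1) keep[of 0] by (auto simp: run_def)
      ultimately have "run p (num p n) (num p x) s'"
        unfolding run_def Lt_num[OF p] by blast
      moreover have "step p (num p x) s' (num p n)"
        using step_n[OF keep[OF s(2) order_refl]] s'(2) by blast
      ultimately show "\<exists>s. run p (num p (Suc n)) (num p x) s \<and> Nt p s (num p (Suc n)) z"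
        unfolding run_Suc using s'(2) z by blast
    qed
  qed
  show ?thesis
  proof (rule repI)
    show "uniformly_def M (\<lambda>p e. \<exists>n x. Pr p n x (e 0) \<and> (\<exists>s. run p n x s \<and> Nt p s n (e 1)))"
      unfolding run_def step_def
      by (intro arith_intros uniformly_def_inst2[OF F(1)] uniformly_def_inst2[OF G(1)])
    fix p c y z
    assume p: "arith p" and "\<exists>n x. c = prod_encode (n, x) \<and> prec F G n x y"
    then obtain n x where "c = prod_encode (n, x)" "prec F G n x y" by blast
    then show "(\<exists>n x. Pr p n x (num p c) \<and> (\<exists>s. run p n x s \<and> Nt p s n z)) \<longleftrightarrow> z = num p y"
      using main[OF p] by (auto simp: Pr_num[OF p])
  qed
qed

text \<open>A candidate is compared with the true minimum by linearity. If smaller, it is standard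
  and its value is a nonzero numeral. If larger, even nonstandard, the minimality clause applied to
  the true minimum would require a nonzero value there.\<close>

lemma rep_min:
  assumes "rep F"
  shows "rep (\<lambda>x n. F (prod_encode (n, x)) 0 \<and> (\<forall>m<n. \<exists>y. F (prod_encode (m, x)) (Suc y)))"
proof -
  obtain Q where Q: "uniformly_def M (\<lambda>p e. Q p (e 0) (e 1))"
      "\<And>p x y z. arith p \<Longrightarrow> F x y \<Longrightarrow> Q p (num p x) z \<longleftrightarrow> z = num p y"
    using repE[OF assms] by blast
  show ?thesis
  proof (rule repI)
    show "uniformly_def M (\<lambda>p e. (\<exists>u. Pr p (e 1) (e 0) u \<and> Q p u (p 0)) \<and>
        (\<forall>m. Lt p m (e 1) \<longrightarrow> (\<exists>u w. Pr p m (e 0) u \<and> Q p u w \<and> \<not> w = p 0)))"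
      by (intro arith_intros uniformly_def_inst2[OF Q(1)])
    fix p x n z
    assume p: "arith p"
      and F: "F (prod_encode (n, x)) 0 \<and> (\<forall>m<n. \<exists>y. F (prod_encode (m, x)) (Suc y))"
    have Qn: "Q p (num p (prod_encode (n, x))) w \<longleftrightarrow> w = p 0" for w
      using Q(2)[OF p] F by auto
    have Qm: "\<exists>y. \<forall>w. Q p (num p (prod_encode (m, x))) w \<longleftrightarrow> w = num p (Suc y)" if "m < n" for m
      using Q(2)[OF p] F that by meson
    show "(\<exists>u. Pr p z (num p x) u \<and> Q p u (p 0)) \<and>
        (\<forall>m. Lt p m z \<longrightarrow> (\<exists>u w. Pr p m (num p x) u \<and> Q p u w \<and> \<not> w = p 0)) \<longleftrightarrow> z = num p n"
      (is "?L \<longleftrightarrow> _")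
    proof
      assume L: ?L
      then have "N p z" using Pr_N[OF p] by blast
      then consider "Lt p z (num p n)" | "z = num p n" | "Lt p (num p n) z"
        using Lt_linear[OF p _ N_num[OF p]] by blast
      then show "z = num p n"
      proof cases
        case 1
        then obtain m where m: "m < n" "z = num p m" by (auto simp: Lt_num[OF p])
        then have "Q p (num p (prod_encode (m, x))) (p 0)" using L by (simp add: Pr_num_iff[OF p])
        then show ?thesis using Qm[OF m(1)] num_Suc_neq_zero[OF p] by metis
      next
        case 3
        with L obtain u w where "Pr p (num p n) (num p x) u" "Q p u w" "w \<noteq> p 0" by blast
        then have "\<exists>w. Q p (num p (prod_encode (n, x))) w \<and> w \<noteq> p 0"
          by (auto simp: Pr_num_iff[OF p])
        then show ?thesis using Qn by simp
      qed
    next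
      assume z: "z = num p n"
      have "\<exists>w. Q p (num p (prod_encode (m, x))) w \<and> w \<noteq> p 0" if "m < n" for m
        using Qm[OF that] num_Suc_neq_zero[OF p] by metis
      then show ?L unfolding z by (auto simp: Pr_num_iff[OF p] Lt_num[OF p] Qn)
    qed
  qed
qed

definition rep_fun :: "(nat \<Rightarrow> nat) \<Rightarrow> bool" where
  "rep_fun h \<longleftrightarrow> rep (\<lambda>x y. y = h x)"

lemma rep_fun_comp: "rep_fun h \<Longrightarrow> rep_fun k \<Longrightarrow> rep_fun (\<lambda>x. h (k x))"
  unfolding rep_fun_def using rep_comp[of "\<lambda>x y. y = h x" "\<lambda>x y. y = k x"] by simp

lemma rep_fun_id: "rep_fun (\<lambda>x. x)"
  unfolding rep_fun_def by (rule rep_id)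

lemma rep_fun_Suc: "rep_fun h \<Longrightarrow> rep_fun (\<lambda>x. Suc (h x))"
  using rep_fun_comp[of Suc h] rep_Suc by (simp add: rep_fun_def)

lemma rep_fun_const: "rep_fun (\<lambda>_. k)"
proof (induction k)
  case 0
  show ?case using rep_zero by (simp add: rep_fun_def)
qed (rule rep_fun_Suc)

lemma rep_fun_pair: "rep_fun h \<Longrightarrow> rep_fun k \<Longrightarrow> rep_fun (\<lambda>x. prod_encode (h x, k x))"
  unfolding rep_fun_def using rep_pair[of "\<lambda>x y. y = h x" "\<lambda>x y. y = k x"] by simp

lemma rep_fun_fst: "rep_fun (\<lambda>x. fst (prod_decode x))"
  unfolding rep_fun_def by (rule rep_mono[OF rep_fst]) (metis prod.collapse prod_decode_inverse)

lemma rep_fun_snd: "rep_fun (\<lambda>x. snd (prod_decode x))"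
  unfolding rep_fun_def by (rule rep_mono[OF rep_snd]) (metis prod.collapse prod_decode_inverse)

lemmas rep_fun_intros = rep_fun_id rep_fun_const rep_fun_Suc rep_fun_pair
  rep_fun_comp[OF rep_fun_fst] rep_fun_comp[OF rep_fun_snd]

lemma rep_fun_iterate:
  assumes "rep_fun k"
  shows "rep_fun (\<lambda>n. (k ^^ n) c)"
proof -
  \<comment> \<open>The recursion parameter is a dummy: the step reads the previous value only, as
    the first component of the second component. At the end the parameter is filled with
    \<open>n\<close> itself.\<close>
  let ?F = "\<lambda>x y. y = c" and ?G = "\<lambda>x y. y = k (fst (prod_decode (snd (prod_decode x))))"
  have "prec ?F ?G n x ((k ^^ n) c)" for n x
    by (induction n) (auto intro!: prec.intros)
  moreover have "rep ?F" "rep ?G"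
    using rep_fun_const[of c] rep_fun_comp[OF assms, of "\<lambda>x. fst (prod_decode (snd (prod_decode x)))"]
      rep_fun_comp[OF rep_fun_fst rep_fun_snd] by (simp_all add: rep_fun_def)
  from rep_prec[OF this] have "rep (\<lambda>z y. \<exists>n x. z = prod_encode (n, x) \<and> prec ?F ?G n x y)" .
  ultimately have "rep_fun (\<lambda>z. (k ^^ fst (prod_decode z)) c)"
    unfolding rep_fun_def by (elim rep_mono) (metis prod.collapse prod_decode_inverse)
  from rep_fun_comp[OF this, of "\<lambda>n. prod_encode (n, n)"] show ?thesis
    by (simp add: rep_fun_intros)
qed

section \<open>Partial recursive functions\<close>

abbreviation computes_code :: "recfun \<Rightarrow> nat \<Rightarrow> nat \<Rightarrow> bool" where
  "computes_code f x y \<equiv> computes f (list_decode x) y"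

inductive_cases computes_RZeroE: "computes RZero xs y"
inductive_cases computes_RSuccE: "computes RSucc xs y"
inductive_cases computes_RProjE: "computes (RProj i) xs y"
inductive_cases computes_RCompE: "computes (RComp f gs) xs y"
inductive_cases computes_RPrecE: "computes (RPrec f g) xs y"
inductive_cases computes_RPrec_0E: "computes (RPrec f g) (0 # xs) y"
inductive_cases computes_RPrec_SucE: "computes (RPrec f g) (Suc n # xs) y"
inductive_cases computes_RMinE: "computes (RMin f) xs y"

lemma list_decode_eq_Cons: "list_decode x = a # as \<longleftrightarrow> x = Suc (prod_encode (a, list_encode as))"
  by (metis list_decode_inverse list_encode.simps(2) list_encode_inverse)

lemma rep_nth: "rep (\<lambda>x y. i < length (list_decode x) \<and> y = list_decode x ! i)"
proof (induction i)
  case 0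
  show ?case
  proof (rule rep_mono[OF rep_comp[OF rep_fst rep_pred]])
    fix x y assume "0 < length (list_decode x) \<and> y = list_decode x ! 0"
    then obtain as where "list_decode x = y # as" by (cases "list_decode x") auto
    then show "\<exists>u. x = Suc u \<and> (\<exists>b. u = prod_encode (y, b))"
      by (auto simp: list_decode_eq_Cons)
  qed
next
  case (Suc i)
  show ?case
  proof (rule rep_mono[OF rep_comp[OF Suc rep_comp[OF rep_snd rep_pred]]])
    fix x y assume *: "Suc i < length (list_decode x) \<and> y = list_decode x ! Suc i"
    then obtain a as where "list_decode x = a # as" by (cases "list_decode x") auto
    with * show "\<exists>t. (\<exists>u. x = Suc u \<and> (\<exists>a. u = prod_encode (a, t))) \<and>
        i < length (list_decode t) \<and> y = list_decode t ! i"
      by (intro exI[of _ "list_encode as"]) (auto simp: list_decode_eq_Cons)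
  qed
qed

text \<open>\<open>prec\<close> passes the nested pair of counter, value and parameter, whereas the
  code of \<open>n # y # xs\<close> has a successor at each cons. The function inserted before
  \<open>g\<close> adds these two successors.\<close>

lemma computes_RPrec_imp_prec:
  assumes "computes (RPrec f g) (n # xs) y"
  shows "prec (computes_code f) (\<lambda>v. computes_code g (Suc (prod_encode (fst (prod_decode v),
    Suc (snd (prod_decode v)))))) n (list_encode xs) y"
  using assms
proof (induction n arbitrary: y)
  case 0
  then show ?case by (auto elim!: computes_RPrec_0E intro!: prec.intros(1))
next
  case (Suc n)
  then obtain w where w: "computes (RPrec f g) (n # xs) w" "computes g (n # w # xs) y"
    by (auto elim: computes_RPrec_SucE)
  show ?case
    by (rule prec.intros(2)[OF Suc.IH[OF w(1)]]) (use w(2) in simp)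
qed

text \<open>By \<open>rep_mono\<close>, each case needs only an inclusion of the computation graph
  in a relation already known to be representable.\<close>

lemma rep_computes: "rep (computes_code f)"
proof (induction f)
  case RZero
  show ?case by (rule rep_mono[OF rep_zero]) (auto elim: computes_RZeroE)
next
  case RSucc
  show ?case
    by (rule rep_mono[OF rep_comp[OF rep_Suc rep_nth[of 0]]]) (auto elim!: computes_RSuccE)
next
  case (RProj i)
  show ?case by (rule rep_mono[OF rep_nth[of i]]) (auto elim: computes_RProjE)
next
  case (RComp f gs)
  \<comment> \<open>The inner induction runs over \<open>hs\<close> with entries taken from
    \<open>gs\<close>, so that the outer induction hypothesis stays available for each of
    them.\<close>
  have "rep (\<lambda>x w. \<exists>ys. w = list_encode ys \<and> list_all2 (\<lambda>g y. computes g (list_decode x) y) hs ys)"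
    if "set hs \<subseteq> set gs" for hs
    using that
  proof (induction hs)
    case Nil
    show ?case by (rule rep_mono[OF rep_zero]) auto
  next
    case (Cons h hs)
    then have "rep (computes_code h)" and
      "rep (\<lambda>x w. \<exists>ys. w = list_encode ys \<and> list_all2 (\<lambda>g y. computes g (list_decode x) y) hs ys)"
      using RComp.IH(2) by simp_all
    from rep_comp[OF rep_Suc rep_pair[OF this]] show ?case
    proof (rule rep_mono)
      fix x w assume "\<exists>ys. w = list_encode ys \<and> list_all2 (\<lambda>g y. computes g (list_decode x) y) (h # hs) ys"
      then obtain y ys where "w = Suc (prod_encode (y, list_encode ys))" "computes_code h x y"
        "list_all2 (\<lambda>g y. computes g (list_decode x) y) hs ys"
        by (auto simp: list_all2_Cons1)
      then show "\<exists>u. (\<exists>a b. computes_code h x a \<and>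
          (\<exists>ys. b = list_encode ys \<and> list_all2 (\<lambda>g y. computes g (list_decode x) y) hs ys) \<and>
          u = prod_encode (a, b)) \<and> w = Suc u"
        by blast
    qed
  qed
  from rep_comp[OF RComp.IH(1) this[OF order_refl]] show ?case
  proof (rule rep_mono)
    fix x z assume "computes_code (RComp f gs) x z"
    then obtain ys where "list_all2 (\<lambda>g y. computes g (list_decode x) y) gs ys" "computes f ys z"
      by (auto elim: computes_RCompE)
    then show "\<exists>w. (\<exists>ys. w = list_encode ys \<and> list_all2 (\<lambda>g y. computes g (list_decode x) y) gs ys) \<and>
        computes_code f w z"
      by (intro exI[of _ "list_encode ys"]) auto
  qed
next
  case (RPrec f g)
  have "rep_fun (\<lambda>v. Suc (prod_encode (fst (prod_decode v), Suc (snd (prod_decode v)))))"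
    by (intro rep_fun_intros)
  from rep_comp[OF RPrec.IH(2) this[unfolded rep_fun_def]]
  have "rep (\<lambda>v. computes_code g (Suc (prod_encode (fst (prod_decode v), Suc (snd (prod_decode v))))))"
    by simp
  from rep_comp[OF rep_prec[OF RPrec.IH(1) this] rep_pred] show ?case
  proof (rule rep_mono)
    fix x y assume *: "computes_code (RPrec f g) x y"
    then obtain n xs where "list_decode x = n # xs" by (auto elim: computes_RPrecE)
    with computes_RPrec_imp_prec[of f g n xs y] *
    show "\<exists>u. x = Suc u \<and> (\<exists>n x. u = prod_encode (n, x) \<and> prec (computes_code f)
        (\<lambda>v. computes_code g (Suc (prod_encode (fst (prod_decode v), Suc (snd (prod_decode v)))))) n x y)"
      by (auto simp: list_decode_eq_Cons)
  qed
next
  case (RMin f)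
  from rep_min[OF rep_comp[OF RMin.IH rep_Suc]] show ?case
    by (rule rep_mono) (auto elim!: computes_RMinE)
qed

text \<open>\<open>sf\<close> relates a predecessor at index 2 to the value at index 0, and index 1
  holds zero. Copying the predecessor back to index 0 reuses the same variables at each level, so
  the free variables stay bounded and the code is an iterate of one fixed function.\<close>

primrec numeral_fm :: "('f, 'r) fm \<Rightarrow> nat \<Rightarrow> ('f, 'r) fm" where
  "numeral_fm sf 0 = Eq (Var 0) (Var 1)"
| "numeral_fm sf (Suc n) = Ex 2 (Conj sf (Ex 0 (Conj (Eq (Var 0) (Var 2)) (numeral_fm sf n))))"

lemma sat_numeral_fm:
  assumes p: "arith p" and sf: "\<And>e. sat M (interleave e p) sf \<longleftrightarrow> Sc p (e 1) (e 0)"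
  shows "sat M (interleave e p) (numeral_fm sf n) \<longleftrightarrow> e 0 = num p n"
proof (induction n arbitrary: e)
  case 0
  show ?case by simp
next
  case (Suc n)
  have upd: "(interleave e p)(2 := a) = interleave (e(1 := a)) p"
      "(interleave e p)(0 := a) = interleave (e(0 := a)) p" for e :: "nat \<Rightarrow> real" and a
    by (auto simp: interleave_def fun_eq_iff elim!: evenE)
  have at: "interleave e p 2 = e 1" for e :: "nat \<Rightarrow> real"
    by (simp add: interleave_def)
  have "sat M (interleave e p) (numeral_fm sf (Suc n)) \<longleftrightarrow> Sc p (num p n) (e 0)"
    by (simp add: upd sf Suc.IH at)
  then show ?case by (simp add: Sc_num_iff[OF p] del: num.simps)
qed

lemma fv_numeral_fm: "fv_fm (numeral_fm sf n) \<subseteq> fv_fm sf \<union> {0, 1}"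
  by (induction n) auto

lemma wf_numeral_fm: "wf_fm M sf \<Longrightarrow> wf_fm M (numeral_fm sf n)"
  by (induction n) auto

section \<open>Existential closure and diagonalization\<close>

lemma sat_foldr_Ex:
  assumes "fv_fm \<phi> \<subseteq> set vs"
  shows "sat M e (foldr Ex vs \<phi>) \<longleftrightarrow> (\<exists>e'. sat M e' \<phi>)"
proof -
  have "sat M e (foldr Ex vs \<phi>) \<longleftrightarrow> (\<exists>e'. (\<forall>v. v \<notin> set vs \<longrightarrow> e' v = e v) \<and> sat M e' \<phi>)"
  proof (induction vs arbitrary: e)
    case Nil
    have "(\<forall>v. e' v = e v) \<longleftrightarrow> e' = e" for e' by auto
    then show ?case by simp
  next
    case (Cons v vs)
    show ?case
    proof
      assume "sat M e (foldr Ex (v # vs) \<phi>)"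
      then obtain a e' where "\<forall>u. u \<notin> set vs \<longrightarrow> e' u = (e(v := a)) u" "sat M e' \<phi>"
        by (auto simp: Cons.IH)
      then show "\<exists>e'. (\<forall>u. u \<notin> set (v # vs) \<longrightarrow> e' u = e u) \<and> sat M e' \<phi>"
        by (intro exI[of _ e']) auto
    next
      assume "\<exists>e'. (\<forall>u. u \<notin> set (v # vs) \<longrightarrow> e' u = e u) \<and> sat M e' \<phi>"
      then obtain e' where "\<forall>u. u \<notin> set (v # vs) \<longrightarrow> e' u = e u" "sat M e' \<phi>" by blast
      then have "sat M (e(v := e' v)) (foldr Ex vs \<phi>)"
        unfolding Cons.IH by (intro exI[of _ e']) auto
      then show "sat M e (foldr Ex (v # vs) \<phi>)" by auto
    qed
  qed
  also have "\<dots> \<longleftrightarrow> (\<exists>e'. sat M e' \<phi>)"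
  proof
    assume "\<exists>e'. sat M e' \<phi>"
    then obtain e' where e': "sat M e' \<phi>" by blast
    have "sat M (\<lambda>v. if v \<in> set vs then e' v else e v) \<phi> = sat M e' \<phi>"
      by (rule sat_cong) (use assms in auto)
    with e' show "\<exists>e'. (\<forall>v. v \<notin> set vs \<longrightarrow> e' v = e v) \<and> sat M e' \<phi>"
      by (intro exI[of _ "\<lambda>v. if v \<in> set vs then e' v else e v"]) auto
  qed blast
  finally show ?thesis .
qed

lemma wf_foldr_Ex: "wf_fm M (foldr Ex vs \<phi>) = wf_fm M \<phi>"
  by (induction vs) auto

lemma fv_foldr_Ex: "fv_fm (foldr Ex vs \<phi>) = fv_fm \<phi> - set vs"
  by (induction vs) auto

text \<open>
  Diagonalization: if truth were decidable, then a formula \<open>\<theta>(v)\<close> would represent the set of all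
  \<open>n\<close> such that the sentence \<open>\<exists>p. arith p \<and> \<theta>\<^sub>n(n)\<close> is false, where \<open>n\<close> is the code of \<open>\<theta>\<^sub>n\<close>;
  now take for \<open>n\<close> the code of \<open>\<theta>\<close>. The quantified parameters are bounded in advance by the
  variables of \<open>arith\<close>, and \<open>clip\<close> rewrites \<open>\<theta>\<close> to use no others.
\<close>

lemma undecidable:
  assumes "arith p\<^sub>0"
  shows "\<not> has_decidable_theory M"
proof
  assume "has_decidable_theory M"
  then obtain cf cr f where inj: "inj_on cf (fun_syms M)" "inj_on cr (rel_syms M)"
    and f: "\<And>n. computes f [n] (if n \<in> fm_code cf cr ` theory_of M then 1 else 0)"
    unfolding has_decidable_theory_def recursive_set_def by blast
  define T where "T = fm_code cf cr ` theory_of M"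
  let ?code = "fm_code cf cr"
  obtain bf where bf: "wf_fm M bf" "\<And>p e. arith p \<longleftrightarrow> sat M (interleave e p) bf"
    using uniformly_defE[OF uniformly_def_arith] by blast
  obtain sf where sf: "wf_fm M sf" "\<And>p e. Sc p (e 1) (e 0) \<longleftrightarrow> sat M (interleave e p) sf"
    using uniformly_defE[OF uniformly_def_inst2[OF Sc is_var_simps(1) is_var_simps(1)]] by blast
  obtain m where m: "fv_fm bf \<union> fv_fm sf \<union> {0, 1} \<subseteq> {..<2 * m}"
  proof -
    have "finite (fv_fm bf \<union> fv_fm sf \<union> {0, 1})" by (simp add: finite_fv_fm)
    then obtain k where "fv_fm bf \<union> fv_fm sf \<union> {0, 1} \<subseteq> {..<k}"
      using finite_nat_iff_bounded by blast
    then show thesis by (intro that[of k]) fastforce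
  qed
  define vs where "vs = [0..<2 * m]"
  define \<sigma> where "\<sigma> n \<phi> = foldr Ex vs (Conj bf (Conj (numeral_fm sf n) \<phi>))" for n \<phi>
  \<comment> \<open>The effect of one level of \<open>numeral_fm\<close> on codes; the tags 4, 3 and
    0 belong to \<open>Ex\<close>, \<open>Conj\<close> and \<open>Eq\<close>.\<close>
  define K where "K d = prod_encode (4, prod_encode (2, prod_encode (3, prod_encode (?code sf,
      prod_encode (4, prod_encode (0, prod_encode (3, prod_encode
        (prod_encode (0, prod_encode (prod_encode (0, 0), prod_encode (0, 2))), d))))))))" for d
  define exs where "exs us c = foldr (\<lambda>v c. prod_encode (4, prod_encode (v, c))) us c" for us c
  define g where "g n = exs vs (prod_encode (3, prod_encode (?code bf,
      prod_encode (3, prod_encode ((K ^^ n) (?code (Eq (Var 0) (Var 1))), n)))))" for n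
  have code_numeral: "?code (numeral_fm sf n) = (K ^^ n) (?code (Eq (Var 0) (Var 1)))" for n
    by (induction n) (simp_all add: K_def)
  have code_exs: "?code (foldr Ex us \<phi>) = exs us (?code \<phi>)" for us \<phi>
    by (induction us) (simp_all add: exs_def)
  have code_\<sigma>: "?code (\<sigma> (?code \<phi>) \<phi>) = g (?code \<phi>)" for \<phi>
    unfolding \<sigma>_def code_exs g_def by (simp only: fm_code.simps code_numeral)
  have "rep_fun K" unfolding K_def by (intro rep_fun_intros)
  have rep_exs: "rep_fun (\<lambda>x. exs us (h x))" if "rep_fun h" for us h
    unfolding exs_def
  proof (induction us)
    case (Cons u us)
    then show ?case unfolding foldr.simps comp_def by (intro rep_fun_pair rep_fun_const)
  qed (simp add: that)
  have "rep_fun g"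
    unfolding g_def by (intro rep_exs rep_fun_intros rep_fun_iterate[OF \<open>rep_fun K\<close>])
  \<comment> \<open>\<open>Suc (prod_encode (x, 0))\<close> is the code of the one-element list
    \<open>[x]\<close>, the input format of \<open>f\<close>.\<close>
  then have "rep_fun (\<lambda>n. Suc (prod_encode (g n, 0)))" by (intro rep_fun_intros)
  from rep_comp[OF rep_computes[of f] this[unfolded rep_fun_def]]
  have "rep (\<lambda>n y. computes f [g n] y)" by simp
  then have rep_T: "rep (\<lambda>n y. y = (if g n \<in> T then 1 else 0))"
    by (rule rep_mono) (use f in \<open>simp add: T_def\<close>)
  obtain Q where Q: "uniformly_def M (\<lambda>p e. Q p (e 0) (e 1))"
      "\<And>p n y z. arith p \<Longrightarrow> y = (if g n \<in> T then 1 else 0) \<Longrightarrow> Q p (num p n) z \<longleftrightarrow> z = num p y"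
    using repE[OF rep_T] by blast
  have Q_zero: "Q p (num p n) (p 0) \<longleftrightarrow> g n \<notin> T" if "arith p" for p n
  proof (cases "g n \<in> T")
    case True
    then show ?thesis
      using Q(2)[OF that refl, of n "p 0"] num_Suc_neq_zero(2)[OF that, of 0] by (simp del: num.simps)
  next
    case False
    then show ?thesis using Q(2)[OF that refl, of n "p 0"] by simp
  qed
  \<comment> \<open>Output 0 is rejection, so under \<open>arith p\<close> this formula says that
    the sentence with code \<open>g n\<close> is not in the theory.\<close>
  obtain \<phi>\<^sub>0 where \<phi>\<^sub>0: "wf_fm M \<phi>\<^sub>0" "\<And>p e. Q p (e 0) (p 0) \<longleftrightarrow> sat M (interleave e p) \<phi>\<^sub>0"
    using uniformly_defE[OF uniformly_def_inst2[OF Q(1) is_var_simps(1,2)]] by blast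
  \<comment> \<open>All variables are read as the first one, and all parameters from
    \<open>m\<close> on as \<open>p 0\<close>, which sits at index 1.\<close>
  define \<rho> where "\<rho> = interleave (\<lambda>_. 0) (\<lambda>i. if i < m then Suc (2 * i) else 1)"
  define clip where "clip p i = (if i < m then p i else p 0)" for p :: "nat \<Rightarrow> real" and i
  define \<theta> where "\<theta> = sub_fm \<rho> \<phi>\<^sub>0"
  have wf_\<theta>: "wf_fm M \<theta>" by (simp add: \<theta>_def wf_sub_fm \<phi>\<^sub>0(1))
  have "0 < m" using m by (cases m) auto
  then have "\<rho> i < 2 * m" for i by (auto simp: \<rho>_def interleave_def)
  then have fv_\<theta>: "fv_fm \<theta> \<subseteq> {..<2 * m}"
    using fv_sub_fm[of \<rho> \<phi>\<^sub>0] by (auto simp: \<theta>_def)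
  have sat_\<theta>: "sat M (interleave e p) \<theta> \<longleftrightarrow> Q (clip p) (e 0) (p 0)" for e p
  proof -
    have "(\<lambda>i. interleave e p (\<rho> i)) = interleave (\<lambda>_. e 0) (clip p)"
      by (auto simp: \<rho>_def interleave_def clip_def fun_eq_iff)
    then show ?thesis
      using \<phi>\<^sub>0(2)[of "clip p" "\<lambda>_. e 0"] \<open>0 < m\<close> by (simp add: \<theta>_def sat_sub_fm clip_def)
  qed
  have clip_cong: "sat M (interleave e (clip p)) \<phi> = sat M (interleave e p) \<phi>"
    if "fv_fm \<phi> \<subseteq> {..<2 * m}" for e p \<phi>
    by (rule sat_cong) (use that in \<open>auto simp: interleave_def clip_def\<close>)
  have arith_clip: "arith (clip p) \<longleftrightarrow> arith p" for p
    using clip_cong[of bf undefined p] m by (simp flip: bf(2))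
  have numeral: "sat M (interleave e p) (numeral_fm sf n) \<longleftrightarrow> e 0 = num (clip p) n"
    if "arith p" for e p n
  proof -
    have "fv_fm (numeral_fm sf n) \<subseteq> {..<2 * m}" using fv_numeral_fm[of sf n] m by blast
    from clip_cong[OF this, of e p] show ?thesis
      using sat_numeral_fm[of "clip p" sf e n] that by (simp add: arith_clip flip: sf(2))
  qed
  have \<sigma>_T: "g (?code \<theta>) \<in> T \<longleftrightarrow>
      (\<exists>(e :: nat \<Rightarrow> real) p. arith p \<and> e 0 = num (clip p) (?code \<theta>) \<and> Q (clip p) (e 0) (p 0))"
  proof -
    let ?\<sigma> = "\<sigma> (?code \<theta>) \<theta>" and ?\<psi> = "Conj bf (Conj (numeral_fm sf (?code \<theta>)) \<theta>)"
    have wf: "wf_fm M ?\<sigma>"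
      by (simp add: \<sigma>_def wf_foldr_Ex bf(1) wf_numeral_fm[OF sf(1)] wf_\<theta>)
    have "fv_fm (numeral_fm sf (?code \<theta>)) \<subseteq> {..<2 * m}"
      using fv_numeral_fm[of sf "?code \<theta>"] m by blast
    then have fv: "fv_fm ?\<psi> \<subseteq> set vs"
      using m fv_\<theta> by (simp add: vs_def atLeast0LessThan)
    have sat_\<psi>: "sat M (interleave e p) ?\<psi> \<longleftrightarrow>
        arith p \<and> e 0 = num (clip p) (?code \<theta>) \<and> Q (clip p) (e 0) (p 0)" for e p
      using numeral[of p e "?code \<theta>"] by (auto simp: sat_\<theta> simp flip: bf(2))
    have "g (?code \<theta>) \<in> T \<longleftrightarrow> ?code ?\<sigma> \<in> ?code ` theory_of M"
      by (simp add: T_def code_\<sigma>)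
    also have "\<dots> \<longleftrightarrow> ?\<sigma> \<in> theory_of M"
    proof
      assume "?code ?\<sigma> \<in> ?code ` theory_of M"
      then obtain \<psi> where "\<psi> \<in> theory_of M" "?code ?\<sigma> = ?code \<psi>" by blast
      moreover from this have "?\<sigma> = \<psi>"
        by (intro fm_code_inj[OF inj wf]) (auto simp: theory_of_def)
      ultimately show "?\<sigma> \<in> theory_of M" by simp
    qed simp
    also have "\<dots> \<longleftrightarrow> (\<exists>e'. sat M e' ?\<psi>)"
      using wf fv unfolding theory_of_def \<sigma>_def mem_Collect_eq sat_foldr_Ex[OF fv] fv_foldr_Ex by blast
    also have "\<dots> \<longleftrightarrow> (\<exists>e p. sat M (interleave e p) ?\<psi>)"
    proof -
      have "e' = interleave (\<lambda>i. e' (2 * i)) (\<lambda>i. e' (Suc (2 * i)))" for e' :: "nat \<Rightarrow> real"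
        by (auto simp: interleave_def fun_eq_iff)
      then show ?thesis by metis
    qed
    finally show ?thesis by (simp only: sat_\<psi>)
  qed
  have Q_diag: "Q (clip p) (num (clip p) (?code \<theta>)) (p 0) \<longleftrightarrow> g (?code \<theta>) \<notin> T" if "arith p" for p
    using Q_zero[of "clip p" "?code \<theta>"] that \<open>0 < m\<close> by (simp add: arith_clip) (simp add: clip_def)
  show False
  proof (cases "g (?code \<theta>) \<in> T")
    case True
    then obtain e :: "nat \<Rightarrow> real" and p where "arith p" "e 0 = num (clip p) (?code \<theta>)" "Q (clip p) (e 0) (p 0)"
      using \<sigma>_T by blast
    then show False using Q_diag[of p] True by simp
  next
    case False
    \<comment> \<open>The diagonal sentence asserts that suitable parameters exist, so its truth
      needs an actual witness; \<open>p\<^sub>0\<close> provides it.\<close>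
    then have "Q (clip p\<^sub>0) (num (clip p\<^sub>0) (?code \<theta>)) (p\<^sub>0 0)" using Q_diag[OF assms] by simp
    then show False
      using False assms \<sigma>_T by (auto dest!: spec[of _ "\<lambda>_. num (clip p\<^sub>0) (?code \<theta>)"])
  qed
qed

end

lemma (in arith_interpretation) arith_standard:
  assumes inj: "inj enc" and zero: "p 0 = enc 0"
    and N: "\<And>x. N p x \<longleftrightarrow> x \<in> range enc"
    and Sc: "\<And>x y. Sc p x y \<longleftrightarrow> suc_rel enc x y"
    and Lt: "\<And>x y. Lt p x y \<longleftrightarrow> less_rel enc x y"
    and Pr: "\<And>x y z. Pr p x y z \<longleftrightarrow> pair_rel enc x y z"
    and Nt: "\<And>x y z. Nt p x y z \<longleftrightarrow> nth_rel enc x y z"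
  shows "arith p"
proof -
  note eq = inj_eq[OF inj]
  have Sc_enc: "suc_rel enc (enc i) y \<longleftrightarrow> y = enc (Suc i)" "suc_rel enc x (enc (Suc i)) \<longleftrightarrow> x = enc i" for i x y
    by (auto simp: suc_rel_def eq)
  have Pr_Suc: "pair_rel enc x y z' \<longleftrightarrow>
        (\<exists>x' y'. suc_rel enc x' x \<and> suc_rel enc y y' \<and> pair_rel enc x' y' z) \<or>
        x = enc 0 \<and> (\<exists>y'. suc_rel enc y' y \<and> pair_rel enc y' (enc 0) z)" (is "_ \<longleftrightarrow> ?A \<or> ?B")
    if zz': "suc_rel enc z z'" for x y z z'
  proof -
    obtain k where k: "z = enc k" "z' = enc (Suc k)" using zz' by (auto simp: suc_rel_def)
    show ?thesis
    proof
      assume "pair_rel enc x y z'"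
      then obtain i j where ij: "x = enc i" "y = enc j" "Suc k = prod_encode (i, j)"
        by (auto simp: pair_rel_def k eq)
      show "?A \<or> ?B"
      proof (cases i)
        case 0
        then obtain j' where "j = Suc j'" "k = prod_encode (j', 0)"
          using ij(3) by (cases j) (auto simp: prod_encode_walk)
        then have ?B using 0 ij by (auto simp: suc_rel_def pair_rel_def k)
        then show ?thesis ..
      next
        case (Suc i')
        then have "k = prod_encode (i', Suc j)" using ij(3) by (simp add: prod_encode_walk)
        then have ?A using Suc ij by (auto simp: suc_rel_def pair_rel_def k)
        then show ?thesis ..
      qed
    next
      assume "?A \<or> ?B"
      then show "pair_rel enc x y z'"
        by (auto simp: suc_rel_def pair_rel_def k eq)
          (metis prod_encode_walk(1), metis prod_encode_walk(2))
    qed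
  qed
  have zero_pair: "pair_rel enc x y (enc 0) \<longleftrightarrow> x = enc 0 \<and> y = enc 0" for x y
  proof -
    have "0 = prod_encode (i, j) \<longleftrightarrow> i = 0 \<and> j = 0" for i j
      using le_prod_encode_1[of i j] le_prod_encode_2[of j i] by (auto simp: prod_encode_def)
    then show ?thesis by (auto simp: pair_rel_def eq)
  qed
  have start: "\<exists>c. nth_rel enc c (enc 0) v" if v: "v \<in> range enc" for v
  proof -
    obtain k where "v = enc k" using v by blast
    then show ?thesis
      unfolding nth_rel_def by (intro exI[of _ "enc (list_encode [k])"] exI[of _ "list_encode [k]"] exI[of _ 0])
        (simp del: list_encode.simps)
  qed
  \<comment> \<open>The new list cuts the old one off after position \<open>n\<close>, pads it with
    zeros if it is shorter, and puts \<open>v\<close> at the next position.\<close>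
  have extend: "\<exists>c'. (\<forall>i w. (less_rel enc i n \<or> i = n) \<and> nth_rel enc c i w \<longrightarrow> nth_rel enc c' i w) \<and>
      nth_rel enc c' n' v" if cnv: "c \<in> range enc" "suc_rel enc n n'" "v \<in> range enc" for c n n' v
  proof -
    obtain c0 n0 v0 where *: "c = enc c0" "n = enc n0" "n' = enc (Suc n0)" "v = enc v0"
      using cnv by (auto simp: suc_rel_def)
    define l where "l = map (\<lambda>i. if i < length (list_decode c0) then list_decode c0 ! i else 0) [0..<Suc n0] @ [v0]"
    have len: "length l = Suc (Suc n0)" by (simp add: l_def)
    have "nth_rel enc (enc (list_encode l)) n' v"
      unfolding nth_rel_def using len
      by (intro exI[of _ "list_encode l"] exI[of _ "Suc n0"]) (simp add: * l_def nth_append)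
    moreover have "nth_rel enc (enc (list_encode l)) i w"
      if iw: "less_rel enc i n \<or> i = n" "nth_rel enc c i w" for i w
    proof -
      obtain j where j: "i = enc j" "j \<le> n0" using iw(1) by (auto simp: less_rel_def * eq)
      then have "j < length (list_decode c0)" "w = enc (list_decode c0 ! j)"
        using iw(2) by (auto simp: nth_rel_def * eq)
      moreover have "l ! j = list_decode c0 ! j"
        using calculation(1) j(2) by (auto simp: l_def nth_append simp del: upt_Suc)
      ultimately show ?thesis
        unfolding nth_rel_def using len j
        by (intro exI[of _ "list_encode l"] exI[of _ j]) simp
    qed
    ultimately show ?thesis by blast
  qed
  show ?thesis
    unfolding arith_def arith_model_def N Sc Lt Pr Nt zero
  proof (intro conjI allI impI)
    show "\<exists>c'. (\<forall>i w. (less_rel enc i n \<or> i = n) \<and> nth_rel enc c i w \<longrightarrow> nth_rel enc c' i w) \<and>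
      nth_rel enc c' n' v" if "c \<in> range enc" "suc_rel enc n n'" "v \<in> range enc" for c n n' v
      by (rule extend[OF that])
  qed (simp_all add: Pr_Suc zero_pair start, auto simp: suc_rel_def less_rel_def pair_rel_def nth_rel_def eq less_Suc_eq)
qed

theorem corollary1p3:
  fixes R :: "('f, 'r) real_structure" and S :: "('g, 's) real_structure"
  assumes "expansion_of R real_group"
    and "generated_by_topological_submanifolds R"
    and "PCC R"
    and "\<not> o_minimal R"
    and "expansion_of S R"
  shows "\<not> has_decidable_theory S"
proof -
  obtain enc where inj: "inj enc"
    and R: "defp R (\<lambda>e. e 0 \<in> range enc)"
      "defp R (\<lambda>e. suc_rel enc (e 0) (e 1))" "defp R (\<lambda>e. less_rel enc (e 0) (e 1))"
      "defp R (\<lambda>e. pair_rel enc (e 0) (e 1) (e 2))" "defp R (\<lambda>e. nth_rel enc (e 0) (e 1) (e 2))"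
    using ex_definable_arithmetic[OF assms(3) defp_real_group[OF assms(1)] assms(4)] by blast
  \<comment> \<open>Each of the five relations involves at most three variables.\<close>
  note exp = defp_expansion[OF assms(5), where n = 3]
  have S: "defp S (\<lambda>e. e 0 \<in> range enc)"
      "defp S (\<lambda>e. suc_rel enc (e 0) (e 1))" "defp S (\<lambda>e. less_rel enc (e 0) (e 1))"
      "defp S (\<lambda>e. pair_rel enc (e 0) (e 1) (e 2))" "defp S (\<lambda>e. nth_rel enc (e 0) (e 1) (e 2))"
    by (rule exp[OF R(1)] exp[OF R(2)] exp[OF R(3)] exp[OF R(4)] exp[OF R(5)]; simp add: trunc_def)+
  obtain Q1 p1 where 1: "uniformly_def S Q1" "\<And>e. e 0 \<in> range enc \<longleftrightarrow> Q1 p1 e"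
    using defpE[OF S(1)] by blast
  obtain Q2 p2 where 2: "uniformly_def S Q2" "\<And>e. suc_rel enc (e 0) (e 1) \<longleftrightarrow> Q2 p2 e"
    using defpE[OF S(2)] by blast
  obtain Q3 p3 where 3: "uniformly_def S Q3" "\<And>e. less_rel enc (e 0) (e 1) \<longleftrightarrow> Q3 p3 e"
    using defpE[OF S(3)] by blast
  obtain Q4 p4 where 4: "uniformly_def S Q4" "\<And>e. pair_rel enc (e 0) (e 1) (e 2) \<longleftrightarrow> Q4 p4 e"
    using defpE[OF S(4)] by blast
  obtain Q5 p5 where 5: "uniformly_def S Q5" "\<And>e. nth_rel enc (e 0) (e 1) (e 2) \<longleftrightarrow> Q5 p5 e"
    using defpE[OF S(5)] by blast
  \<comment> \<open>The five parameter sequences are merged along the pairing function, shifted by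
    one because the parameter at index 0 is reserved for zero.\<close>
  define slice :: "nat \<Rightarrow> (nat \<Rightarrow> real) \<Rightarrow> nat \<Rightarrow> real" where
    "slice k p = (\<lambda>i. p (Suc (prod_encode (k, i))))" for k p
  define p where "p = case_nat (enc 0) (\<lambda>j. case prod_decode j of (k, i) \<Rightarrow> ([p1, p2, p3, p4, p5] ! k) i)"
  have slice: "slice 0 p = p1" "slice 1 p = p2" "slice 2 p = p3" "slice 3 p = p4" "slice 4 p = p5"
    by (simp_all add: slice_def p_def)
  \<comment> \<open>The \<open>Q\<close>-predicates take whole environments, the locale predicates
    of fixed arity. Capping indices by \<open>min\<close> repeats the last argument, which is
    harmless since at the chosen parameters the relations ignore the other variables.\<close>
  have inst: "uniformly_def S (\<lambda>p e. Q (slice k p) (\<lambda>i. e (min i n)))" if "uniformly_def S Q" for Q k n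
    unfolding slice_def
    by (rule uniformly_def_inst[OF uniformly_def_reindex_params[OF that], of "\<lambda>i p e. e (min i n)"])
      (rule is_var_simps)
  interpret arith_interpretation S
    "\<lambda>p x. Q1 (slice 0 p) (\<lambda>i. [x] ! min i 0)"
    "\<lambda>p x y. Q2 (slice 1 p) (\<lambda>i. [x, y] ! min i 1)"
    "\<lambda>p x y. Q3 (slice 2 p) (\<lambda>i. [x, y] ! min i 1)"
    "\<lambda>p x y z. Q4 (slice 3 p) (\<lambda>i. [x, y, z] ! min i 2)"
    "\<lambda>p x y z. Q5 (slice 4 p) (\<lambda>i. [x, y, z] ! min i 2)"
  proof
    have "[e 0] ! min i 0 = e (min i 0)" "[e 0, e 1] ! min i 1 = e (min i 1)"
      "[e 0, e 1, e 2] ! min i 2 = e (min i 2)" for e :: "nat \<Rightarrow> real" and i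
      by (auto simp: min_def nth_Cons' numeral_2_eq_2 le_Suc_eq)
    then show
      "uniformly_def S (\<lambda>p e. Q1 (slice 0 p) (\<lambda>i. [e 0] ! min i 0))"
      "uniformly_def S (\<lambda>p e. Q2 (slice 1 p) (\<lambda>i. [e 0, e 1] ! min i 1))"
      "uniformly_def S (\<lambda>p e. Q3 (slice 2 p) (\<lambda>i. [e 0, e 1] ! min i 1))"
      "uniformly_def S (\<lambda>p e. Q4 (slice 3 p) (\<lambda>i. [e 0, e 1, e 2] ! min i 2))"
      "uniformly_def S (\<lambda>p e. Q5 (slice 4 p) (\<lambda>i. [e 0, e 1, e 2] ! min i 2))"
      using inst[OF 1(1), of 0 0] inst[OF 2(1), of 1 1] inst[OF 3(1), of 2 1]
        inst[OF 4(1), of 3 2] inst[OF 5(1), of 4 2]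
      by simp_all
  qed
  have "arith p"
    by (rule arith_standard[OF inj])
      (simp_all only: slice 1(2)[symmetric] 2(2)[symmetric] 3(2)[symmetric] 4(2)[symmetric] 5(2)[symmetric],
       simp_all add: p_def)
  then show ?thesis by (rule undecidable)
qed

end
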